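(* Let $X$ be a compact complex manifold with $\dim_{\mathbb{C}} X = n = 2p+1$. Suppose that $X$ carries a holomorphic $p$-contact structure $\Gamma\in C^\infty_{p,0}(X,\mathbb{C})$. If $(X,\Gamma)$ is $p$-contact metrically hyperbolic, then $(X,\Gamma)$ is $p$-contact hyperbolic.
   Context: $C^\infty_{r,s}(X,\mathbb{C})$ denotes the space of smooth $\mathbb{C}$-valued $(r,s)$-forms on $X$. A holomorphic $p$-contact structure on a compact complex manifold $X$ with $\dim_{\mathbb{C}}X=n=2p+1$ is a form $\Gamma\in C^\infty_{p,0}(X,\mathbb{C})$ such that $\bar\partial\Gamma=0$ and $\Gamma\wedge\partial\Gamma\neq 0$ at every point of $X$. Weak strict positivity: a $(p,p)$-form $\Xi$ is weakly strictly positive at $x$ if $\Xi\wedge i\alpha_1\wedge\overline{\alpha}_1\wedge\dots\wedge i\alpha_{n-p}\wedge\overline{\alpha}_{n-p}$ is a positive $(n,n)$-form for every linearly independent family $\{\alpha_1,\dots,\alpha_{n-p}\}$ of $(1,0)$-forms at $x$. $p$-contact metrically hyperbolic: $(X,\Gamma)$ is so called if there exist a Hermitian metric $\omega$ and a real $C^\infty$ $(p,p)$-form $\Omega$ on $X$ such that: (i) $d\Omega=0$ and $\Omega$ is weakly strictly positive on $X$; (ii) $\frac{\omega^p}{p!}=i^{p^2}\,\Gamma\wedge\overline{\Gamma}+\Omega$ on $X$; (iii) if $\pi_X:\widetilde{X}\to X$ is the universal covering map, there exists a $C^\infty$ $(2p-1)$-form $\widetilde\beta$ on $\widetilde{X}$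 that is bounded with respect to $\widetilde\omega:=\pi_X^\star\omega$ and satisfies $\pi_X^\star\Omega=d\widetilde\beta$ on $\widetilde X$. Subexponential growth: let $\omega$ be a Hermitian metric on $X$, $q\in\{1,\dots,n-1\}$ and $f:\mathbb{C}^q\to X$ a holomorphic map that is non-degenerate at some point (its differential there is injective). Let $B_r$, $S_r$ be the open ball and the sphere of radius $r>0$ centred at $0$ in $\mathbb{C}^q$, $\tau(z)=|z|^2$, $\omega_q:=\omega^q/q!$, and $\mathrm{Vol}_{\omega,f}(B_r):=\int_{B_r}f^\star\omega_q$. Let $d\sigma_{\omega,f,r}$ be the area measure induced by $f^\star\omega$ on $S_r$, i.e. the restriction to $S_r$ of the $(2q-1)$-form $d\sigma_{\omega,f}=\star_{f^\star\omega}\big(d\tau/|d\tau|_{f^\star\omega}\big)$, characterised by $f^\star\omega_q=\frac{d\tau}{|d\tau|_{f^\star\omega}}\wedge d\sigma_{\omega,f}$ (defined away from the proper analytic subset where $f^\star\omega$ degenerates). The map $f$ has subexponential growth if: (i) there exist constants $C_1>0$ and $r_0>0$ such that $\int_{S_t}|d\tau|_{f^\star\omega}\,d\sigma_{\omega,f,t}\le C_1\,t\,\mathrm{Vol}_{\omega,f}(B_t)$ for all $t>r_0$; (ii) for every constant $C>0$, $\limsup_{b\to+\infty}\big(\frac{b}{C}-\log F(b)\big)=+\infty$, where $F(b):=\int_0^b\mathrm{Vol}_{\omega,f}(B_t)\,dt$ for $b>0$. Since $X$ is compact, any two Hermitian metrics on it are comparable and the choice of $\omega$ does not matter. $p$-contact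 hyperbolic: $(X,\Gamma)$ is so called if there exists no holomorphic map $f:\mathbb{C}^p\to X$ satisfying all three conditions: (i) $f$ is non-degenerate at some point $x_0\in\mathbb{C}^p$, i.e. $d_{x_0}f:\mathbb{C}^p\to T^{1,0}_{f(x_0)}X$ is injective; (ii) $f$ has subexponential growth (with $q=p$); (iii) $f^\star\Gamma=0$. *)

theory Defs
  imports "HOL-Analysis.Analysis" "HOL-Combinatorics.Permutations" "HOL-Library.Liminf_Limsup"
begin

section \<open>Alternating forms on complex coordinate space\<close>

text \<open>
  A complex-valued alternating \<open>k\<close>-form on the real vector space underlying \<open>complex ^ 'n\<close> is a
  function of a sequence of vectors of which only the first \<open>k\<close> entries matter.
\<close>

type_synonym 'n covec = "(nat \<Rightarrow> (complex, 'n) vec) \<Rightarrow> complex"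

definition alternating_form :: "nat \<Rightarrow> 'n::finite covec \<Rightarrow> bool" where
  "alternating_form k a \<longleftrightarrow>
     (\<forall>v w. (\<forall>j<k. v j = w j) \<longrightarrow> a v = a w) \<and>
     (\<forall>v. \<forall>j<k. linear (\<lambda>u. a (v(j := u)))) \<and>
     (\<forall>v. \<forall>i<k. \<forall>j<k. i \<noteq> j \<and> v i = v j \<longrightarrow> a v = 0)"

definition wedge :: "nat \<Rightarrow> nat \<Rightarrow> 'n::finite covec \<Rightarrow> 'n covec \<Rightarrow> 'n covec" where
  "wedge k l a b = (\<lambda>v.
     (\<Sum>\<sigma> | \<sigma> permutes {..<k + l}.
        of_int (sign \<sigma>) * a (\<lambda>j. v (\<sigma> j)) * b (\<lambda>j. v (\<sigma> (k + j)))) / of_nat (fact k * fact l))"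

text \<open>The product \<open>\<theta> 0 \<and> \<dots> \<and> \<theta> (m - 1)\<close> of \<open>m\<close> forms, all of degree \<open>d\<close>.\<close>

primrec wedge_prod :: "nat \<Rightarrow> (nat \<Rightarrow> 'n::finite covec) \<Rightarrow> nat \<Rightarrow> 'n covec" where
  "wedge_prod d \<theta> 0 = (\<lambda>v. 1)"
| "wedge_prod d \<theta> (Suc m) = wedge (d * m) d (wedge_prod d \<theta> m) (\<theta> m)"

definition conj_form :: "'n::finite covec \<Rightarrow> 'n covec" where
  "conj_form a = (\<lambda>v. cnj (a v))"

abbreviation clinear_functional :: "(complex ^ 'n \<Rightarrow> complex) \<Rightarrow> bool" where
  "clinear_functional l \<equiv> Vector_Spaces.linear (*s) (*) l"

definition covector :: "(complex ^ 'n \<Rightarrow> complex) \<Rightarrow> 'n::finite covec" where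
  "covector l = (\<lambda>v. l (v 0))"

text \<open>
  The forms of type \<open>(r,s)\<close>: the complex span of the products of \<open>r\<close> complex linear and
  \<open>s\<close> conjugate linear functionals.
\<close>

inductive_set forms_of_type :: "nat \<Rightarrow> nat \<Rightarrow> 'n::finite covec set" for r s where
  zero: "(\<lambda>v. 0) \<in> forms_of_type r s"
| add: "\<lbrakk>a \<in> forms_of_type r s;
         \<And>i. i < r \<Longrightarrow> clinear_functional (\<theta> i);
         \<And>i. r \<le> i \<Longrightarrow> i < r + s \<Longrightarrow> clinear_functional (\<lambda>u. cnj (\<theta> i u))\<rbrakk>
        \<Longrightarrow> (\<lambda>v. a v + c * wedge_prod 1 (\<lambda>i. covector (\<theta> i)) (r + s) v) \<in> forms_of_type r s"

text \<open>The \<open>(1,1)\<close>-form \<open>i l \<and> conj l\<close>.\<close>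

definition i_wedge_conj :: "(complex ^ 'n \<Rightarrow> complex) \<Rightarrow> 'n::finite covec" where
  "i_wedge_conj l = (\<lambda>v. \<i> * wedge 1 1 (covector l) (conj_form (covector l)) v)"

text \<open>
  Positive forms of top degree: positive multiples of \<open>(i dz\<^sub>1 \<and> conj dz\<^sub>1) \<and> \<dots> \<and> (i dz\<^sub>n \<and> conj dz\<^sub>n)\<close>.
  The factors have even degree, so the enumeration of the coordinates is immaterial.
\<close>

definition positive_top_form :: "'n::finite covec \<Rightarrow> bool" where
  "positive_top_form \<tau> \<longleftrightarrow>
     (\<exists>c::real. c > 0 \<and>
        \<tau> = (\<lambda>v. of_real c *
               wedge_prod 2 (\<lambda>j. i_wedge_conj (\<lambda>u. u $ from_nat_into (UNIV :: 'n set) j)) CARD('n) v))"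

definition clinearly_independent :: "nat \<Rightarrow> (nat \<Rightarrow> complex ^ 'n \<Rightarrow> complex) \<Rightarrow> bool" where
  "clinearly_independent m \<alpha> \<longleftrightarrow>
     (\<forall>c. (\<forall>u. (\<Sum>j<m. c j * \<alpha> j u) = 0) \<longrightarrow> (\<forall>j<m. c j = 0))"

definition weakly_strictly_positive :: "nat \<Rightarrow> 'n::finite covec \<Rightarrow> bool" where
  "weakly_strictly_positive p \<Xi> \<longleftrightarrow>
     (\<forall>\<alpha>. (\<forall>j < CARD('n) - p. clinear_functional (\<alpha> j)) \<and>
           clinearly_independent (CARD('n) - p) \<alpha> \<longrightarrow>
        positive_top_form
          (wedge (2 * p) (2 * (CARD('n) - p)) \<Xi>
             (wedge_prod 2 (\<lambda>j. i_wedge_conj (\<alpha> j)) (CARD('n) - p))))"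


section \<open>Calculus of forms on coordinate space\<close>

text \<open>For open \<open>S\<close>: all iterated directional derivatives up to order \<open>k\<close> exist and are continuous.\<close>

fun C_k_on :: "nat \<Rightarrow> ('a::real_normed_vector \<Rightarrow> 'b::real_normed_vector) \<Rightarrow> 'a set \<Rightarrow> bool" where
  "C_k_on 0 g S \<longleftrightarrow> continuous_on S g"
| "C_k_on (Suc k) g S \<longleftrightarrow>
     (\<forall>y\<in>S. g differentiable (at y)) \<and> (\<forall>u. C_k_on k (\<lambda>y. frechet_derivative g (at y) u) S)"

definition smooth_on :: "('a::real_normed_vector \<Rightarrow> 'b::real_normed_vector) \<Rightarrow> 'a set \<Rightarrow> bool" where
  "smooth_on g S \<longleftrightarrow> (\<forall>k. C_k_on k g S)"

definition holomorphic_vec_on :: "(complex ^ 'm::finite \<Rightarrow> complex ^ 'n::finite) \<Rightarrow> (complex ^ 'm) set \<Rightarrow> bool" where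
  "holomorphic_vec_on g S \<longleftrightarrow>
     (\<forall>y\<in>S. \<exists>L. (g has_derivative L) (at y) \<and> Vector_Spaces.linear (*s) (*s) L)"

definition skip :: "nat \<Rightarrow> (nat \<Rightarrow> 'a) \<Rightarrow> nat \<Rightarrow> 'a" where
  "skip i v = (\<lambda>j. if j < i then v j else v (Suc j))"

definition ext_deriv :: "nat \<Rightarrow> (complex ^ 'n \<Rightarrow> 'n::finite covec) \<Rightarrow> complex ^ 'n \<Rightarrow> 'n covec" where
  "ext_deriv k a y = (\<lambda>v.
     \<Sum>i\<le>k. (-1) ^ i * frechet_derivative (\<lambda>z. a z (skip i v)) (at y) (v i))"

text \<open>
  The two parts of the exterior derivative obtained by replacing the differential \<open>D\<close> of the
  coefficients by its complex linear part \<open>u \<mapsto> (D u - i D (i u)) / 2\<close>, or its conjugate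
  linear part \<open>u \<mapsto> (D u + i D (i u)) / 2\<close>.
\<close>

definition del :: "nat \<Rightarrow> (complex ^ 'n \<Rightarrow> 'n::finite covec) \<Rightarrow> complex ^ 'n \<Rightarrow> 'n covec" where
  "del k a y = (\<lambda>v.
     \<Sum>i\<le>k. (-1) ^ i *
       (let D = frechet_derivative (\<lambda>z. a z (skip i v)) (at y) in (D (v i) - \<i> * D (\<i> *s v i)) / 2))"

definition del_bar :: "nat \<Rightarrow> (complex ^ 'n \<Rightarrow> 'n::finite covec) \<Rightarrow> complex ^ 'n \<Rightarrow> 'n covec" where
  "del_bar k a y = (\<lambda>v.
     \<Sum>i\<le>k. (-1) ^ i *
       (let D = frechet_derivative (\<lambda>z. a z (skip i v)) (at y) in (D (v i) + \<i> * D (\<i> *s v i)) / 2))"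


section \<open>Complex manifolds, holomorphic maps and differential forms\<close>

text \<open>
  A manifold is a Hausdorff second countable type with an atlas. The coordinate map of a chart
  \<open>(U, \<phi>)\<close> is relevant only on \<open>U\<close>.
\<close>

type_synonym ('x, 'n) chart = "'x set \<times> ('x \<Rightarrow> (complex, 'n) vec)"

definition chart_image :: "('x, 'n::finite) chart \<Rightarrow> (complex ^ 'n) set" where
  "chart_image c = snd c ` fst c"

definition chart_inv :: "('x, 'n::finite) chart \<Rightarrow> complex ^ 'n \<Rightarrow> 'x" where
  "chart_inv c = inv_into (fst c) (snd c)"

definition complex_atlas ::
  "('x::{t2_space, second_countable_topology}, 'n::finite) chart set \<Rightarrow> bool" where
  "complex_atlas A \<longleftrightarrow>
     (\<Union>c\<in>A. fst c) = UNIV \<and>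
     (\<forall>c\<in>A. open (fst c) \<and> open (chart_image c) \<and>
             homeomorphism (fst c) (chart_image c) (snd c) (chart_inv c)) \<and>
     (\<forall>c\<in>A. \<forall>c'\<in>A. holomorphic_vec_on (snd c' \<circ> chart_inv c) (snd c ` (fst c \<inter> fst c')))"

text \<open>Coordinate space itself carries the atlas with this single chart.\<close>

definition std_chart :: "(complex ^ 'n, 'n::finite) chart" where
  "std_chart = (UNIV, \<lambda>z. z)"

definition holomorphic_map ::
  "('x::topological_space, 'm::finite) chart set \<Rightarrow> ('y::topological_space, 'n::finite) chart set
     \<Rightarrow> ('x \<Rightarrow> 'y) \<Rightarrow> bool" where
  "holomorphic_map A B F \<longleftrightarrow> continuous_on UNIV F \<and>
     (\<forall>c\<in>A. \<forall>c'\<in>B. holomorphic_vec_on (snd c' \<circ> F \<circ> chart_inv c) (snd c ` (fst c \<inter> F -` fst c')))"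

text \<open>The differential of \<open>F\<close> at the point with coordinate \<open>y\<close>, in the charts \<open>c\<close> and \<open>c'\<close>.\<close>

definition differential ::
  "('x, 'm::finite) chart \<Rightarrow> ('y, 'n::finite) chart \<Rightarrow> ('x \<Rightarrow> 'y) \<Rightarrow> complex ^ 'm
     \<Rightarrow> complex ^ 'm \<Rightarrow> complex ^ 'n" where
  "differential c c' F y = frechet_derivative (snd c' \<circ> F \<circ> chart_inv c) (at y)"

text \<open>
  A differential form is the family of its local expressions: \<open>\<alpha> c y\<close> is the value of the form, in
  the chart \<open>c\<close>, at the point with coordinate \<open>y\<close>. Different local expressions are related by the
  coordinate changes.
\<close>

type_synonym ('x, 'n) dform = "('x, 'n) chart \<Rightarrow> (complex, 'n) vec \<Rightarrow> 'n covec"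

definition smooth_form :: "('x, 'n::finite) chart set \<Rightarrow> nat \<Rightarrow> ('x, 'n) dform \<Rightarrow> bool" where
  "smooth_form A k \<alpha> \<longleftrightarrow>
     (\<forall>c\<in>A. \<forall>y\<in>chart_image c. alternating_form k (\<alpha> c y)) \<and>
     (\<forall>c\<in>A. \<forall>v. smooth_on (\<lambda>y. \<alpha> c y v) (chart_image c)) \<and>
     (\<forall>c\<in>A. \<forall>c'\<in>A. \<forall>x\<in>fst c \<inter> fst c'. \<forall>v.
        \<alpha> c (snd c x) v = \<alpha> c' (snd c' x) (\<lambda>j. differential c c' (\<lambda>x. x) (snd c x) (v j)))"

text \<open>The smooth \<open>(r,s)\<close>-forms.\<close>

definition smooth_form_of_type ::
  "('x, 'n::finite) chart set \<Rightarrow> nat \<Rightarrow> nat \<Rightarrow> ('x, 'n) dform \<Rightarrow> bool" where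
  "smooth_form_of_type A r s \<alpha> \<longleftrightarrow>
     smooth_form A (r + s) \<alpha> \<and> (\<forall>c\<in>A. \<forall>y\<in>chart_image c. \<alpha> c y \<in> forms_of_type r s)"

definition real_form :: "('x, 'n::finite) chart set \<Rightarrow> ('x, 'n) dform \<Rightarrow> bool" where
  "real_form A \<alpha> \<longleftrightarrow> (\<forall>c\<in>A. \<forall>y\<in>chart_image c. \<forall>v. \<alpha> c y v \<in> \<real>)"

definition chart_at :: "('x, 'n::finite) chart set \<Rightarrow> 'x \<Rightarrow> ('x, 'n) chart" where
  "chart_at A x = (SOME c. c \<in> A \<and> x \<in> fst c)"

text \<open>
  The pullback of a form on the target (with atlas \<open>B\<close>); by the compatibility of its local expressions
  the choice of the target chart does not matter.
\<close>

definition pullback ::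
  "('y, 'n::finite) chart set \<Rightarrow> ('x \<Rightarrow> 'y) \<Rightarrow> ('y, 'n) dform \<Rightarrow> ('x, 'm::finite) dform" where
  "pullback B F \<alpha> = (\<lambda>c y v.
     let x = chart_inv c y; c' = chart_at B (F x)
     in \<alpha> c' (snd c' (F x)) (\<lambda>j. differential c c' F y (v j)))"

definition universal_covering ::
  "('y::{t2_space, second_countable_topology}, 'n::finite) chart set
     \<Rightarrow> ('x::{t2_space, second_countable_topology}, 'n) chart set \<Rightarrow> ('y \<Rightarrow> 'x) \<Rightarrow> bool" where
  "universal_covering B A \<pi> \<longleftrightarrow>
     complex_atlas B \<and> simply_connected (UNIV :: 'y set) \<and> covering_space UNIV \<pi> UNIV \<and>
     holomorphic_map B A \<pi> \<and>
     (\<forall>c\<in>B. \<forall>c'\<in>A. \<forall>y\<in>fst c. \<pi> y \<in> fst c' \<longrightarrow> bij (differential c c' \<pi> (snd c y)))"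


section \<open>Hermitian metrics\<close>

text \<open>The real bilinear form \<open>(u, v) \<mapsto> \<omega>(u, i v)\<close>, whose volume form is \<open>\<omega>\<^sup>n / n!\<close>.\<close>

definition bilin_of :: "'n::finite covec \<Rightarrow> complex ^ 'n \<Rightarrow> complex ^ 'n \<Rightarrow> real" where
  "bilin_of w u v = Re (w (\<lambda>j. if j = 0 then u else \<i> *s v))"

definition pos_def :: "('a::real_vector \<Rightarrow> 'a \<Rightarrow> real) \<Rightarrow> bool" where
  "pos_def g \<longleftrightarrow> (\<forall>v. v \<noteq> 0 \<longrightarrow> g v v > 0)"

definition hermitian_metric :: "('x, 'n::finite) chart set \<Rightarrow> ('x, 'n) dform \<Rightarrow> bool" where
  "hermitian_metric A \<omega> \<longleftrightarrow>
     smooth_form_of_type A 1 1 \<omega> \<and> real_form A \<omega> \<and>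
     (\<forall>c\<in>A. \<forall>y\<in>chart_image c. pos_def (bilin_of (\<omega> c y)))"

definition wedge_power_fact :: "nat \<Rightarrow> 'n::finite covec \<Rightarrow> 'n covec" where
  "wedge_power_fact k w = (\<lambda>v. wedge_prod 2 (\<lambda>_. w) k v / fact k)"

definition bounded_form ::
  "('x, 'n::finite) chart set \<Rightarrow> ('x, 'n) dform \<Rightarrow> nat \<Rightarrow> ('x, 'n) dform \<Rightarrow> bool" where
  "bounded_form A \<omega> k \<beta> \<longleftrightarrow>
     (\<exists>C. \<forall>c\<in>A. \<forall>y\<in>chart_image c. \<forall>v.
        (\<forall>j<k. bilin_of (\<omega> c y) (v j) (v j) \<le> 1) \<longrightarrow> cmod (\<beta> c y v) \<le> C)"


section \<open>Contact structures and metric hyperbolicity\<close>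

definition holomorphic_p_contact_structure ::
  "nat \<Rightarrow> ('x, 'n::finite) chart set \<Rightarrow> ('x, 'n) dform \<Rightarrow> bool" where
  "holomorphic_p_contact_structure p A \<Gamma> \<longleftrightarrow>
     smooth_form_of_type A p 0 \<Gamma> \<and>
     (\<forall>c\<in>A. \<forall>y\<in>chart_image c. \<forall>v. del_bar p (\<Gamma> c) y v = 0) \<and>
     (\<forall>c\<in>A. \<forall>y\<in>chart_image c. \<exists>v. wedge p (p + 1) (\<Gamma> c y) (del p (\<Gamma> c) y) v \<noteq> 0)"

definition p_contact_metrically_hyperbolic ::
  "nat \<Rightarrow> ('x, 'n::finite) chart set \<Rightarrow> ('x, 'n) dform \<Rightarrow> ('y, 'n) chart set \<Rightarrow> ('y \<Rightarrow> 'x) \<Rightarrow> bool" where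
  "p_contact_metrically_hyperbolic p A \<Gamma> B \<pi> \<longleftrightarrow>
     (\<exists>\<omega> \<Omega>. hermitian_metric A \<omega> \<and> smooth_form_of_type A p p \<Omega> \<and> real_form A \<Omega> \<and>
        (\<forall>c\<in>A. \<forall>y\<in>chart_image c. \<forall>v. ext_deriv (2 * p) (\<Omega> c) y v = 0) \<and>
        (\<forall>c\<in>A. \<forall>y\<in>chart_image c. weakly_strictly_positive p (\<Omega> c y)) \<and>
        (\<forall>c\<in>A. \<forall>y\<in>chart_image c. \<forall>v.
           wedge_power_fact p (\<omega> c y) v =
             \<i> ^ (p\<^sup>2) * wedge p p (\<Gamma> c y) (conj_form (\<Gamma> c y)) v + \<Omega> c y v) \<and>
        (\<exists>\<beta>. smooth_form B (2 * p - 1) \<beta> \<and> bounded_form B (pullback A \<pi> \<omega>) (2 * p - 1) \<beta> \<and>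
           (\<forall>c\<in>B. \<forall>y\<in>chart_image c. \<forall>v.
              pullback A \<pi> \<Omega> c y v = ext_deriv (2 * p - 1) (\<beta> c) y v)))"


section \<open>Subexponential growth and hyperbolicity\<close>

text \<open>The oriented orthonormal basis \<open>e\<^sub>1, i e\<^sub>1, e\<^sub>2, i e\<^sub>2, \<dots>\<close>.\<close>

definition std_frame :: "nat \<Rightarrow> complex ^ 'q::finite" where
  "std_frame j = axis (from_nat_into (UNIV :: 'q set) (j div 2)) (if even j then 1 else \<i>)"

definition ball_integral :: "real \<Rightarrow> (complex ^ 'q::finite \<Rightarrow> 'q covec) \<Rightarrow> complex" where
  "ball_integral r \<eta> = (LINT z:ball 0 r|lborel. \<eta> z std_frame)"

text \<open>
  The integral of a function over the sphere of radius \<open>t\<close> centred at the origin against the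
  Euclidean surface measure, expressed through Lebesgue measure on the unit ball by integration
  in polar coordinates: \<open>\<integral>\<^bsub>|x| < 1\<^esub> g(t x / |x|) dx = (1 / 2q) \<integral>\<^bsub>|u| = 1\<^esub> g(t u) du\<close>.
\<close>

definition sphere_surface_integral :: "real \<Rightarrow> (complex ^ 'q::finite \<Rightarrow> complex) \<Rightarrow> complex" where
  "sphere_surface_integral t g =
     of_real (real DIM(complex ^ 'q) * t ^ (DIM(complex ^ 'q) - 1)) *
       (LINT x:ball 0 1|lborel. g (t *\<^sub>R sgn x))"

text \<open>
  The integral of a form of degree \<open>2 q - 1\<close> over the sphere with its boundary orientation. If \<open>\<nu>\<close> is
  the outward unit normal and \<open>\<nu>, e\<^sub>1, \<dots>\<close> an oriented orthonormal basis, the density of \<open>\<eta>\<close>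
  with respect to the surface measure is \<open>\<eta>(e\<^sub>1, \<dots>) = (\<langle>\<nu>, \<cdot>\<rangle> \<and> \<eta>)(\<nu>, e\<^sub>1, \<dots>)\<close>, and the top degree
  form \<open>\<langle>\<nu>, \<cdot>\<rangle> \<and> \<eta>\<close> may be evaluated on any oriented orthonormal basis.
\<close>

definition sphere_integral :: "real \<Rightarrow> (complex ^ 'q::finite \<Rightarrow> 'q covec) \<Rightarrow> complex" where
  "sphere_integral t \<eta> =
     sphere_surface_integral t (\<lambda>z.
       wedge 1 (2 * CARD('q) - 1) (covector (\<lambda>u. of_real (sgn z \<bullet> u))) (\<eta> z) std_frame)"

text \<open>The vector dual to a real covector, and the length of a real covector, with respect to \<open>g\<close>.\<close>

definition sharp :: "('a::real_vector \<Rightarrow> 'a \<Rightarrow> real) \<Rightarrow> ('a \<Rightarrow> real) \<Rightarrow> 'a" where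
  "sharp g l = (THE X. \<forall>u. g X u = l u)"

definition colength :: "('a::real_vector \<Rightarrow> 'a \<Rightarrow> real) \<Rightarrow> ('a \<Rightarrow> real) \<Rightarrow> real" where
  "colength g l = sqrt (g (sharp g l) (sharp g l))"

text \<open>
  The Hodge star of a real covector \<open>l\<close> for a metric \<open>g\<close> with volume form \<open>vol\<close>: the interior product
  of \<open>vol\<close> with the vector dual to \<open>l\<close>.
\<close>

definition star_covector ::
  "(complex ^ 'q \<Rightarrow> complex ^ 'q \<Rightarrow> real) \<Rightarrow> 'q::finite covec \<Rightarrow> (complex ^ 'q \<Rightarrow> real) \<Rightarrow> 'q covec" where
  "star_covector g vol l = (\<lambda>v. vol (case_nat (sharp g l) v))"

definition d_tau :: "complex ^ 'q::finite \<Rightarrow> complex ^ 'q \<Rightarrow> real" where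
  "d_tau z = frechet_derivative (\<lambda>z. (norm z)\<^sup>2) (at z)"

text \<open>
  For a possibly degenerate metric \<open>w\<close> on coordinate space, such as the pullback of a Hermitian metric
  under a holomorphic map: the length of \<open>d\<tau>\<close> and the form \<open>d\<sigma> = \<star>(d\<tau> / |d\<tau>|)\<close>. Both are defined where \<open>w\<close> is
  nondegenerate and are given the value 0 elsewhere.
\<close>

definition d_tau_length :: "(complex ^ 'q \<Rightarrow> 'q covec) \<Rightarrow> complex ^ 'q::finite \<Rightarrow> real" where
  "d_tau_length w z =
     (if pos_def (bilin_of (w z)) then colength (bilin_of (w z)) (d_tau z) else 0)"

definition area_form :: "(complex ^ 'q \<Rightarrow> 'q covec) \<Rightarrow> complex ^ 'q::finite \<Rightarrow> 'q covec" where
  "area_form w z =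
     (if pos_def (bilin_of (w z))
      then star_covector (bilin_of (w z)) (wedge_power_fact CARD('q) (w z))
             (\<lambda>u. d_tau z u / d_tau_length w z)
      else (\<lambda>v. 0))"

definition volume_of_ball :: "(complex ^ 'q::finite \<Rightarrow> 'q covec) \<Rightarrow> real \<Rightarrow> real" where
  "volume_of_ball w r = Re (ball_integral r (\<lambda>z. wedge_power_fact CARD('q) (w z)))"

definition subexponential_growth ::
  "('x, 'n::finite) chart set \<Rightarrow> ('x, 'n) dform \<Rightarrow> (complex ^ 'q::finite \<Rightarrow> 'x) \<Rightarrow> bool" where
  "subexponential_growth A \<omega> f \<longleftrightarrow>
     (let w = pullback A f \<omega> std_chart;
          vol = volume_of_ball w;
          F = (\<lambda>b. LINT t:{0..b}|lborel. vol t)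
      in (\<exists>C\<^sub>1 > 0. \<exists>r\<^sub>0 > 0. \<forall>t > r\<^sub>0.
            Re (sphere_integral t (\<lambda>z v. of_real (d_tau_length w z) * area_form w z v)) \<le> C\<^sub>1 * t * vol t) \<and>
         (\<forall>C > 0. Limsup at_top (\<lambda>b. ereal (b / C - ln (F b))) = \<infinity>))"

definition nondegenerate_at ::
  "('x, 'n::finite) chart set \<Rightarrow> (complex ^ 'q::finite \<Rightarrow> 'x) \<Rightarrow> complex ^ 'q \<Rightarrow> bool" where
  "nondegenerate_at A f z \<longleftrightarrow> (\<forall>c\<in>A. f z \<in> fst c \<longrightarrow> inj (differential std_chart c f z))"

text \<open>
  On a compact manifold any two Hermitian metrics are comparable, so that the growth condition holds
  for one Hermitian metric if and only if it holds for all of them.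
\<close>

definition p_contact_hyperbolic ::
  "'p::finite itself \<Rightarrow> ('x::topological_space, 'n::finite) chart set \<Rightarrow> ('x, 'n) dform \<Rightarrow> bool" where
  "p_contact_hyperbolic _ A \<Gamma> \<longleftrightarrow>
     \<not> (\<exists>f :: complex ^ 'p \<Rightarrow> 'x.
          holomorphic_map {std_chart} A f \<and>
          (\<exists>x\<^sub>0. nondegenerate_at A f x\<^sub>0) \<and>
          (\<exists>\<omega>. hermitian_metric A \<omega> \<and> subexponential_growth A \<omega> f) \<and>
          (\<forall>z v. pullback A f \<Gamma> std_chart z v = 0))"

end

theory Submission
  imports Defs "HOL-Complex_Analysis.Cauchy_Integral_Formula"
begin

text \<open>
  Suppose that \<open>f\<close> violates hyperbolicity. Since \<open>f\<^sup>*\<Gamma> = 0\<close>, the pulled back volume form \<open>f\<^sup>*\<omega>\<^sup>p / p!\<close>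
  equals \<open>f\<^sup>*\<Omega>\<close>. Lifting \<open>f\<close> to the universal cover turns this into the exact form \<open>d b\<close>, where \<open>b\<close> is the
  pullback of the bounded primitive. By Stokes' theorem the volume \<open>V t\<close> of the ball of radius \<open>t\<close> is
  at most a constant times the area of the sphere, and the Cauchy-Schwarz inequality together with the first growth
  condition bounds the square of that area by a constant times \<open>V t\<close> times \<open>V' t\<close>. Hence
  \<open>V \<le> C V'\<close> for large radii, so \<open>V\<close> and its integral grow at least like \<open>exp (t / C)\<close>, contradicting the
  second growth condition.
\<close>


section \<open>Alternating forms\<close>

text \<open>The growth condition speaks of some metric \<open>\<omega>'\<close>, hyperbolicity of
  another metric \<open>\<omega>\<close>, and both pullbacks may degenerate. Everything is measured
  with the pullback \<open>w'\<close> of \<open>\<omega>'\<close>: compactness turns the identity of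
  volume form and \<open>d b\<close> into an inequality
  \<open>volume_density (w' z) \<le> K * Re (d b)\<close> and rescales the bound on
  \<open>b\<close>. At degenerate points \<open>|d\<tau>|\<close> is set to 0, so the flux of
  \<open>b\<close> has to vanish there too: a kernel vector has length 0 and can be scaled without
  limit, hence a form bounded on unit vectors kills it. The Cauchy-Schwarz inequality is used as
  \<open>2 L \<le> s L^2 + 1 / s\<close> with one \<open>s\<close> for each radius; for
  \<open>s\<close> of order \<open>1 / t\<close> the growth condition lets half of the volume term
  be absorbed on the left. Pointwise estimates are made on a frame that is unitary for the metric
  and begins in the direction dual to \<open>d\<tau>\<close>; they reach \<open>std_frame\<close>
  because forms of top degree are proportional. Spheres are encoded by integrals over the unit ball,
  so Stokes' theorem comes from differentiating integrals over balls in the radius.\<close>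

definition multilinear_form :: "nat \<Rightarrow> 'n::finite covec \<Rightarrow> bool" where
  "multilinear_form k a \<longleftrightarrow>
     (\<forall>v w. (\<forall>j<k. v j = w j) \<longrightarrow> a v = a w) \<and> (\<forall>v. \<forall>j<k. linear (\<lambda>u. a (v(j := u))))"

lemma multilinear_cong: "multilinear_form k a \<Longrightarrow> (\<And>j. j < k \<Longrightarrow> v j = w j) \<Longrightarrow> a v = a w"
  unfolding multilinear_form_def by blast

lemma multilinear_linear: "multilinear_form k a \<Longrightarrow> j < k \<Longrightarrow> linear (\<lambda>u. a (v(j := u)))"
  unfolding multilinear_form_def by blast

text \<open>Continuity and the product rule for moving forms are proved for multilinear forms:
  directional derivatives of the coefficients are seen to be multilinear at once, and that is enough
  there.\<close>

lemma alternating_multilinear: "alternating_form k a \<Longrightarrow> multilinear_form k a"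
  unfolding alternating_form_def multilinear_form_def by blast

lemma alternating_cong: "alternating_form k a \<Longrightarrow> (\<And>j. j < k \<Longrightarrow> v j = w j) \<Longrightarrow> a v = a w"
  unfolding alternating_form_def by blast

lemma alternating_linear: "alternating_form k a \<Longrightarrow> j < k \<Longrightarrow> linear (\<lambda>u. a (v(j := u)))"
  unfolding alternating_form_def by blast

lemma alternating_eq_0:
  "alternating_form k a \<Longrightarrow> i < k \<Longrightarrow> j < k \<Longrightarrow> i \<noteq> j \<Longrightarrow> v i = v j \<Longrightarrow> a v = 0"
  unfolding alternating_form_def by blast

lemma alternating_transpose:
  assumes a: "alternating_form k a" and ij: "i < k" "j < k" "i \<noteq> j"
  shows "a (\<lambda>m. v (Transposition.transpose i j m)) = - a v"
proof -
  let ?f = "\<lambda>x y. a (v(i := x, j := y))"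
  have l1: "?f (x + x') y = ?f x y + ?f x' y" for x x' y
    using linear_add[OF alternating_linear[OF a ij(1), of "v(j := y)"], of x x'] ij
    by (simp add: fun_upd_twist)
  have l2: "?f x (y + y') = ?f x y + ?f x y'" for x y y'
    using linear_add[OF alternating_linear[OF a ij(2), of "v(i := x)"], of y y'] by simp
  have z: "?f x x = 0" for x
    by (rule alternating_eq_0[OF a ij]) (use ij in auto)
  \<comment> \<open>Polarization: with \<open>v i + v j\<close> in both slots the form vanishes, and
    only the two mixed terms survive the expansion.\<close>
  have "?f (v i + v j) (v i + v j) = ?f (v i) (v j) + ?f (v j) (v i)"
    unfolding l1 l2 unfolding z by simp
  then have "?f (v j) (v i) = - ?f (v i) (v j)"
    unfolding z by (metis minus_unique)
  moreover have "v(i := v j, j := v i) = (\<lambda>m. v (Transposition.transpose i j m))"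
    by (auto simp: fun_eq_iff Transposition.transpose_def)
  ultimately show ?thesis by simp
qed

lemma alternating_permutes:
  assumes a: "alternating_form k a" and s: "\<sigma> permutes {..<k}"
  shows "a (\<lambda>m. v (\<sigma> m)) = of_int (sign \<sigma>) * a v"
  using s finite_lessThan[of k]
proof (induction arbitrary: v rule: permutes_induct)
  case (swap i j p)
  have "a (\<lambda>m. v ((Transposition.transpose i j \<circ> p) m)) = of_int (sign p) * a (\<lambda>m. v (Transposition.transpose i j m))"
    using swap.IH[of "\<lambda>m. v (Transposition.transpose i j m)"] by (simp add: o_def)
  also have "\<dots> = of_int (sign p) * (- a v)"
    by (subst alternating_transpose[OF a]) (use swap in auto)
  also have "sign (Transposition.transpose i j \<circ> p) = - sign p"
    using swap by (subst sign_compose)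
       (auto simp: sign_swap_id permutation_swap_id intro: permutes_imp_permutation)
  ultimately show ?case by (simp add: o_def)
qed (auto simp: id_def)

text \<open>This is why forms of top degree are determined by one value: linearity reduces every
  argument to a vector of \<open>E\<close>, and a tuple from \<open>E\<close> is a permutation of
  \<open>E\<close> or has a repetition.\<close>

lemma alternating_eq_0_if_basis:
  assumes a: "alternating_form k a" and E: "span (E ` {..<k}) = UNIV" and 0: "a E = 0"
  shows "a v = 0"
proof -
  \<comment> \<open>The first \<open>m\<close> slots are already arbitrary, the others still come
    from \<open>E\<close>; each step of the induction frees one slot.\<close>
  have "\<forall>v. (\<forall>j<k. m \<le> j \<longrightarrow> v j \<in> E ` {..<k}) \<longrightarrow> a v = 0" if "m \<le> k" for m
    using that
  proof (induction m)
    case 0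
    show ?case
    proof (intro allI impI)
      fix v assume v: "\<forall>j<k. 0 \<le> j \<longrightarrow> v j \<in> E ` {..<k}"
      then have "\<forall>j. \<exists>i. j < k \<longrightarrow> i < k \<and> v j = E i" by auto
      then obtain h where h: "j < k \<Longrightarrow> h j < k \<and> v j = E (h j)" for j by metis
      show "a v = 0"
      proof (cases "inj_on h {..<k}")
        case True
        define \<sigma> where "\<sigma> j = (if j < k then h j else j)" for j
        have "bij_betw h {..<k} {..<k}"
          using True h by (intro bij_betw_imageI endo_inj_surj) auto
        moreover have "bij_betw \<sigma> {..<k} {..<k} = bij_betw h {..<k} {..<k}"
          by (rule bij_betw_cong) (simp add: \<sigma>_def)
        ultimately have "\<sigma> permutes {..<k}"
          by (intro bij_imp_permutes) (auto simp: \<sigma>_def)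
        then have "a (\<lambda>m. E (\<sigma> m)) = 0"
          by (simp add: alternating_permutes[OF a] \<open>a E = 0\<close>)
        moreover have "a v = a (\<lambda>m. E (\<sigma> m))"
          by (rule alternating_cong[OF a]) (simp add: \<sigma>_def h)
        ultimately show ?thesis by simp
      next
        case False
        then obtain i j where "i < k" "j < k" "i \<noteq> j" "h i = h j"
          by (auto simp: inj_on_def)
        then show ?thesis using h[of i] h[of j] alternating_eq_0[OF a, of i j v] by simp
      qed
    qed
  next
    case (Suc m)
    show ?case
    proof (intro allI impI)
      fix v assume v: "\<forall>j<k. Suc m \<le> j \<longrightarrow> v j \<in> E ` {..<k}"
      have lin: "linear (\<lambda>u. a (v(m := u)))"
        using alternating_linear[OF a, of m v] Suc by simp
      have "a (v(m := u)) = 0" if "u \<in> E ` {..<k}" for u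
      proof -
        have "\<forall>j<k. m \<le> j \<longrightarrow> (v(m := u)) j \<in> E ` {..<k}"
          using v that by simp
        then show ?thesis using Suc by simp
      qed
      then have "a (v(m := u)) = 0" if "u \<in> span (E ` {..<k})" for u
        using linear_eq_0_on_span[OF lin _ that] by blast
      from this[of "v m"] show "a v = 0" using E by simp
    qed
  qed
  from this[of k] show ?thesis by auto
qed

lemma alternating_diff_scale:
  assumes "alternating_form k a" "alternating_form k b"
  shows "alternating_form k (\<lambda>v. c * a v - d * b v)"
proof -
  have "linear (\<lambda>u. c * a (v(j := u)) - d * b (v(j := u)))" if "j < k" for v j
    using alternating_linear[OF assms(1) that, of v] alternating_linear[OF assms(2) that, of v]
    by (simp add: linear_iff algebra_simps)
  moreover have "c * a v - d * b v = c * a w - d * b w" if "\<forall>j<k. v j = w j" for v w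
    using alternating_cong[OF assms(1), of v w] alternating_cong[OF assms(2), of v w] that by simp
  moreover have "c * a v - d * b v = 0" if "i < k" "j < k" "i \<noteq> j" "v i = v j" for i j v
    using alternating_eq_0[OF assms(1)] alternating_eq_0[OF assms(2)] that by simp
  ultimately show ?thesis unfolding alternating_form_def by blast
qed

text \<open>The combination \<open>b E * a - a E * b\<close> is alternating and vanishes on
  \<open>E\<close>. The product form avoids division and carries every computation in a convenient
  frame over to \<open>std_frame\<close>.\<close>

lemma top_forms_proportional:
  assumes a: "alternating_form k a" "alternating_form k b" and E: "span (E ` {..<k}) = UNIV"
  shows "a v * b E = b v * a E"
  using alternating_eq_0_if_basis[OF alternating_diff_scale[OF a, of "b E" "a E"] E, of v]
  by (simp add: algebra_simps)

section \<open>Wedge products\<close>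

lemma wedge_compose: "wedge k l a b (\<lambda>j. T (v j)) = wedge k l (\<lambda>v. a (\<lambda>j. T (v j))) (\<lambda>v. b (\<lambda>j. T (v j))) v"
  by (simp add: wedge_def)

lemma wedge_prod_compose:
  "wedge_prod d \<theta> m (\<lambda>j. T (v j)) = wedge_prod d (\<lambda>i v. \<theta> i (\<lambda>j. T (v j))) m v"
proof (induction m arbitrary: v)
  case (Suc m)
  show ?case by (simp add: wedge_compose Suc)
qed simp

lemma alternating_wedge:
  assumes a: "alternating_form k a" and b: "alternating_form l b"
  shows "alternating_form (k + l) (wedge k l a b)"
proof -
  let ?P = "{\<sigma>. \<sigma> permutes {..<k + l}}"
  have fP: "finite ?P" by (simp add: finite_permutations)
  have loc: "wedge k l a b v = wedge k l a b w" if vw: "\<forall>j<k + l. v j = w j" for v w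
  proof -
    have "a (\<lambda>j. v (\<sigma> j)) = a (\<lambda>j. w (\<sigma> j)) \<and> b (\<lambda>j. v (\<sigma> (k + j))) = b (\<lambda>j. w (\<sigma> (k + j)))"
      if s: "\<sigma> permutes {..<k + l}" for \<sigma>
    proof -
      have "\<sigma> j < k + l" if "j < k + l" for j
        using permutes_in_image[OF s, of j] that by simp
      then show ?thesis
        using vw by (auto intro!: alternating_cong[OF a] alternating_cong[OF b])
    qed
    then show ?thesis
      unfolding wedge_def by (intro arg_cong2[where f="(/)"] sum.cong) auto
  qed
  have lin: "linear (\<lambda>u. wedge k l a b (v(j := u)))" if j: "j < k + l" for v j
  proof -
    have "linear (\<lambda>u. of_int (sign \<sigma>) * a (\<lambda>i. (v(j := u)) (\<sigma> i)) * b (\<lambda>i. (v(j := u)) (\<sigma> (k + i))))"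
      if s: "\<sigma> permutes {..<k + l}" for \<sigma>
    proof -
      \<comment> \<open>The place to which \<open>\<sigma>\<close> sends argument \<open>j\<close>:
        below \<open>k\<close> it is a slot of \<open>a\<close>, otherwise a slot of
        \<open>b\<close>.\<close>
      define m where "m = inv \<sigma> j"
      have m: "\<sigma> m = j" "m < k + l"
        using permutes_inverses[OF s] permutes_in_image[OF permutes_inv[OF s], of j] j by (auto simp: m_def)
      have eq: "\<sigma> i = j \<longleftrightarrow> i = m" for i
        using m permutes_inj[OF s] by (auto dest: injD)
      show ?thesis
      proof (cases "m < k")
        case True
        have 1: "(\<lambda>i. (v(j := u)) (\<sigma> i)) = (\<lambda>i. v (\<sigma> i))(m := u)" for u
          by (auto simp: fun_eq_iff eq)
        have 2: "b (\<lambda>i. (v(j := u)) (\<sigma> (k + i))) = b (\<lambda>i. v (\<sigma> (k + i)))" for u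
          using True by (intro alternating_cong[OF b]) (auto simp: eq)
        show ?thesis unfolding 1 2
          using alternating_linear[OF a True, of "\<lambda>i. v (\<sigma> i)"]
          by (simp add: linear_iff algebra_simps)
      next
        case False
        then have km: "m - k < l" "k + (m - k) = m" using m by auto
        have 1: "(\<lambda>i. (v(j := u)) (\<sigma> (k + i))) = (\<lambda>i. v (\<sigma> (k + i)))(m - k := u)" for u
          using km by (auto simp: fun_eq_iff eq)
        have 2: "a (\<lambda>i. (v(j := u)) (\<sigma> i)) = a (\<lambda>i. v (\<sigma> i))" for u
          using False by (intro alternating_cong[OF a]) (auto simp: eq)
        show ?thesis unfolding 1 2
          using alternating_linear[OF b km(1), of "\<lambda>i. v (\<sigma> (k + i))"]
          by (simp add: linear_iff algebra_simps)
      qed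
    qed
    then have "linear (\<lambda>u. \<Sum>\<sigma>\<in>?P. of_int (sign \<sigma>) * a (\<lambda>i. (v(j := u)) (\<sigma> i)) * b (\<lambda>i. (v(j := u)) (\<sigma> (k + i))))"
      by (intro linear_compose_sum) auto
    then show ?thesis unfolding wedge_def
      by (simp add: linear_iff add_divide_distrib scaleR_conv_of_real)
  qed
  have alt: "wedge k l a b v = 0" if ij: "i < k + l" "j < k + l" "i \<noteq> j" "v i = v j" for v i j
  proof -
    let ?t = "Transposition.transpose i j"
    let ?f = "\<lambda>\<sigma>. of_int (sign \<sigma>) * a (\<lambda>m. v (\<sigma> m)) * b (\<lambda>m. v (\<sigma> (k + m)))"
    have t: "?t permutes {..<k + l}" using ij by (intro permutes_swap_id) auto
    have vt: "v (?t m) = v m" for m using ij by (auto simp: Transposition.transpose_def)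
    \<comment> \<open>Composing on the left with the transposition of \<open>i\<close> and
      \<open>j\<close> permutes the summands, reverses the signs and keeps the values because
      \<open>v i = v j\<close>. The sum equals its own negative.\<close>
    have "sum ?f ?P = sum (\<lambda>\<sigma>. ?f (?t \<circ> \<sigma>)) ?P"
      by (rule setum_permutations_compose_left[OF t])
    also have "\<dots> = sum (\<lambda>\<sigma>. - ?f \<sigma>) ?P"
    proof (rule sum.cong)
      fix \<sigma> assume "\<sigma> \<in> ?P"
      then have "sign (?t \<circ> \<sigma>) = - sign \<sigma>"
        using ij by (subst sign_compose)
          (auto simp: sign_swap_id permutation_swap_id intro: permutes_imp_permutation[of "{..<k+l}"])
      then show "?f (?t \<circ> \<sigma>) = - ?f \<sigma>" by (simp add: vt)
    qed simp
    finally have "sum ?f ?P = 0" by (simp add: sum_negf)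
    then show ?thesis by (simp add: wedge_def)
  qed
  show ?thesis unfolding alternating_form_def using loc lin alt by blast
qed

lemma alternating_const: "alternating_form 0 (\<lambda>v. c)"
  by (simp add: alternating_form_def)

lemma alternating_wedge_prod:
  assumes "\<And>i. i < m \<Longrightarrow> alternating_form d (\<theta> i)"
  shows "alternating_form (d * m) (wedge_prod d \<theta> m)"
  using assms
proof (induction m)
  case (Suc m)
  then show ?case using alternating_wedge[of "d * m" "wedge_prod d \<theta> m" d "\<theta> m"]
    by (simp add: add.commute)
qed (simp add: alternating_const)

lemma alternating_scale:
  assumes "alternating_form k a" shows "alternating_form k (\<lambda>v. c * a v)"
  using alternating_diff_scale[OF assms assms, of c 0] by simp

lemma alternating_wedge_power_fact:
  assumes "alternating_form 2 w" shows "alternating_form (2 * m) (wedge_power_fact m w)"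
  using alternating_scale[OF alternating_wedge_prod[of m 2 "\<lambda>_. w"], of "1 / fact m"] assms
  by (simp add: wedge_power_fact_def)

text \<open>Each permutation of the first \<open>2 m\<close> indices is counted \<open>(2 m)!\<close> times in the wedge product with one more factor.\<close>

lemma wedge_prod_2:
  assumes w: "alternating_form 2 w"
  shows "wedge_prod 2 (\<lambda>_. w) m v =
    (\<Sum>\<sigma> | \<sigma> permutes {..<2 * m}. of_int (sign \<sigma>) * (\<Prod>j<m. w (\<lambda>i. v (\<sigma> (2 * j + i))))) / 2 ^ m"
proof (induction m arbitrary: v)
  case 0
  show ?case by simp
next
  case (Suc m)
  let ?P = "{\<sigma>. \<sigma> permutes {..<2 * m + 2}}"
  let ?Q = "{\<sigma>. \<sigma> permutes {..<2 * m}}"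
  let ?f = "\<lambda>\<sigma>. of_int (sign \<sigma>) * (\<Prod>j<Suc m. w (\<lambda>i. v (\<sigma> (2 * j + i))))"
  have "(\<Sum>\<sigma>\<in>?P. of_int (sign \<sigma>) * wedge_prod 2 (\<lambda>_. w) m (\<lambda>j. v (\<sigma> j)) * w (\<lambda>j. v (\<sigma> (2 * m + j))))
     = (\<Sum>\<sigma>\<in>?P. \<Sum>\<rho>\<in>?Q. ?f (\<sigma> \<circ> \<rho>) / 2 ^ m)"
  proof (rule sum.cong)
    fix \<sigma> assume s: "\<sigma> \<in> ?P"
    have *: "?f (\<sigma> \<circ> \<rho>) = of_int (sign \<sigma>) * (of_int (sign \<rho>) *
        (\<Prod>j<m. w (\<lambda>i. v (\<sigma> (\<rho> (2 * j + i)))))) * w (\<lambda>j. v (\<sigma> (2 * m + j)))" if r: "\<rho> \<in> ?Q" for \<rho>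
    proof -
      have "sign (\<sigma> \<circ> \<rho>) = sign \<sigma> * sign \<rho>"
        using s r by (intro sign_compose) (auto intro: permutes_imp_permutation[rotated])
      moreover have "\<rho> (2 * m + j) = 2 * m + j" for j
        using r by (auto simp: permutes_def)
      ultimately show ?thesis by (simp add: mult_ac)
    qed
    have "of_int (sign \<sigma>) * wedge_prod 2 (\<lambda>_. w) m (\<lambda>j. v (\<sigma> j)) * w (\<lambda>j. v (\<sigma> (2 * m + j)))
        = (\<Sum>\<rho>\<in>?Q. of_int (sign \<sigma>) * (of_int (sign \<rho>) *
            (\<Prod>j<m. w (\<lambda>i. v (\<sigma> (\<rho> (2 * j + i)))))) * w (\<lambda>j. v (\<sigma> (2 * m + j))) / 2 ^ m)"
      by (subst Suc) (simp add: sum_distrib_left sum_distrib_right sum_divide_distrib mult_ac)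
    also have "\<dots> = (\<Sum>\<rho>\<in>?Q. ?f (\<sigma> \<circ> \<rho>) / 2 ^ m)"
      by (intro sum.cong refl) (simp only: *)
    finally show "of_int (sign \<sigma>) * wedge_prod 2 (\<lambda>_. w) m (\<lambda>j. v (\<sigma> j)) * w (\<lambda>j. v (\<sigma> (2 * m + j)))
        = (\<Sum>\<rho>\<in>?Q. ?f (\<sigma> \<circ> \<rho>) / 2 ^ m)" .
  qed simp
  also have "\<dots> = (\<Sum>\<rho>\<in>?Q. \<Sum>\<sigma>\<in>?P. ?f (\<sigma> \<circ> \<rho>) / 2 ^ m)"
    by (rule sum.swap)
  also have "\<dots> = (\<Sum>\<rho>\<in>?Q. \<Sum>\<sigma>\<in>?P. ?f \<sigma> / 2 ^ m)"
  proof (rule sum.cong)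
    fix \<rho> assume "\<rho> \<in> ?Q"
    then have "\<rho> permutes {..<2 * m + 2}"
      by (auto intro: permutes_subset)
    from sum_permutations_compose_right[OF this, of "\<lambda>\<sigma>. ?f \<sigma> / 2 ^ m"]
    show "(\<Sum>\<sigma>\<in>?P. ?f (\<sigma> \<circ> \<rho>) / 2 ^ m) = (\<Sum>\<sigma>\<in>?P. ?f \<sigma> / 2 ^ m)" by simp
  qed simp
  also have "\<dots> = fact (2 * m) * ((\<Sum>\<sigma>\<in>?P. ?f \<sigma>) / 2 ^ m)"
    by (simp add: card_permutations[OF refl] sum_divide_distrib)
  finally show ?case
    by (simp add: wedge_def)
qed

abbreviation vec_pair :: "'a \<Rightarrow> 'a \<Rightarrow> nat \<Rightarrow> 'a" where
  "vec_pair u v \<equiv> (\<lambda>j. if j = 0 then u else v)"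

section \<open>Expansion of a wedge product along its first slot\<close>

lemma alternating_permutes_Suc:
  assumes a: "alternating_form k a" and s: "\<sigma> permutes {1..k}"
  shows "a (\<lambda>m. v (\<sigma> (Suc m))) = of_int (sign \<sigma>) * a (\<lambda>m. v (Suc m))"
  using s finite_atLeastAtMost[of 1 k]
proof (induction arbitrary: v rule: permutes_induct)
  case (swap i j p)
  let ?t = "Transposition.transpose i j"
  have "a (\<lambda>m. v ((?t \<circ> p) (Suc m))) = of_int (sign p) * a (\<lambda>m. v (?t (Suc m)))"
    using swap.IH[of "\<lambda>m. v (?t m)"] by (simp add: o_def)
  also have "(\<lambda>m. v (?t (Suc m))) = (\<lambda>m. v (Suc (Transposition.transpose (i - 1) (j - 1) m)))"
    using swap by (auto simp: fun_eq_iff Transposition.transpose_def)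
  also have "a \<dots> = - a (\<lambda>m. v (Suc m))"
    by (rule alternating_transpose[OF a, of "i - 1" "j - 1" "\<lambda>m. v (Suc m)"]) (use swap in auto)
  also have "sign (?t \<circ> p) = - sign p"
    using swap by (subst sign_compose)
       (auto simp: sign_swap_id permutation_swap_id intro: permutes_imp_permutation[of "{1..k}"])
  ultimately show ?case by (simp add: o_def)
qed (auto simp: id_def)

text \<open>The two lists differ only in the position of \<open>v 0\<close>, at the front or at
  place \<open>i - 1\<close>. Moving it takes \<open>i - 1\<close> adjacent transpositions, whence
  the sign.\<close>

lemma skip_eq_transpose:
  assumes b: "alternating_form k b" and i: "1 \<le> i" "i \<le> k"
  shows "(-1) ^ i * b (skip i v) = - b (\<lambda>j. v (Transposition.transpose 0 i (Suc j)))"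
  using i(1) i(2)
proof (induction i arbitrary: v rule: dec_induct)
  case base
  have "skip 1 v = (\<lambda>j. v (Transposition.transpose 0 1 (Suc j)))"
    by (auto simp: skip_def fun_eq_iff Transposition.transpose_def)
  then show ?case by simp
next
  case (step i)
  let ?u = "\<lambda>j. v (Transposition.transpose i (Suc i) j)"
  have 1: "skip (Suc i) v = skip i ?u"
    by (auto simp: skip_def fun_eq_iff Transposition.transpose_def less_Suc_eq)
  let ?x = "\<lambda>j. v (Transposition.transpose 0 (Suc i) (Suc j))"
  have 2: "(\<lambda>j. ?u (Transposition.transpose 0 i (Suc j)))
      = (\<lambda>j. ?x (Transposition.transpose (i - 1) i j))"
    using step by (auto simp: fun_eq_iff Transposition.transpose_def)
  have "b (\<lambda>j. ?x (Transposition.transpose (i - 1) i j)) = - b ?x"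
    by (rule alternating_transpose[OF b]) (use step in auto)
  with step.IH[of ?u] step.prems show ?case by (simp add: 1 2)
qed

text \<open>Permutations are grouped by the image \<open>i\<close> of 0; the \<open>fact k\<close>
  members of a group contribute equally. With \<open>skip\<close> the result has the shape of
  \<open>ext_deriv\<close>, which later allows flux and divergence to be read off the same
  components.\<close>

lemma wedge_covector:
  assumes b: "alternating_form k b"
  shows "wedge 1 k (covector l) b v = (\<Sum>i\<le>k. (-1) ^ i * l (v i) * b (skip i v))"
proof -
  let ?f = "\<lambda>\<sigma>. of_int (sign \<sigma>) * l (v (\<sigma> 0)) * b (\<lambda>j. v (\<sigma> (Suc j)))"
  have "(\<Sum>\<sigma> | \<sigma> permutes {..<1 + k}. ?f \<sigma>) = sum ?f {\<sigma>. \<sigma> permutes insert 0 {1..k}}"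
    by (rule arg_cong[where f="\<lambda>S. sum ?f {\<sigma>. \<sigma> permutes S}"]) auto
  also have "\<dots> = (\<Sum>i\<in>insert 0 {1..k}. \<Sum>q | q permutes {1..k}. ?f (Transposition.transpose 0 i \<circ> q))"
    by (rule sum_over_permutations_insert) auto
  also have "\<dots> = (\<Sum>i\<in>insert 0 {1..k}. \<Sum>q | q permutes {1..k}. (-1) ^ i * l (v i) * b (skip i v))"
  proof (intro sum.cong refl)
    fix i q assume i: "i \<in> insert 0 {1..k}" and q: "q \<in> {q. q permutes {1..k}}"
    let ?t = "Transposition.transpose 0 i"
    have sg: "sign (?t \<circ> q) = (if i = 0 then 1 else -1) * sign q"
      using q by (subst sign_compose)
         (auto simp: sign_swap_id permutation_swap_id intro: permutes_imp_permutation[of "{1..k}"])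
    have 0: "q 0 = 0" using q by (auto simp: permutes_def)
    have "?f (?t \<circ> q) = of_int (sign (?t \<circ> q)) * l (v i) * (of_int (sign q) * b (\<lambda>j. v (?t (Suc j))))"
      using alternating_permutes_Suc[OF b, of q "\<lambda>m. v (?t m)"] q by (simp add: 0)
    also have "\<dots> = (if i = 0 then 1 else -1) * (of_int (sign q * sign q) * l (v i) * b (\<lambda>j. v (?t (Suc j))))"
      unfolding sg of_int_mult by (cases "i = 0") (simp_all add: mult_ac)
    also have "\<dots> = (if i = 0 then 1 else -1) * (l (v i) * b (\<lambda>j. v (?t (Suc j))))"
      by (simp only: sign_idempotent of_int_1 mult_1)
    also have "\<dots> = (-1) ^ i * l (v i) * b (skip i v)"
    proof (cases "i = 0")
      case True
      then have "skip i v = (\<lambda>j. v (?t (Suc j)))" by (auto simp: skip_def)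
      with True show ?thesis by simp
    next
      case False
      with i have "(-1) ^ i * b (skip i v) = - b (\<lambda>j. v (?t (Suc j)))"
        by (intro skip_eq_transpose[OF b]) auto
      then have "(-1) ^ i * l (v i) * b (skip i v) = l (v i) * (- b (\<lambda>j. v (?t (Suc j))))"
        by (metis mult.assoc mult.left_commute)
      with False show ?thesis by simp
    qed
    finally show "?f (?t \<circ> q) = (-1) ^ i * l (v i) * b (skip i v)" .
  qed
  also have "\<dots> = fact k * (\<Sum>i\<le>k. (-1) ^ i * l (v i) * b (skip i v))"
  proof -
    have "card {q. q permutes {1..k}} = fact k" by (simp add: card_permutations[of _ k])
    moreover have "insert 0 {1..k} = {..k}" by auto
    ultimately show ?thesis by (simp add: sum_distrib_left)
  qed
  finally show ?thesis by (simp add: wedge_def covector_def)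
qed

text \<open>Both sides are compared with the omission of entry 0 through
  \<open>skip_eq_transpose\<close>. This is the sign rule behind the cancellation of second
  derivatives when \<open>d\<close> meets a pullback.\<close>

lemma skip_transpose:
  assumes b: "alternating_form k b" and im: "i \<le> k" "m \<le> k" "i \<noteq> m"
  shows "(-1) ^ i * b (skip i (\<lambda>j. v (Transposition.transpose i m j))) = - ((-1) ^ m * b (skip m v))"
proof -
  have D0: "skip 0 u = (\<lambda>j. u (Suc j))" for u :: "nat \<Rightarrow> complex ^ 'a" by (simp add: skip_def)
  consider "i = 0" | "m = 0" | "1 \<le> i" "1 \<le> m" by linarith
  then show ?thesis
  proof cases
    case 1
    then show ?thesis using skip_eq_transpose[OF b, of m v] im by (simp add: D0)
  next
    case 2
    then show ?thesis
      using skip_eq_transpose[OF b, of i "\<lambda>j. v (Transposition.transpose i m j)"] im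
      by (simp add: D0 transpose_commute)
  next
    case 3
    let ?x = "\<lambda>j. v (Transposition.transpose 0 m (Suc j))"
    have "(\<lambda>j. v (Transposition.transpose i m (Transposition.transpose 0 i (Suc j))))
       = (\<lambda>j. ?x (Transposition.transpose (i - 1) (m - 1) j))"
      using 3 im by (auto simp: fun_eq_iff Transposition.transpose_def)
    moreover have "b (\<lambda>j. ?x (Transposition.transpose (i - 1) (m - 1) j)) = - b ?x"
      by (rule alternating_transpose[OF b]) (use 3 im in auto)
    ultimately show ?thesis
      using skip_eq_transpose[OF b, of i "\<lambda>j. v (Transposition.transpose i m j)"]
        skip_eq_transpose[OF b, of m v] 3 im by simp
  qed
qed

section \<open>Signs of permutations that respect the pairing of indices\<close>

text \<open>The values of the standard symplectic form on the frame \<open>e\<^sub>0, i e\<^sub>0, e\<^sub>1, i e\<^sub>1, \<dots>\<close>.\<close>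

definition pairing :: "nat \<Rightarrow> nat \<Rightarrow> int" where
  "pairing a b = (if even a \<and> b = Suc a then 1 else if even b \<and> a = Suc b then -1 else 0)"

text \<open>The map exchanges the blocks \<open>{2 * k, 2 * k + 1}\<close> and
  \<open>{2 * m, 2 * m + 1}\<close>, preserving parity and partners.\<close>

lemma pairing_swap:
  assumes "x \<noteq> y" shows
  "pairing (Transposition.transpose (2 * k) (2 * m) (Transposition.transpose (Suc (2 * k)) (Suc (2 * m)) x))
     (Transposition.transpose (2 * k) (2 * m) (Transposition.transpose (Suc (2 * k)) (Suc (2 * m)) y)) = pairing x y"
proof -
  define \<rho> where "\<rho> z = Transposition.transpose (2 * k) (2 * m) (Transposition.transpose (Suc (2 * k)) (Suc (2 * m)) z)" for z
  have ev: "\<rho> (2 * z) = 2 * Transposition.transpose k m z" for z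
    by (auto simp: \<rho>_def Transposition.transpose_def)
  have od: "\<rho> (Suc (2 * z)) = Suc (2 * Transposition.transpose k m z)" for z
    by (auto simp: \<rho>_def Transposition.transpose_def)
  have s: "pairing (2 * z) (2 * z') = 0" "pairing (Suc (2 * z)) (Suc (2 * z')) = 0"
     "pairing (2 * z) (Suc (2 * z')) = (if z = z' then 1 else 0)"
     "pairing (Suc (2 * z)) (2 * z') = (if z = z' then -1 else 0)" for z z'
    by (auto simp: pairing_def) presburger+
  have "x = 2 * (x div 2) \<or> x = Suc (2 * (x div 2))" "y = 2 * (y div 2) \<or> y = Suc (2 * (y div 2))"
    by presburger+
  then obtain x' y' where "x = 2 * x' \<or> x = Suc (2 * x')" "y = 2 * y' \<or> y = Suc (2 * y')" by blast
  then show ?thesis unfolding \<rho>_def[symmetric]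
    by (auto simp: ev od s transpose_eq_iff)
qed

text \<open>Such a permutation moves whole pairs and flips some of them. Exchanging two pairs is
  even, and each flip contributes -1 to the sign as well as to the product.\<close>

lemma sign_pairing:
  assumes "\<sigma> permutes {..<2 * m}" "\<And>j. j < m \<Longrightarrow> pairing (\<sigma> (2 * j)) (\<sigma> (Suc (2 * j))) \<noteq> 0"
  shows "sign \<sigma> * (\<Prod>j<m. pairing (\<sigma> (2 * j)) (\<sigma> (Suc (2 * j)))) = 1"
  using assms
proof (induction m arbitrary: \<sigma>)
  case (Suc m)
  let ?S = "{..<2 * Suc m}"
  \<comment> \<open>The pair that occupies the last two places; \<open>\<sigma>'\<close> brings it
    home by an even exchange of blocks.\<close>
  define k where "k = \<sigma> (2 * m) div 2"
  let ?t = "Transposition.transpose (2 * k) (2 * m)"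
  let ?t' = "Transposition.transpose (Suc (2 * k)) (Suc (2 * m))"
  define \<sigma>' where "\<sigma>' = ?t \<circ> (?t' \<circ> \<sigma>)"
  have inj: "\<sigma> x \<noteq> \<sigma> y" if "x \<noteq> y" for x y
    using permutes_inj[OF Suc.prems(1)] that by (auto dest: injD)
  have nz: "pairing (\<sigma> (2 * m)) (\<sigma> (Suc (2 * m))) \<noteq> 0" using Suc.prems(2) by simp
  have vals: "\<sigma> (2 * m) = 2 * k \<and> \<sigma> (Suc (2 * m)) = Suc (2 * k) \<or>
              \<sigma> (2 * m) = Suc (2 * k) \<and> \<sigma> (Suc (2 * m)) = 2 * k"
    using nz unfolding pairing_def k_def by (auto split: if_splits elim!: evenE)
  have km: "k \<le> m"
    using vals permutes_in_image[OF Suc.prems(1), of "2 * m"] by auto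
  have t: "?t permutes ?S" "?t' permutes ?S"
    using km by (auto intro!: permutes_swap_id)
  have p': "\<sigma>' permutes ?S"
    unfolding \<sigma>'_def by (intro permutes_compose t Suc.prems)
  note perm = permutes_imp_permutation[OF finite_lessThan[of "2 * Suc m"]]
  have "sign \<sigma>' = sign ?t * (sign ?t' * sign \<sigma>)"
    unfolding \<sigma>'_def
    by (subst sign_compose sign_compose; (intro perm permutes_compose t Suc.prems)?)+ simp
  then have sg': "sign \<sigma>' = sign \<sigma>" by (simp add: sign_swap_id)
  have sy': "pairing (\<sigma>' (2 * j)) (\<sigma>' (Suc (2 * j))) = pairing (\<sigma> (2 * j)) (\<sigma> (Suc (2 * j)))" for j
    using pairing_swap[OF inj, of "2 * j" "Suc (2 * j)" k m] by (simp add: \<sigma>'_def)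
  have vals': "\<sigma>' (2 * m) = 2 * m \<and> \<sigma>' (Suc (2 * m)) = Suc (2 * m) \<or>
              \<sigma>' (2 * m) = Suc (2 * m) \<and> \<sigma>' (Suc (2 * m)) = 2 * m"
    using vals by (auto simp: \<sigma>'_def Transposition.transpose_def) presburger+
  \<comment> \<open>Undoes a possible flip inside the last pair, so that \<open>\<sigma>''\<close>
    fixes both of its indices and the induction hypothesis applies.\<close>
  define u where "u = (if \<sigma>' (2 * m) = 2 * m then id else Transposition.transpose (2 * m) (Suc (2 * m)))"
  define \<sigma>'' where "\<sigma>'' = u \<circ> \<sigma>'"
  have u: "u permutes ?S" unfolding u_def by (auto intro!: permutes_swap_id permutes_id)
  have p'': "\<sigma>'' permutes ?S" unfolding \<sigma>''_def by (intro permutes_compose u p')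
  have fx: "\<sigma>'' (2 * m) = 2 * m" "\<sigma>'' (Suc (2 * m)) = Suc (2 * m)"
    using vals' by (auto simp: \<sigma>''_def u_def)
  have "\<sigma>'' permutes {..<2 * m}"
    by (rule permutes_superset[OF p'']) (use fx in \<open>auto simp: less_Suc_eq\<close>)
  have inj': "\<sigma>' x \<noteq> \<sigma>' y" if "x \<noteq> y" for x y
    using permutes_inj[OF p'] that by (auto dest: injD)
  have u': "u (\<sigma>' i) = \<sigma>' i" if "i < 2 * m" for i
    using vals' that inj'[of i "2 * m"] inj'[of i "Suc (2 * m)"]
    by (auto simp: u_def Transposition.transpose_def)
  have IH: "sign \<sigma>'' * (\<Prod>j<m. pairing (\<sigma>'' (2 * j)) (\<sigma>'' (Suc (2 * j)))) = 1"
    using Suc.prems by (intro Suc.IH \<open>\<sigma>'' permutes {..<2 * m}\<close>) (auto simp: \<sigma>''_def u' sy')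
  have "(\<Prod>j<m. pairing (\<sigma>'' (2 * j)) (\<sigma>'' (Suc (2 * j)))) = (\<Prod>j<m. pairing (\<sigma> (2 * j)) (\<sigma> (Suc (2 * j))))"
    by (intro prod.cong) (auto simp: \<sigma>''_def u' sy')
  moreover have "sign \<sigma>'' = sign u * sign \<sigma>"
    unfolding \<sigma>''_def using sg' by (subst sign_compose) (auto intro: perm u p')
  moreover have "sign u = pairing (\<sigma> (2 * m)) (\<sigma> (Suc (2 * m)))"
    unfolding sy'[symmetric] using vals' by (auto simp: u_def pairing_def sign_swap_id)
  ultimately show ?case using IH by (simp add: mult_ac)
qed simp

text \<open>The value of the normalised \<open>m\<close>-th power on any unitary frame. It is left
  as a sum over permutations; the estimates rely on its positivity.\<close>

definition pairing_const :: "nat \<Rightarrow> real" where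
  "pairing_const m = (\<Sum>\<sigma> | \<sigma> permutes {..<2 * m}.
      of_int (sign \<sigma> * (\<Prod>j<m. pairing (\<sigma> (2 * j)) (\<sigma> (Suc (2 * j)))))) / 2 ^ m / fact m"

text \<open>The identity contributes 1, and by \<open>sign_pairing\<close> every other summand is 0
  or 1.\<close>

lemma pairing_const_pos: "pairing_const m > 0"
proof -
  let ?f = "\<lambda>\<sigma>. real_of_int (sign \<sigma> * (\<Prod>j<m. pairing (\<sigma> (2 * j)) (\<sigma> (Suc (2 * j)))))"
  have "0 < (\<Sum>\<sigma> | \<sigma> permutes {..<2 * m}. ?f \<sigma>)"
  proof (rule sum_pos2[of _ id])
    show "0 < ?f id" by (simp add: pairing_def)
    fix \<sigma> assume "\<sigma> \<in> {\<sigma>. \<sigma> permutes {..<2 * m}}"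
    then have s: "\<sigma> permutes {..<2 * m}" by simp
    show "0 \<le> ?f \<sigma>"
    proof (cases "\<forall>j<m. pairing (\<sigma> (2 * j)) (\<sigma> (Suc (2 * j))) \<noteq> 0")
      case True
      then show ?thesis using sign_pairing[OF s] by simp
    next
      case False
      then have "(\<Prod>j<m. pairing (\<sigma> (2 * j)) (\<sigma> (Suc (2 * j)))) = 0" by auto
      then show ?thesis by (simp only: mult_zero_right of_int_0 order_refl)
    qed
  qed (auto simp: finite_permutations permutes_id)
  then show ?thesis by (simp add: pairing_const_def)
qed

lemma wedge_power_fact_expand:
  assumes w: "alternating_form 2 w"
  shows "wedge_power_fact m w v = (\<Sum>\<sigma> | \<sigma> permutes {..<2 * m}.
     of_int (sign \<sigma>) * (\<Prod>j<m. w (vec_pair (v (\<sigma> (2 * j))) (v (\<sigma> (Suc (2 * j))))))) / 2 ^ m / fact m"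
proof -
  have "w (\<lambda>i. v (\<sigma> (2 * j + i))) = w (vec_pair (v (\<sigma> (2 * j))) (v (\<sigma> (Suc (2 * j)))))" for \<sigma> j
    by (rule alternating_cong[OF w]) (auto simp: less_2_cases_iff)
  then show ?thesis by (simp add: wedge_power_fact_def wedge_prod_2[OF w])
qed

lemma wedge_power_fact_pairing:
  assumes w: "alternating_form 2 w"
    and E: "\<And>a b. a < 2 * m \<Longrightarrow> b < 2 * m \<Longrightarrow> w (vec_pair (E a) (E b)) = of_int (pairing a b)"
  shows "wedge_power_fact m w E = of_real (pairing_const m)"
proof -
  have "(\<Prod>j<m. w (vec_pair (E (\<sigma> (2 * j))) (E (\<sigma> (Suc (2 * j)))))) =
        of_int (\<Prod>j<m. pairing (\<sigma> (2 * j)) (\<sigma> (Suc (2 * j))))" if s: "\<sigma> permutes {..<2 * m}" for \<sigma>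
  proof -
    have "\<sigma> x < 2 * m" if "x < 2 * m" for x using permutes_in_image[OF s, of x] that by simp
    then show ?thesis by (auto intro!: prod.cong E)
  qed
  then show ?thesis
    by (simp add: wedge_power_fact_expand[OF w] pairing_const_def)
qed

text \<open>Number of summands times the largest possible one; the denominator
  \<open>2 ^ m * fact m\<close> is at least 1 and is dropped.\<close>

lemma wedge_power_fact_le:
  assumes w: "alternating_form 2 w"
    and M: "\<And>a b. a < 2 * m \<Longrightarrow> b < 2 * m \<Longrightarrow> cmod (w (vec_pair (v a) (v b))) \<le> M"
  shows "cmod (wedge_power_fact m w v) \<le> fact (2 * m) * M ^ m"
proof -
  let ?f = "\<lambda>\<sigma>. of_int (sign \<sigma>) * (\<Prod>j<m. w (vec_pair (v (\<sigma> (2 * j))) (v (\<sigma> (Suc (2 * j))))))"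
  have f: "cmod (?f \<sigma>) \<le> M ^ m" if s: "\<sigma> permutes {..<2 * m}" for \<sigma>
  proof -
    have "\<sigma> x < 2 * m" if "x < 2 * m" for x using permutes_in_image[OF s, of x] that by simp
    then have "(\<Prod>j<m. cmod (w (vec_pair (v (\<sigma> (2 * j))) (v (\<sigma> (Suc (2 * j))))))) \<le> (\<Prod>j<m. M)"
      by (intro prod_mono) (auto intro!: M)
    moreover have "cmod (of_int (sign \<sigma>)) = 1"
      by (cases \<sigma> rule: sign_cases) auto
    ultimately show ?thesis by (simp add: norm_mult prod_norm)
  qed
  have "cmod (\<Sum>\<sigma> | \<sigma> permutes {..<2 * m}. ?f \<sigma>) \<le> (\<Sum>\<sigma> | \<sigma> permutes {..<2 * m}. M ^ m)"
    by (intro sum_norm_le) (use f in auto)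
  also have "\<dots> = fact (2 * m) * M ^ m"
    by (simp add: card_permutations[OF refl])
  finally have *: "cmod (\<Sum>\<sigma> | \<sigma> permutes {..<2 * m}. ?f \<sigma>) \<le> fact (2 * m) * M ^ m" .
  have "cmod (wedge_power_fact m w v) = cmod (\<Sum>\<sigma> | \<sigma> permutes {..<2 * m}. ?f \<sigma>) / (2 ^ m * fact m)"
    by (simp add: wedge_power_fact_expand[OF w] norm_divide norm_power norm_mult norm_fact)
  also have "\<dots> \<le> cmod (\<Sum>\<sigma> | \<sigma> permutes {..<2 * m}. ?f \<sigma>) / 1"
    by (intro divide_left_mono) (auto intro!: mult_ge1_I)
  finally show ?thesis using * by simp
qed

section \<open>Hermitian forms and their volume densities\<close>

text \<open>What remains of a Hermitian metric under a holomorphic pullback: definiteness may be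
  lost, reality and semidefiniteness are not. The type (1,1) is recorded as invariance under
  multiplication by \<open>\<i>\<close>.\<close>

definition semipositive_form :: "'n::finite covec \<Rightarrow> bool" where
  "semipositive_form w \<longleftrightarrow> alternating_form 2 w \<and> (\<forall>v. w v \<in> \<real>) \<and>
     (\<forall>v. w (\<lambda>j. \<i> *s v j) = w v) \<and> (\<forall>u. 0 \<le> bilin_of w u u)"

lemma semipositive_alternating: "semipositive_form w \<Longrightarrow> alternating_form 2 w"
  by (simp add: semipositive_form_def)

lemma vec_pair_linear:
  assumes "alternating_form 2 w"
  shows "linear (\<lambda>u. w (vec_pair u v))" "linear (\<lambda>v. w (vec_pair u v))"
proof -
  have "(vec_pair 0 v)(0 := u) = vec_pair u v" for u by (simp add: fun_eq_iff)
  then show "linear (\<lambda>u. w (vec_pair u v))"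
    using alternating_linear[OF assms, of 0 "vec_pair 0 v"] by simp
  have "w ((vec_pair u 0)(1 := v)) = w (vec_pair u v)" for v
    by (rule alternating_cong[OF assms]) (auto simp: less_2_cases_iff)
  then show "linear (\<lambda>v. w (vec_pair u v))"
    using alternating_linear[OF assms, of 1 "vec_pair u 0"] by simp
qed

lemma vec_pair_swap:
  assumes "alternating_form 2 w"
  shows "w (vec_pair u v) = - w (vec_pair v u)"
proof -
  have "w (\<lambda>m. vec_pair v u (Transposition.transpose 0 1 m)) = - w (vec_pair v u)"
    by (rule alternating_transpose[OF assms]) auto
  moreover have "w (\<lambda>m. vec_pair v u (Transposition.transpose 0 1 m)) = w (vec_pair u v)"
    by (rule alternating_cong[OF assms]) (auto simp: less_2_cases_iff)
  ultimately show ?thesis by simp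
qed

lemma bilin_linear:
  assumes "alternating_form 2 w"
  shows "linear (\<lambda>u. bilin_of w u v)" "linear (bilin_of w u)"
proof -
  note l = vec_pair_linear[OF assms]
  show "linear (\<lambda>u. bilin_of w u v)"
    using l(1)[of "\<i> *s v"] unfolding bilin_of_def linear_iff by simp
  have "linear (\<lambda>v :: complex ^ 'a. \<i> *s v)"
    by (simp add: linear_iff vec_eq_iff algebra_simps)
  then have "linear (\<lambda>v. w (vec_pair u (\<i> *s v)))"
    using linear_compose[OF _ l(2)[of u]] by (simp only: o_def)
  then show "linear (bilin_of w u)"
    unfolding bilin_of_def linear_iff by simp
qed

lemma i_smult_i_smult: "\<i> *s (\<i> *s v) = - (v :: complex ^ 'n)"
  by (simp add: vec_eq_iff)

lemma i_smult_scaleR: "\<i> *s (c *\<^sub>R v) = c *\<^sub>R (\<i> *s (v :: complex ^ 'n))"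
  by (simp add: vec_eq_iff)

lemma i_smult_minus: "\<i> *s (- v) = - (\<i> *s (v :: complex ^ 'n))"
  by (simp add: vec_eq_iff)

section \<open>Linear algebra of a single semipositive form\<close>

context
  fixes w :: "'n::finite covec"
  assumes w: "semipositive_form w"
begin

private abbreviation (input) "g \<equiv> bilin_of w"

private lemmas alt_w = semipositive_alternating[OF w]

lemmas bilin_semipositive_linear = bilin_linear[OF alt_w]

lemma bilin_minus: "g (- u) v = - g u v" "g u (- v) = - g u v"
  using linear_neg[OF bilin_semipositive_linear(1)] linear_neg[OF bilin_semipositive_linear(2)] by auto

lemma form_eq_bilin: "w (vec_pair u v) = of_real (- g u (\<i> *s v))"
proof -
  have "w (vec_pair u (- v)) = - w (vec_pair u v)"
    using linear_neg[OF vec_pair_linear(2)[OF alt_w]] by blast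
  moreover have "w (vec_pair u v) \<in> \<real>" using w by (auto simp: semipositive_form_def)
  ultimately show ?thesis unfolding bilin_of_def i_smult_i_smult by (simp add: complex_is_Real_iff complex_eq_iff)
qed

lemma bilin_i_smult: "g (\<i> *s u) (\<i> *s v) = g u v"
proof -
  have "w (vec_pair (\<i> *s u) (\<i> *s (\<i> *s v))) = w (\<lambda>j. \<i> *s vec_pair u (\<i> *s v) j)"
    by (rule arg_cong[where f=w]) auto
  also have "\<dots> = w (vec_pair u (\<i> *s v))" using w by (simp only: semipositive_form_def)
  finally show ?thesis by (simp add: bilin_of_def)
qed

lemma bilin_sym: "g u v = g v u"
proof -
  have "w (vec_pair u (\<i> *s v)) = - w (vec_pair (\<i> *s v) u)" by (rule vec_pair_swap[OF alt_w])
  also have "\<dots> = of_real (g (\<i> *s v) (\<i> *s u))" by (simp add: form_eq_bilin)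
  finally have "w (vec_pair u (\<i> *s v)) = of_real (g v u)" by (simp only: bilin_i_smult)
  then show ?thesis unfolding bilin_of_def by simp
qed

lemma bilin_i_smult_left: "g (\<i> *s u) v = - g u (\<i> *s v)"
  using bilin_i_smult[of "u" "- \<i> *s v"] bilin_i_smult[of u "- (\<i> *s v)"] by (simp add: i_smult_minus i_smult_i_smult bilin_minus)

lemma bilin_i_smult_self: "g u (\<i> *s u) = 0"
  using bilin_i_smult_left[of u u] bilin_sym[of u "\<i> *s u"] by simp

lemma bilin_nonneg: "0 \<le> g u u" using w by (simp add: semipositive_form_def)

lemma bilin_scale: "g (c *\<^sub>R u) v = c * g u v" "g u (c *\<^sub>R v) = c * g u v"
  using linear_scale[OF bilin_semipositive_linear(1)] linear_scale[OF bilin_semipositive_linear(2)] by auto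

lemma bilin_add: "g (u + u') v = g u v + g u' v" "g u (v + v') = g u v + g u v'"
  using linear_add[OF bilin_semipositive_linear(1)] linear_add[OF bilin_semipositive_linear(2)] by auto

lemma bilin_diff: "g (u - u') v = g u v - g u' v" "g u (v - v') = g u v - g u v'"
  using linear_diff[OF bilin_semipositive_linear(1)] linear_diff[OF bilin_semipositive_linear(2)] by auto

text \<open>Cauchy-Schwarz in arithmetic-mean form, from nonnegativity on \<open>u + v\<close> and
  \<open>u - v\<close>.\<close>

lemma bilin_le: "\<bar>g u v\<bar> \<le> (g u u + g v v) / 2"
  using bilin_nonneg[of "u + v"] bilin_nonneg[of "u - v"] bilin_sym[of u v] by (simp add: bilin_add bilin_diff)

text \<open>A null vector of a semidefinite form lies in its radical: otherwise the form would take
  negative values on the line \<open>c *\<^sub>R u + v\<close>.\<close>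

lemma bilin_degenerate: assumes "g u u = 0" shows "g u v = 0"
proof (rule ccontr)
  assume n: "g u v \<noteq> 0"
  \<comment> \<open>Chosen so that \<open>2 * c * g u v + g v v = - 1\<close>.\<close>
  define c where "c = - (g v v + 1) / (2 * g u v)"
  have "g (c *\<^sub>R u + v) (c *\<^sub>R u + v) = 2 * c * g u v + g v v"
    using assms bilin_sym[of u v] by (simp add: bilin_add bilin_scale)
  also have "\<dots> = - 1" using n by (simp add: c_def field_simps)
  finally show False using bilin_nonneg[of "c *\<^sub>R u + v"] by linarith
qed

text \<open>A unitary frame: orthonormal and consisting of pairs \<open>e, \<i> e\<close>, as
  \<open>std_frame\<close> is for the Euclidean metric. On such frames
  \<open>wedge_power_fact\<close> has the universal value \<open>pairing_const\<close>.\<close>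

definition adapted_frame :: "(nat \<Rightarrow> complex ^ 'n) \<Rightarrow> nat \<Rightarrow> bool" where
  "adapted_frame E m \<longleftrightarrow> (\<forall>a<2 * m. \<forall>b<2 * m. g (E a) (E b) = (if a = b then 1 else 0)) \<and>
     (\<forall>j<m. E (Suc (2 * j)) = \<i> *s E (2 * j))"

lemma adapted_frame_independent:
  assumes "adapted_frame E m"
  shows "independent (E ` {..<2 * m})" "card (E ` {..<2 * m}) = 2 * m"
proof -
  have inj: "inj_on E {..<2 * m}"
    using assms unfolding adapted_frame_def inj_on_def by (metis lessThan_iff zero_neq_one)
  then show "card (E ` {..<2 * m}) = 2 * m" by (simp add: card_image)
  show "independent (E ` {..<2 * m})"
    unfolding dependent_def
  proof safe
    fix a assume a: "a < 2 * m" "E a \<in> span (E ` {..<2 * m} - {E a})"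
    have "g (E a) x = 0" if x: "x \<in> E ` {..<2 * m} - {E a}" for x
      using assms a x unfolding adapted_frame_def by auto
    then have "g (E a) (E a) = 0"
      using linear_eq_0_on_span[OF bilin_semipositive_linear(2) _ a(2), of "E a"] by blast
    then show False using assms a unfolding adapted_frame_def by simp
  qed
qed

lemma adapted_frame_span:
  assumes "adapted_frame E CARD('n)"
  shows "span (E ` {..<2 * CARD('n)}) = UNIV"
proof -
  have "dim (UNIV :: (complex ^ 'n) set) \<le> card (E ` {..<2 * CARD('n)})"
    using adapted_frame_independent(2)[OF assms] by (simp add: dim_UNIV)
  then show ?thesis
    using card_ge_dim_independent[OF _ adapted_frame_independent(1)[OF assms], of UNIV] by auto
qed

text \<open>Gram-Schmidt, two vectors at a time: the new \<open>u\<close> brings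
  \<open>\<i> *s u\<close> along, which is orthogonal to the old frame because that frame is stable
  under \<open>\<i>\<close> up to sign.\<close>

lemma adapted_frame_extend:
  assumes E: "adapted_frame E m" and m: "m < CARD('n)" and pd: "pos_def g"
  obtains u where "adapted_frame (E(2 * m := u, Suc (2 * m) := \<i> *s u)) (Suc m)"
proof -
  have "dim (E ` {..<2 * m}) \<le> 2 * m"
    using dim_le_card'[of "E ` {..<2 * m}"] adapted_frame_independent(2)[OF E] by simp
  moreover have "dim (UNIV :: (complex ^ 'n) set) = 2 * CARD('n)" by (simp add: dim_UNIV)
  ultimately have "dim (span (E ` {..<2 * m})) < dim (UNIV :: (complex ^ 'n) set)"
    using m by simp
  then have "span (E ` {..<2 * m}) \<noteq> UNIV" by (metis less_irrefl)
  then obtain u0 where u0: "u0 \<notin> span (E ` {..<2 * m})" by blast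
  define u1 where "u1 = u0 - (\<Sum>a<2 * m. g u0 (E a) *\<^sub>R E a)"
  have "(\<Sum>a<2 * m. g u0 (E a) *\<^sub>R E a) \<in> span (E ` {..<2 * m})"
    by (intro span_sum span_scale span_base) auto
  with u0 have "u1 \<noteq> 0" unfolding u1_def by auto
  then have pos: "g u1 u1 > 0" using pd by (simp add: pos_def_def)
  have u1: "g u1 (E b) = 0" if "b < 2 * m" for b
  proof -
    have "g (\<Sum>a<2 * m. g u0 (E a) *\<^sub>R E a) (E b) = (\<Sum>a<2 * m. g u0 (E a) * g (E a) (E b))"
      by (simp add: linear_sum[OF bilin_semipositive_linear(1)] bilin_scale)
    also have "\<dots> = (\<Sum>a<2 * m. if a = b then g u0 (E b) else 0)"
      using E that by (intro sum.cong) (auto simp: adapted_frame_def)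
    also have "\<dots> = g u0 (E b)" using that by simp
    finally show ?thesis by (simp add: u1_def bilin_diff)
  qed
  define u where "u = (1 / sqrt (g u1 u1)) *\<^sub>R u1"
  have uu: "g u u = 1" using pos by (simp add: u_def bilin_scale real_div_sqrt flip: power2_eq_square)
  have uE: "g u (E b) = 0" if "b < 2 * m" for b
    using u1[OF that] by (simp add: u_def bilin_scale)
  have iuE: "g (\<i> *s u) (E b) = 0" if b: "b < 2 * m" for b
  proof (cases "even b")
    case True
    then obtain j where j: "b = 2 * j" by auto
    then have "E (Suc b) = \<i> *s E b" "Suc b < 2 * m" using E b unfolding adapted_frame_def by auto
    then show ?thesis using uE[of "Suc b"] by (simp add: bilin_i_smult_left)
  next
    case False
    then obtain j where j: "b = Suc (2 * j)" by (metis oddE Suc_eq_plus1)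
    then have "E b = \<i> *s E (2 * j)" "2 * j < 2 * m" using E b unfolding adapted_frame_def by auto
    then show ?thesis using uE[of "2 * j"] by (simp add: bilin_i_smult)
  qed
  show thesis
  proof (rule that)
    let ?E = "E(2 * m := u, Suc (2 * m) := \<i> *s u)"
    have "g (?E a) (?E b) = (if a = b then 1 else 0)" if "a < 2 * Suc m" "b < 2 * Suc m" for a b
    proof -
      have "a < 2 * m \<or> a = 2 * m \<or> a = Suc (2 * m)" "b < 2 * m \<or> b = 2 * m \<or> b = Suc (2 * m)"
        using that by auto
      moreover have "g (E c) u = 0" "g (E c) (\<i> *s u) = 0" if "c < 2 * m" for c
        using uE[OF that] iuE[OF that] bilin_sym by metis+
      moreover have "g u (\<i> *s u) = 0" "g (\<i> *s u) u = 0" "g (\<i> *s u) (\<i> *s u) = 1"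
        using bilin_i_smult_self[of u] bilin_sym[of u "\<i> *s u"] bilin_i_smult[of u u] uu by simp_all
      moreover have "g (E a) (E b) = (if a = b then 1 else 0)" if "a < 2 * m" "b < 2 * m"
        using E that unfolding adapted_frame_def by blast
      ultimately show ?thesis
        using uu uE iuE by (elim disjE) simp_all
    qed
    moreover have "?E (Suc (2 * j)) = \<i> *s ?E (2 * j)" if "j < Suc m" for j
      using E that unfolding adapted_frame_def by (auto simp: less_Suc_eq)
    ultimately show "adapted_frame ?E (Suc m)" unfolding adapted_frame_def by blast
  qed
qed

text \<open>The first vector is prescribed. This is used to start a frame in the direction dual to a
  covector, in the radial direction, or in a kernel.\<close>

lemma adapted_frame_exists:
  assumes pd: "pos_def g" and X: "g X X = 1"
  obtains E where "adapted_frame E CARD('n)" "E 0 = X"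
proof -
  have "\<exists>E. adapted_frame E (Suc m) \<and> E 0 = X" if "m < CARD('n)" for m
    using that
  proof (induction m)
    case 0
    have "adapted_frame (\<lambda>j. if j = 0 then X else \<i> *s X) (Suc 0)"
      unfolding adapted_frame_def using X bilin_i_smult[of X X] bilin_i_smult_self[of X] bilin_sym[of X "\<i> *s X"]
      by (auto simp: less_2_cases_iff)
    then show ?case by (intro exI[of _ "\<lambda>j. if j = 0 then X else \<i> *s X"]) simp
  next
    case (Suc m)
    then obtain E where "adapted_frame E (Suc m)" "E 0 = X" by auto
    moreover obtain u where "adapted_frame (E(2 * Suc m := u, Suc (2 * Suc m) := \<i> *s u)) (Suc (Suc m))"
      using adapted_frame_extend[OF \<open>adapted_frame E (Suc m)\<close> Suc.prems pd] .
    ultimately show ?case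
      by (intro exI[of _ "E(2 * Suc m := u, Suc (2 * Suc m) := \<i> *s u)"] conjI) (assumption, simp)
  qed
  from this[of "CARD('n) - 1"] that show thesis by auto
qed

lemma adapted_frame_power:
  assumes E: "adapted_frame E m"
  shows "wedge_power_fact m w E = of_real (pairing_const m)"
proof (rule wedge_power_fact_pairing[OF alt_w])
  fix a b assume ab: "a < 2 * m" "b < 2 * m"
  show "w (vec_pair (E a) (E b)) = of_int (pairing a b)"
  proof (cases "even b")
    case True
    then obtain j where j: "b = 2 * j" by auto
    then have "E (Suc b) = \<i> *s E b" "Suc b < 2 * m" using E ab unfolding adapted_frame_def by auto
    then have "w (vec_pair (E a) (E b)) = of_real (- (if a = Suc b then 1 else 0))"
      using E ab unfolding adapted_frame_def by (metis form_eq_bilin)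
    then show ?thesis using True by (auto simp: pairing_def)
  next
    case False
    then obtain j where j: "b = Suc (2 * j)" by (metis oddE Suc_eq_plus1)
    then have "E b = \<i> *s E (2 * j)" "2 * j < 2 * m" using E ab unfolding adapted_frame_def by auto
    then have "\<i> *s E b = - E (2 * j)" by (simp add: i_smult_i_smult)
    then have "w (vec_pair (E a) (E b)) = of_real (if a = 2 * j then 1 else 0)"
      using E ab \<open>2 * j < 2 * m\<close> unfolding adapted_frame_def by (simp add: form_eq_bilin bilin_minus)
    then show ?thesis using False j by (auto simp: pairing_def)
  qed
qed

lemma wedge_power_real: "wedge_power_fact m w v \<in> \<real>"
proof -
  have "w u \<in> \<real>" for u using w by (simp add: semipositive_form_def)
  moreover have "fact m \<in> (\<real> :: complex set)" by (metis Reals_of_nat of_nat_fact)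
  ultimately show ?thesis
    unfolding wedge_power_fact_expand[OF alt_w]
    by (auto intro!: sum_in_Reals prod_in_Reals Reals_mult Reals_divide)
qed

lemma unit_vector_exists:
  assumes "pos_def g" obtains X where "g X X = 1"
proof -
  obtain b :: "complex ^ 'n" where "b \<in> Basis" using nonempty_Basis by blast
  then have b: "g b b > 0" using assms nonzero_Basis by (auto simp: pos_def_def)
  have "g ((1 / sqrt (g b b)) *\<^sub>R b) ((1 / sqrt (g b b)) *\<^sub>R b) = 1"
    using b by (simp add: bilin_scale real_div_sqrt flip: power2_eq_square)
  then show thesis by (rule that)
qed

text \<open>Existence by expanding \<open>l\<close> in a unitary frame, uniqueness by definiteness;
  together they justify the definite description in \<open>sharp\<close>.\<close>

lemma sharp_eq:
  assumes pd: "pos_def g" and l: "linear l"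
  shows "g (sharp g l) u = l u"
proof -
  obtain X where "g X X = 1" using unit_vector_exists[OF pd] .
  then obtain E where E: "adapted_frame E CARD('n)" using adapted_frame_exists[OF pd] by blast
  let ?X = "\<Sum>a<2 * CARD('n). l (E a) *\<^sub>R E a"
  have "g ?X u = l u" for u
  proof -
    have "g ?X (E b) = l (E b)" if "b < 2 * CARD('n)" for b
    proof -
      have "g ?X (E b) = (\<Sum>a<2 * CARD('n). l (E a) * g (E a) (E b))"
        by (simp add: linear_sum[OF bilin_semipositive_linear(1)] bilin_scale)
      also have "\<dots> = (\<Sum>a<2 * CARD('n). if a = b then l (E b) else 0)"
        using E that by (intro sum.cong) (auto simp: adapted_frame_def)
      also have "\<dots> = l (E b)" using that by simp
      finally show ?thesis .
    qed
    then show ?thesis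
      using linear_eq_on_span[OF bilin_semipositive_linear(2) l, of "E ` {..<2 * CARD('n)}" ?X u] adapted_frame_span[OF E]
      by auto
  qed
  moreover have "Y = ?X" if "\<forall>u. g Y u = l u" for Y
  proof (rule ccontr)
    assume "Y \<noteq> ?X"
    then have "g (Y - ?X) (Y - ?X) > 0" using pd by (simp add: pos_def_def)
    then show False using that calculation by (simp only: bilin_diff)
  qed
  ultimately have "\<exists>!X. \<forall>u. g X u = l u" by blast
  from theI'[OF this] show ?thesis unfolding sharp_def by blast
qed

end

section \<open>Scaling and contraction of forms, and the Euclidean model\<close>

lemma multilinear_scaleR:
  assumes b: "multilinear_form k b"
  shows "b (\<lambda>j. s j *\<^sub>R v j) = (\<Prod>j<k. s j) *\<^sub>R b v"
proof -
  have "b (\<lambda>j. if j < m then s j *\<^sub>R v j else v j) = (\<Prod>j<m. s j) *\<^sub>R b v" if "m \<le> k" for m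
    using that
  proof (induction m)
    case (Suc m)
    let ?v = "\<lambda>j. if j < m then s j *\<^sub>R v j else v j"
    have "(\<lambda>j. if j < Suc m then s j *\<^sub>R v j else v j) = ?v(m := s m *\<^sub>R v m)"
      by (auto simp: fun_eq_iff less_Suc_eq)
    moreover have "b (?v(m := s m *\<^sub>R v m)) = s m *\<^sub>R b (?v(m := v m))"
      using linear_scale[OF multilinear_linear[OF b, of m ?v]] Suc.prems by simp
    moreover have "?v(m := v m) = ?v" by (auto simp: fun_eq_iff)
    ultimately show ?case using Suc by simp
  qed simp
  from this[of k] have "b (\<lambda>j. if j < k then s j *\<^sub>R v j else v j) = (\<Prod>j<k. s j) *\<^sub>R b v" by simp
  moreover have "b (\<lambda>j. s j *\<^sub>R v j) = b (\<lambda>j. if j < k then s j *\<^sub>R v j else v j)"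
    by (rule multilinear_cong[OF b]) simp
  ultimately show ?thesis by simp
qed

text \<open>The interior product with \<open>x\<close>, in the shape used by
  \<open>star_covector\<close>.\<close>

lemma alternating_case_nat:
  assumes a: "alternating_form (Suc k) a"
  shows "alternating_form k (\<lambda>v. a (case_nat x v))"
proof -
  have upd: "case_nat x (v(j := u)) = (case_nat x v)(Suc j := u)" for v j u
    by (auto simp: fun_eq_iff split: nat.split)
  have "a (case_nat x v) = a (case_nat x w)" if "\<forall>j<k. v j = w j" for v w
    by (rule alternating_cong[OF a]) (use that in \<open>auto split: nat.split\<close>)
  moreover have "linear (\<lambda>u. a (case_nat x (v(j := u))))" if "j < k" for v j
    unfolding upd using alternating_linear[OF a, of "Suc j"] that by simp
  moreover have "a (case_nat x v) = 0" if "i < k" "j < k" "i \<noteq> j" "v i = v j" for v i j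
    by (rule alternating_eq_0[OF a, of "Suc i" "Suc j"]) (use that in auto)
  ultimately show ?thesis unfolding alternating_form_def by blast
qed

lemma alternating_covector: "linear l \<Longrightarrow> alternating_form 1 (covector l)"
  by (auto simp: alternating_form_def covector_def)

lemma linear_of_real_comp: "linear l \<Longrightarrow> linear (\<lambda>u. complex_of_real (l u))"
  by (simp add: linear_iff scaleR_conv_of_real)

text \<open>The fundamental form of the Euclidean metric, with the sign for which
  \<open>bilin_of flat_form\<close> is the inner product. It makes \<open>std_frame\<close> an
  adapted frame, so Euclidean frames come from the same lemmas.\<close>

definition flat_form :: "'n::finite covec" where
  "flat_form v = of_real (- (v 0 \<bullet> (\<i> *s v 1)))"

lemma inner_i_smult: "(\<i> *s u) \<bullet> (\<i> *s v) = u \<bullet> (v :: complex ^ 'n)"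
  by (simp add: inner_vec_def inner_complex_def add.commute)

lemma inner_i_smult_left: "(\<i> *s u) \<bullet> v = - (u \<bullet> (\<i> *s (v :: complex ^ 'n)))"
  using inner_i_smult[of u "\<i> *s v"] by (simp only: i_smult_i_smult inner_minus_right)

lemma inner_i_smult_self: "u \<bullet> (\<i> *s (u :: complex ^ 'n)) = 0"
  by (simp add: inner_vec_def inner_complex_def mult.commute)

lemma linear_i_smult: "linear (\<lambda>v :: complex ^ 'n. \<i> *s v)"
  by (simp add: linear_iff vec_eq_iff algebra_simps)

lemma bilin_of_flat: "bilin_of flat_form u v = u \<bullet> v"
  by (simp add: bilin_of_def flat_form_def i_smult_i_smult)

lemma semipositive_flat_form: "semipositive_form (flat_form :: 'n::finite covec)"
proof -
  have "linear (\<lambda>u. flat_form (v(j := u)))" if "j < 2" for v :: "nat \<Rightarrow> complex ^ 'n" and j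
  proof -
    have "j = 0 \<or> j = 1" using that by auto
    then show ?thesis
      by (auto simp: flat_form_def linear_iff inner_add_left inner_add_right i_smult_scaleR
          linear_add[OF linear_i_smult] complex_eq_iff)
  qed
  moreover have "flat_form v = 0" if "i < 2" "j < 2" "i \<noteq> j" "v i = v j" for v :: "nat \<Rightarrow> complex ^ 'n" and i j
    using that by (auto simp: less_2_cases_iff flat_form_def inner_i_smult_self)
  ultimately have "alternating_form 2 (flat_form :: 'n covec)"
    unfolding alternating_form_def by (auto simp: flat_form_def)
  then show ?thesis
    by (simp add: semipositive_form_def bilin_of_flat)
      (simp add: flat_form_def inner_i_smult_left i_smult_i_smult)
qed

lemma pos_def_flat: "pos_def (bilin_of flat_form)"
  by (simp add: pos_def_def bilin_of_flat)

lemma std_frame_adapted: "adapted_frame flat_form (std_frame :: nat \<Rightarrow> complex ^ 'n::finite) CARD('n)"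
proof -
  let ?f = "from_nat_into (UNIV :: 'n set)"
  have inj: "?f a = ?f b \<longleftrightarrow> a = b" if "a < CARD('n)" "b < CARD('n)" for a b
    using bij_betw_from_nat_into_finite[of "UNIV :: 'n set"] that
    by (auto simp: bij_betw_def inj_on_def)
  have "std_frame a \<bullet> (std_frame b :: complex ^ 'n) = (if a = b then 1 else 0)"
    if ab: "a < 2 * CARD('n)" "b < 2 * CARD('n)" for a b
  proof -
    have "a div 2 < CARD('n)" "b div 2 < CARD('n)" using ab by auto
    moreover have "a = b \<longleftrightarrow> a div 2 = b div 2 \<and> (even a \<longleftrightarrow> even b)"
      by (metis even_two_times_div_two odd_two_times_div_two_succ)
    ultimately show ?thesis
      using inj[of "a div 2" "b div 2"] by (auto simp: std_frame_def inner_axis_axis inner_complex_def)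
  qed
  moreover have "std_frame (Suc (2 * j)) = \<i> *s (std_frame (2 * j) :: complex ^ 'n)" for j
    by (simp add: std_frame_def vec_eq_iff axis_def)
  ultimately show ?thesis
    unfolding adapted_frame_def[OF semipositive_flat_form] by (simp add: bilin_of_flat)
qed

lemma std_frame_span: "span (std_frame ` {..<2 * CARD('n::finite)}) = (UNIV :: (complex ^ 'n) set)"
  by (rule adapted_frame_span[OF semipositive_flat_form std_frame_adapted])

lemma flat_power_std_frame:
  "wedge_power_fact CARD('n) flat_form (std_frame :: nat \<Rightarrow> complex ^ 'n::finite) = of_real (pairing_const CARD('n))"
  by (rule adapted_frame_power[OF semipositive_flat_form std_frame_adapted])

section \<open>Densities of powers of a form with respect to Lebesgue measure\<close>

definition volume_density :: "'n::finite covec \<Rightarrow> real" where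
  "volume_density w = Re (wedge_power_fact CARD('n) w std_frame)"

text \<open>Adapted frames alone show that the density is nonzero; its sign is a matter of
  orientation. The segment from the Euclidean form to \<open>w\<close> consists of positive definite
  forms, so the density keeps the sign it has at the Euclidean end.\<close>

lemma volume_density_pos:
  fixes w :: "'n::finite covec"
  assumes w: "semipositive_form w" and pd: "pos_def (bilin_of w)"
  shows "volume_density w > 0"
proof (rule ccontr)
  \<comment> \<open>The convex combination of the two forms, written as a difference to fit
    \<open>alternating_diff_scale\<close>.\<close>
  define ws where "ws s = (\<lambda>v. of_real (1 - s) * flat_form v - of_real (- s) * w v)" for s
  define f where "f s = volume_density (ws s)" for s
  note f_def = f_def[unfolded volume_density_def]
  have alt: "alternating_form 2 (ws s)" for s
    unfolding ws_def
    by (intro alternating_diff_scale semipositive_alternating semipositive_flat_form w)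
  have bil: "bilin_of (ws s) u v = (1 - s) * (u \<bullet> v) + s * bilin_of w u v" for s u v
    unfolding bilin_of_flat[symmetric] by (simp add: ws_def bilin_of_def)
  have sp: "semipositive_form (ws s)" if s: "0 \<le> s" "s \<le> 1" for s
  proof -
    have "0 \<le> bilin_of (ws s) u u" for u
      using s bilin_nonneg[OF w, of u] by (simp add: bil)
    moreover have "ws s v \<in> \<real>" "ws s (\<lambda>j. \<i> *s v j) = ws s v" for v
      using w semipositive_flat_form[where 'n='n]
      by (auto simp: ws_def semipositive_form_def intro!: Reals_add Reals_mult)
    ultimately show ?thesis using alt by (simp add: semipositive_form_def)
  qed
  have pds: "pos_def (bilin_of (ws s))" if s: "0 \<le> s" "s \<le> 1" for s
  proof -
    have "0 < (1 - s) * (v \<bullet> v) + s * bilin_of w v v" if "v \<noteq> 0" for v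
    proof (cases "s = 1")
      case True
      then show ?thesis using pd that by (simp add: pos_def_def)
    next
      case False
      then have "0 < (1 - s) * (v \<bullet> v)" using s that by simp
      moreover have "0 \<le> s * bilin_of w v v" using s bilin_nonneg[OF w, of v] by simp
      ultimately show ?thesis by linarith
    qed
    then show ?thesis by (simp add: pos_def_def bil)
  qed
  have cont: "continuous_on {0..1} f"
    unfolding f_def wedge_power_fact_expand[OF alt] unfolding ws_def by (intro continuous_intros) auto
  assume "\<not> 0 < volume_density w"
  moreover have "ws 1 = w" "ws 0 = flat_form" by (auto simp: ws_def)
  ultimately have "f 1 \<le> 0" "0 \<le> f 0"
    using pairing_const_pos[of "CARD('n)"] by (auto simp: f_def flat_power_std_frame volume_density_def)
  then obtain s where s: "0 \<le> s" "s \<le> 1" "f s = 0"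
    using IVT2'[of f 1 0 0] cont by auto
  \<comment> \<open>A zero on \<open>std_frame\<close> is a zero on every frame, contradicting the
    positive value on a frame adapted to \<open>ws s\<close>.\<close>
  have "wedge_power_fact CARD('n) (ws s) std_frame = 0"
    using s wedge_power_real[OF sp[OF s(1,2)], of "CARD('n)" std_frame]
    by (simp add: f_def complex_is_Real_iff complex_eq_iff)
  then have z: "wedge_power_fact CARD('n) (ws s) v = 0" for v
    by (rule alternating_eq_0_if_basis[OF alternating_wedge_power_fact[OF alt] std_frame_span])
  obtain X where "bilin_of (ws s) X X = 1"
    using unit_vector_exists[OF sp pds] s by blast
  then obtain E where "adapted_frame (ws s) E CARD('n)"
    using adapted_frame_exists[OF sp pds] s by metis
  then have "wedge_power_fact CARD('n) (ws s) E = of_real (pairing_const CARD('n))"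
    using adapted_frame_power[OF sp] s by blast
  then show False using z pairing_const_pos[of "CARD('n)"] by simp
qed

lemma not_pos_def_kernel:
  assumes w: "semipositive_form w" and "\<not> pos_def (bilin_of w)"
  obtains u where "u \<noteq> 0" "bilin_of w u u = 0"
  using assms bilin_nonneg[OF w] unfolding pos_def_def by (metis less_eq_real_def)

text \<open>The kernel contains the complex line of a null vector, so both vectors of the first pair
  can be taken in it. Two are wanted because an expansion with \<open>skip\<close> may omit one of
  them.\<close>

lemma kernel_frame:
  fixes w :: "'n::finite covec"
  assumes w: "semipositive_form w" and npd: "\<not> pos_def (bilin_of w)"
  obtains E where "adapted_frame flat_form E CARD('n)" "\<And>v. bilin_of w (E 0) v = 0" "\<And>v. bilin_of w (E 1) v = 0"
proof -
  obtain u where u: "u \<noteq> 0" "bilin_of w u u = 0" using not_pos_def_kernel[OF assms] .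
  have "bilin_of flat_form (sgn u) (sgn u) = 1"
    using u by (simp add: bilin_of_flat dot_square_norm norm_sgn)
  then obtain E where E: "adapted_frame flat_form E CARD('n)" "E 0 = sgn u"
    using adapted_frame_exists[OF semipositive_flat_form pos_def_flat] by metis
  have 0: "bilin_of w (E 0) v = 0" for v
    using bilin_degenerate[OF w u(2)] by (simp add: E sgn_div_norm bilin_scale[OF w])
  have "E 1 = \<i> *s E 0"
    using E(1) unfolding adapted_frame_def[OF semipositive_flat_form] by (metis One_nat_def mult_0_right zero_less_card_finite)
  then have "bilin_of w (E 1) v = 0" for v
    using 0 by (simp add: bilin_i_smult_left[OF w])
  with E 0 show thesis using that by blast
qed

lemma wedge_power_degenerate:
  fixes w :: "'n::finite covec"
  assumes w: "semipositive_form w" and npd: "\<not> pos_def (bilin_of w)"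
  shows "wedge_power_fact CARD('n) w v = 0"
proof -
  obtain E where E: "adapted_frame flat_form E CARD('n)" "\<And>v. bilin_of w (E 0) v = 0"
    using kernel_frame[OF assms] by metis
  have "(\<Prod>j<CARD('n). w (vec_pair (E (\<sigma> (2 * j))) (E (\<sigma> (Suc (2 * j)))))) = 0"
    if s: "\<sigma> permutes {..<2 * CARD('n)}" for \<sigma>
  proof -
    \<comment> \<open>The place where the kernel vector \<open>E 0\<close> ends up; the factor
      containing that place is zero.\<close>
    define m where "m = inv \<sigma> 0"
    have "m < 2 * CARD('n)" "\<sigma> m = 0"
      using permutes_inverses[OF s] permutes_in_image[OF permutes_inv[OF s], of 0] by (auto simp: m_def)
    moreover have "w (vec_pair (E (\<sigma> (2 * (m div 2)))) (E (\<sigma> (Suc (2 * (m div 2)))))) = 0"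
    proof (cases "even m")
      case True
      then show ?thesis using E(2) \<open>\<sigma> m = 0\<close> by (simp add: form_eq_bilin[OF w])
    next
      case False
      then have "Suc (2 * (m div 2)) = m" by presburger
      then show ?thesis using E(2) \<open>\<sigma> m = 0\<close>
        by (subst vec_pair_swap[OF semipositive_alternating[OF w]]) (simp add: form_eq_bilin[OF w])
    qed
    ultimately show ?thesis by (auto intro!: bexI[of _ "m div 2"])
  qed
  then have "(\<Sum>\<sigma> | \<sigma> permutes {..<2 * CARD('n)}. of_int (sign \<sigma>) *
      (\<Prod>j<CARD('n). w (vec_pair (E (\<sigma> (2 * j))) (E (\<sigma> (Suc (2 * j))))))) = 0"
    by (intro sum.neutral) (simp del: prod_zero_iff)
  then have "wedge_power_fact CARD('n) w E = 0"
    unfolding wedge_power_fact_expand[OF semipositive_alternating[OF w]] by simp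
  then show ?thesis
    by (rule alternating_eq_0_if_basis[OF alternating_wedge_power_fact[OF semipositive_alternating[OF w]]
          adapted_frame_span[OF semipositive_flat_form E(1)]])
qed

lemma volume_density_nonneg:
  assumes "semipositive_form w" shows "0 \<le> volume_density w"
  using volume_density_pos[OF assms] wedge_power_degenerate[OF assms]
  by (cases "pos_def (bilin_of w)") (auto simp: less_imp_le volume_density_def)

lemma wedge_power_eq_volume_density:
  "semipositive_form w \<Longrightarrow> wedge_power_fact CARD('n) w std_frame = of_real (volume_density (w :: 'n::finite covec))"
  using wedge_power_real[of w "CARD('n)" std_frame]
  by (simp add: complex_is_Real_iff complex_eq_iff volume_density_def)

text \<open>On a frame adapted to \<open>w\<close> all entries of \<open>w'\<close> are at most
  \<open>K\<close>, which bounds its power there; proportionality of top forms carries the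
  comparison to \<open>std_frame\<close>.\<close>

lemma volume_density_mono:
  fixes w w' :: "'n::finite covec"
  assumes w: "semipositive_form w" and w': "semipositive_form w'" and K: "K \<ge> 0"
    and le: "\<And>v. bilin_of w' v v \<le> K * bilin_of w v v"
  shows "volume_density w' * pairing_const CARD('n) \<le> fact (2 * CARD('n)) * K ^ CARD('n) * volume_density w"
proof (cases "pos_def (bilin_of w')")
  case True
  then have pd: "pos_def (bilin_of w)"
    using le K bilin_nonneg[OF w] unfolding pos_def_def
    by (metis less_eq_real_def mult_zero_right order_less_le_trans less_irrefl)
  obtain X where "bilin_of w X X = 1" using unit_vector_exists[OF w pd] .
  then obtain E where E: "adapted_frame w E CARD('n)" using adapted_frame_exists[OF w pd] by metis
  have EE: "bilin_of w (E a) (E a) = 1" if "a < 2 * CARD('n)" for a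
    using E that unfolding adapted_frame_def[OF w] by simp
  have "cmod (w' (vec_pair (E a) (E b))) \<le> K" if ab: "a < 2 * CARD('n)" "b < 2 * CARD('n)" for a b
  proof -
    have "\<bar>bilin_of w' (E a) (\<i> *s E b)\<bar> \<le> (bilin_of w' (E a) (E a) + bilin_of w' (\<i> *s E b) (\<i> *s E b)) / 2"
      by (rule bilin_le[OF w'])
    also have "\<dots> \<le> K" using le[of "E a"] le[of "E b"] EE ab by (simp add: bilin_i_smult[OF w'])
    finally show ?thesis by (simp add: form_eq_bilin[OF w'])
  qed
  then have bd: "cmod (wedge_power_fact CARD('n) w' E) \<le> fact (2 * CARD('n)) * K ^ CARD('n)"
    by (rule wedge_power_fact_le[OF semipositive_alternating[OF w']])
  have "volume_density w' * pairing_const CARD('n) = cmod (wedge_power_fact CARD('n) w' E) * volume_density w"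
  proof -
    have "wedge_power_fact CARD('n) w' std_frame * wedge_power_fact CARD('n) w E
        = wedge_power_fact CARD('n) w std_frame * wedge_power_fact CARD('n) w' E"
      by (intro top_forms_proportional[OF alternating_wedge_power_fact alternating_wedge_power_fact adapted_frame_span[OF w E]]
          semipositive_alternating w w')
    then have "of_real (volume_density w') * of_real (pairing_const CARD('n)) =
        of_real (volume_density w) * wedge_power_fact CARD('n) w' E"
      using adapted_frame_power[OF w E] by (simp only: wedge_power_eq_volume_density[OF w] wedge_power_eq_volume_density[OF w'])
    then have "cmod (of_real (volume_density w') * of_real (pairing_const CARD('n))) =
        cmod (of_real (volume_density w) * wedge_power_fact CARD('n) w' E)"
      by (rule arg_cong)
    then show ?thesis
      using volume_density_nonneg[OF w] volume_density_nonneg[OF w'] pairing_const_pos[of "CARD('n)"]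
      by (simp add: norm_mult mult.commute)
  qed
  also have "\<dots> \<le> fact (2 * CARD('n)) * K ^ CARD('n) * volume_density w"
    by (intro mult_right_mono bd volume_density_nonneg w)
  finally show ?thesis .
next
  case False
  have "0 \<le> fact (2 * CARD('n)) * K ^ CARD('n) * volume_density w"
    using volume_density_nonneg[OF w] K by simp
  then show ?thesis using wedge_power_degenerate[OF w' False] by (simp add: volume_density_def)
qed

text \<open>A vector of length 0 stays in the unit ball under every scaling, so a form that is
  bounded on unit vectors must vanish on it.\<close>

lemma multilinear_kernel:
  assumes w: "semipositive_form w" and b: "multilinear_form k b"
    and C: "\<And>v. (\<And>j. j < k \<Longrightarrow> bilin_of w (v j) (v j) \<le> 1) \<Longrightarrow> cmod (b v) \<le> C"
    and j0: "j0 < k" "bilin_of w (v j0) (v j0) = 0"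
  shows "b v = 0"
proof (rule ccontr)
  assume "b v \<noteq> 0"
  define q where "q j = bilin_of w (v j) (v j)" for j
  have q: "q j \<ge> 0" for j using bilin_nonneg[OF w] by (simp add: q_def)
  define P where "P = (\<Prod>j\<in>{..<k} - {j0}. 1 / (1 + q j))"
  have "P > 0" unfolding P_def using q by (intro prod_pos) (auto intro!: add_pos_nonneg)
  have *: "c * P * cmod (b v) \<le> C" if "c > 0" for c
  proof -
    \<comment> \<open>The factor \<open>1 / (1 + q j)\<close> brings every other argument into the
      unit ball, even one with \<open>q j = 0\<close>, while \<open>c\<close> remains free.\<close>
    define s where "s j = (if j = j0 then c else 1 / (1 + q j))" for j
    have "s j ^ 2 * q j \<le> 1" for j
    proof (cases "j = j0")
      case True
      then show ?thesis using j0 by (simp add: q_def)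
    next
      case False
      have "q j \<le> (1 + q j)\<^sup>2" using q[of j] by (simp add: power2_eq_square algebra_simps)
      then show ?thesis using False q[of j] by (simp add: s_def power_divide divide_simps add_nonneg_eq_0_iff)
    qed
    then have "cmod (b (\<lambda>j. s j *\<^sub>R v j)) \<le> C"
      by (intro C) (simp add: bilin_scale[OF w] q_def power2_eq_square mult.assoc)
    moreover have "(\<Prod>j<k. s j) = c * P"
    proof -
      have "(\<Prod>j<k. s j) = s j0 * (\<Prod>j\<in>{..<k} - {j0}. s j)"
        using j0 by (intro prod.remove) auto
      also have "(\<Prod>j\<in>{..<k} - {j0}. s j) = P"
        unfolding P_def by (intro prod.cong) (auto simp: s_def)
      finally show ?thesis by (simp add: s_def)
    qed
    ultimately show ?thesis using \<open>P > 0\<close> \<open>c > 0\<close>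
      by (simp add: multilinear_scaleR[OF b] abs_mult)
  qed
  have "C \<ge> 0" using *[of 1] \<open>P > 0\<close> by (smt (verit) norm_ge_zero mult_nonneg_nonneg mult_1)
  \<comment> \<open>This choice of \<open>c\<close> makes the estimate read
    \<open>C + 1 \<le> C\<close>.\<close>
  have "(C + 1) / (P * cmod (b v)) * P * cmod (b v) \<le> C"
    using \<open>C \<ge> 0\<close> \<open>P > 0\<close> \<open>b v \<noteq> 0\<close> by (intro *) simp
  then show False using \<open>P > 0\<close> \<open>b v \<noteq> 0\<close> by (simp add: mult.assoc)
qed

lemma sharp_unique:
  assumes w: "semipositive_form w" and pd: "pos_def (bilin_of w)" and l: "linear l"
    and Y: "\<And>u. bilin_of w Y u = l u"
  shows "sharp (bilin_of w) l = Y"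
proof (rule ccontr)
  let ?X = "sharp (bilin_of w) l"
  assume "?X \<noteq> Y"
  then have "bilin_of w (?X - Y) (?X - Y) > 0" using pd by (simp add: pos_def_def)
  then show False by (simp only: bilin_diff[OF w] Y sharp_eq[OF w pd l])
qed

text \<open>The frame starts with the normalised dual vector of \<open>l\<close>; by orthogonality
  \<open>l\<close> vanishes on the remaining vectors, and a wedge product with \<open>l\<close>
  keeps a single term.\<close>

lemma sharp_frame:
  fixes w :: "'n::finite covec"
  assumes w: "semipositive_form w" and pd: "pos_def (bilin_of w)" and l: "linear l" and n0: "l u \<noteq> 0"
  defines "X \<equiv> sharp (bilin_of w) l" and "L \<equiv> colength (bilin_of w) l"
  obtains E where "adapted_frame w E CARD('n)" "L > 0" "X = L *\<^sub>R E 0" "l (E 0) = L"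
    "\<And>j. 0 < j \<Longrightarrow> j < 2 * CARD('n) \<Longrightarrow> l (E j) = 0"
proof -
  have X: "bilin_of w X u = l u" for u unfolding X_def by (rule sharp_eq[OF w pd l])
  have "X \<noteq> 0" using X[of u] n0 linear_0[OF bilin_semipositive_linear(1)[OF w]] by auto
  then have pos: "bilin_of w X X > 0" using pd by (simp add: pos_def_def)
  have L: "L = sqrt (bilin_of w X X)" by (simp add: L_def X_def colength_def)
  have Lp: "L > 0" "L * L = bilin_of w X X" using pos by (auto simp: L)
  have "bilin_of w ((1 / L) *\<^sub>R X) ((1 / L) *\<^sub>R X) = 1"
    using Lp pos by (simp add: bilin_scale[OF w])
  then obtain E where E: "adapted_frame w E CARD('n)" "E 0 = (1 / L) *\<^sub>R X"
    using adapted_frame_exists[OF w pd] by metis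
  have E0: "X = L *\<^sub>R E 0" using Lp by (simp add: E)
  have lE: "l (E j) = L * (if j = 0 then 1 else 0)" if "j < 2 * CARD('n)" for j
  proof -
    have "l (E j) = L * bilin_of w (E 0) (E j)"
      unfolding X[symmetric] by (subst E0) (simp add: bilin_scale[OF w])
    then show ?thesis using E(1) that unfolding adapted_frame_def[OF w] by simp
  qed
  show thesis using that[OF E(1) Lp(1) E0] lE by simp
qed

lemma alternating_wedge_covector:
  fixes b :: "'n::finite covec"
  assumes "alternating_form (2 * CARD('n) - 1) b" "linear l"
  shows "alternating_form (2 * CARD('n)) (wedge 1 (2 * CARD('n) - 1) (covector l) b)"
proof -
  have "1 + (2 * CARD('n) - 1) = 2 * CARD('n)" using zero_less_card_finite[where 'a='n] by linarith
  then show ?thesis using alternating_wedge[OF alternating_covector[OF assms(2)] assms(1)] by metis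
qed

lemma wedge_covector_frame:
  fixes b :: "'n::finite covec"
  assumes b: "alternating_form (2 * CARD('n) - 1) b"
    and "\<And>j. 0 < j \<Longrightarrow> j < 2 * CARD('n) \<Longrightarrow> l (E j) = 0"
  shows "wedge 1 (2 * CARD('n) - 1) (covector l) b E = l (E 0) * b (skip 0 E)"
proof -
  have "(\<Sum>i\<le>2 * CARD('n) - 1. (-1) ^ i * l (E i) * b (skip i E)) = (\<Sum>i\<in>{0}. (-1) ^ i * l (E i) * b (skip i E))"
    using assms(2) zero_less_card_finite[where 'a='n] by (intro sum.mono_neutral_right) auto
  then show ?thesis unfolding wedge_covector[OF b] by simp
qed

text \<open>In a frame aligned with \<open>l\<close> the product \<open>l \<and> b\<close> is
  \<open>L * b (skip 0 E)\<close>, a value on unit vectors. Passing to \<open>std_frame\<close>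
  multiplies it by the volume density over \<open>pairing_const\<close>.\<close>

lemma flux_le:
  fixes w :: "'n::finite covec"
  assumes w: "semipositive_form w" and pd: "pos_def (bilin_of w)" and l: "linear l"
    and b: "alternating_form (2 * CARD('n) - 1) b"
    and C: "\<And>v. (\<And>j. j < 2 * CARD('n) - 1 \<Longrightarrow> bilin_of w (v j) (v j) \<le> 1) \<Longrightarrow> cmod (b v) \<le> C"
  shows "cmod (wedge 1 (2 * CARD('n) - 1) (covector (\<lambda>u. of_real (l u))) b std_frame) * pairing_const CARD('n)
     \<le> C * colength (bilin_of w) l * volume_density w"
proof (cases "\<exists>u. l u \<noteq> 0")
  case False
  then have "bilin_of w (sharp (bilin_of w) l) u = 0" for u using sharp_eq[OF w pd l] by simp
  with False show ?thesis unfolding wedge_covector[OF b] by (simp add: colength_def)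
next
  case True
  define L where "L = colength (bilin_of w) l"
  define T where "T = wedge 1 (2 * CARD('n) - 1) (covector (\<lambda>u. of_real (l u))) b"
  from True obtain E where E: "adapted_frame w E CARD('n)" "L > 0" "l (E 0) = L"
    "\<And>j. 0 < j \<Longrightarrow> j < 2 * CARD('n) \<Longrightarrow> l (E j) = 0"
    using sharp_frame[OF w pd l] unfolding L_def by metis
  have TE: "T E = of_real L * b (skip 0 E)"
    unfolding T_def by (subst wedge_covector_frame[OF b]) (use E in auto)
  have "cmod (b (skip 0 E)) \<le> C"
    using E(1) by (intro C) (simp add: adapted_frame_def[OF w] skip_def)
  then have le: "cmod (T E) \<le> C * L" using E(2) by (simp add: TE norm_mult)
  have T: "alternating_form (2 * CARD('n)) T"
    unfolding T_def by (intro alternating_wedge_covector b linear_of_real_comp l)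
  have "T std_frame * wedge_power_fact CARD('n) w E = wedge_power_fact CARD('n) w std_frame * T E"
    by (rule top_forms_proportional[OF T alternating_wedge_power_fact[OF semipositive_alternating[OF w]]
          adapted_frame_span[OF w E(1)]])
  then have "T std_frame * of_real (pairing_const CARD('n)) = of_real (volume_density w) * T E"
    using adapted_frame_power[OF w E(1)] by (simp only: wedge_power_eq_volume_density[OF w])
  then have "cmod (T std_frame * of_real (pairing_const CARD('n))) = cmod (of_real (volume_density w) * T E)"
    by (rule arg_cong)
  then have "cmod (T std_frame) * pairing_const CARD('n) = volume_density w * cmod (T E)"
    using volume_density_nonneg[OF w] pairing_const_pos[of "CARD('n)"] by (simp add: norm_mult)
  also have "\<dots> \<le> volume_density w * (C * L)"
    by (intro mult_left_mono le volume_density_nonneg w)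
  finally show ?thesis by (simp add: T_def L_def mult_ac)
qed

text \<open>Whichever entry is skipped, the first slot holds \<open>E 0\<close> or
  \<open>E 1\<close>, both in the kernel. This matches the default value 0 of
  \<open>d_tau_length\<close>.\<close>

lemma flux_degenerate:
  fixes w :: "'n::finite covec"
  assumes w: "semipositive_form w" and npd: "\<not> pos_def (bilin_of w)" and l: "linear l"
    and b: "alternating_form (2 * CARD('n) - 1) b"
    and C: "\<And>v. (\<And>j. j < 2 * CARD('n) - 1 \<Longrightarrow> bilin_of w (v j) (v j) \<le> 1) \<Longrightarrow> cmod (b v) \<le> C"
  shows "wedge 1 (2 * CARD('n) - 1) (covector (\<lambda>u. of_real (l u))) b v = 0"
proof -
  obtain E where E: "adapted_frame flat_form E CARD('n)" "\<And>v. bilin_of w (E 0) v = 0" "\<And>v. bilin_of w (E 1) v = 0"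
    using kernel_frame[OF w npd] by metis
  have p: "0 < 2 * CARD('n) - 1" using zero_less_card_finite[where 'a='n] by linarith
  have "b (skip i E) = 0" for i
    by (rule multilinear_kernel[OF w alternating_multilinear[OF b] C p]) (use E in \<open>auto simp: skip_def\<close>)
  then have "wedge 1 (2 * CARD('n) - 1) (covector (\<lambda>u. of_real (l u))) b E = 0"
    unfolding wedge_covector[OF b] by simp
  then show ?thesis
    by (rule alternating_eq_0_if_basis[OF alternating_wedge_covector[OF b linear_of_real_comp[OF l]]
          adapted_frame_span[OF semipositive_flat_form E(1)]])
qed

lemma d_tau_eq: "d_tau z u = 2 * (z \<bullet> u)"
proof -
  have "((\<lambda>z :: complex ^ 'a. (norm z)\<^sup>2) has_derivative (\<lambda>u. 2 * (z \<bullet> u))) (at z)"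
    unfolding power2_norm_eq_inner
    by (auto intro!: derivative_eq_intros simp: inner_commute)
  then show ?thesis unfolding d_tau_def by (metis frechet_derivative_at)
qed

lemma linear_d_tau: "linear (d_tau z)"
  by (simp add: linear_iff d_tau_eq inner_add_right)

text \<open>The identity \<open>l \<and> \<star>l = |l|^2 vol\<close>. In an aligned frame one
  factor \<open>L\<close> comes from \<open>l (E 0)\<close>, the other from the dual vector
  \<open>L *\<^sub>R E 0\<close> inside the volume form.\<close>

lemma star_flux:
  fixes w :: "'n::finite covec"
  assumes w: "semipositive_form w" and pd: "pos_def (bilin_of w)" and l: "linear l"
  shows "wedge 1 (2 * CARD('n) - 1) (covector (\<lambda>u. of_real (l u)))
       (\<lambda>v. wedge_power_fact CARD('n) w (case_nat (sharp (bilin_of w) l) v)) std_frame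
     = of_real ((colength (bilin_of w) l)\<^sup>2 * volume_density w)"
proof (cases "\<exists>u. l u \<noteq> 0")
  case False
  have "Suc (2 * CARD('n) - 1) = 2 * CARD('n)" using zero_less_card_finite[where 'a='n] by linarith
  then have b: "alternating_form (2 * CARD('n) - 1) (\<lambda>v. wedge_power_fact CARD('n) w (case_nat (sharp (bilin_of w) l) v))"
    using alternating_case_nat[of "2 * CARD('n) - 1"] alternating_wedge_power_fact[OF semipositive_alternating[OF w], of "CARD('n)"]
    by metis
  have "bilin_of w (sharp (bilin_of w) l) u = 0" for u using False sharp_eq[OF w pd l] by simp
  with False show ?thesis unfolding wedge_covector[OF b] by (simp add: colength_def)
next
  case True
  define X where "X = sharp (bilin_of w) l"
  define L where "L = colength (bilin_of w) l"
  define A where "A = wedge_power_fact CARD('n) w"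
  define b where "b = (\<lambda>v. A (case_nat X v))"
  have A: "alternating_form (2 * CARD('n)) A"
    unfolding A_def by (rule alternating_wedge_power_fact[OF semipositive_alternating[OF w]])
  have Suc: "Suc (2 * CARD('n) - 1) = 2 * CARD('n)" using zero_less_card_finite[where 'a='n] by linarith
  have b: "alternating_form (2 * CARD('n) - 1) b"
    unfolding b_def using alternating_case_nat[of "2 * CARD('n) - 1"] A Suc by metis
  define T where "T = wedge 1 (2 * CARD('n) - 1) (covector (\<lambda>u. of_real (l u))) b"
  from True obtain E where E: "adapted_frame w E CARD('n)" "L > 0" "X = L *\<^sub>R E 0" "l (E 0) = L"
    "\<And>j. 0 < j \<Longrightarrow> j < 2 * CARD('n) \<Longrightarrow> l (E j) = 0"
    using sharp_frame[OF w pd l] unfolding L_def X_def by metis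
  have "case_nat X (skip 0 E) = E(0 := L *\<^sub>R E 0)"
    by (auto simp: fun_eq_iff skip_def E(3) split: nat.split)
  moreover have "A (E(0 := L *\<^sub>R E 0)) = L *\<^sub>R A (E(0 := E 0))"
    using linear_scale[OF alternating_linear[OF A, of 0 E]] by simp
  ultimately have bE: "b (skip 0 E) = of_real L * A E" by (simp add: b_def scaleR_conv_of_real)
  have TE: "T E = of_real L * b (skip 0 E)"
    unfolding T_def by (subst wedge_covector_frame[OF b]) (use E in auto)
  have T: "alternating_form (2 * CARD('n)) T"
    unfolding T_def by (intro alternating_wedge_covector b linear_of_real_comp l)
  have "T std_frame * A E = A std_frame * T E"
    by (rule top_forms_proportional[OF T A adapted_frame_span[OF w E(1)]])
  moreover have "A E = of_real (pairing_const CARD('n))"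
    unfolding A_def by (rule adapted_frame_power[OF w E(1)])
  then have "A E \<noteq> 0" using pairing_const_pos[of "CARD('n)"] by simp
  ultimately have "T std_frame = of_real L * of_real L * A std_frame"
    by (simp add: TE bE)
  then have "T std_frame = of_real (L\<^sup>2 * volume_density w)"
    unfolding A_def wedge_power_eq_volume_density[OF w] by (simp add: power2_eq_square)
  then show ?thesis by (simp add: T_def b_def A_def X_def L_def)
qed

text \<open>The length of \<open>d\<tau>\<close> may blow up near degenerate points, but
  \<open>d\<tau> \<and> \<star>d\<tau>\<close> does not. It is evaluated on a Euclidean frame
  beginning with \<open>sgn z\<close>: the dual vector \<open>X\<close> enters only through
  \<open>bilin_of w X v = d_tau z v\<close>, so no bound on \<open>X\<close> itself is
  wanted.\<close>

lemma star_flux_le: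
  fixes w :: "'n::finite covec"
  assumes w: "semipositive_form w" and pd: "pos_def (bilin_of w)" and z: "z \<noteq> 0"
    and M: "\<And>u v. norm u = 1 \<Longrightarrow> norm v = 1 \<Longrightarrow> \<bar>bilin_of w u v\<bar> \<le> M" and zM: "2 * norm z \<le> M"
  shows "(colength (bilin_of w) (d_tau z))\<^sup>2 * volume_density w \<le> 2 * norm z * (fact (2 * CARD('n)) * M ^ CARD('n))"
proof -
  define X where "X = sharp (bilin_of w) (d_tau z)"
  define A where "A = wedge_power_fact CARD('n) w"
  define b where "b = (\<lambda>v. A (case_nat X v))"
  have A: "alternating_form (2 * CARD('n)) A"
    unfolding A_def by (rule alternating_wedge_power_fact[OF semipositive_alternating[OF w]])
  have Suc: "Suc (2 * CARD('n) - 1) = 2 * CARD('n)" using zero_less_card_finite[where 'a='n] by linarith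
  have b: "alternating_form (2 * CARD('n) - 1) b"
    unfolding b_def using alternating_case_nat[of "2 * CARD('n) - 1"] A Suc by metis
  define T where "T = wedge 1 (2 * CARD('n) - 1) (covector (\<lambda>u. of_real (d_tau z u))) b"
  have T: "alternating_form (2 * CARD('n)) T"
    unfolding T_def by (intro alternating_wedge_covector b linear_of_real_comp linear_d_tau)
  have "bilin_of flat_form (sgn z) (sgn z) = 1"
    using z by (simp add: bilin_of_flat dot_square_norm norm_sgn)
  then obtain E where E: "adapted_frame flat_form E CARD('n)" "E 0 = sgn z"
    using adapted_frame_exists[OF semipositive_flat_form pos_def_flat] by metis
  note span = adapted_frame_span[OF semipositive_flat_form E(1)]
  have EE: "E a \<bullet> E c = (if a = c then 1 else 0)" if "a < 2 * CARD('n)" "c < 2 * CARD('n)" for a c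
    using E(1) that unfolding adapted_frame_def[OF semipositive_flat_form] by (simp add: bilin_of_flat)
  have zE: "z = norm z *\<^sub>R E 0" using z by (simp add: E(2) sgn_div_norm)
  have l: "d_tau z (E j) = 2 * norm z * (if j = 0 then 1 else 0)" if "j < 2 * CARD('n)" for j
    unfolding d_tau_eq by (subst zE) (use EE[of 0 j] that in simp)
  have nE: "norm (E a) = 1" if "a < 2 * CARD('n)" for a
    using EE[OF that that] by (simp add: norm_eq_1)
  have TE: "T E = of_real (2 * norm z) * A (E(0 := X))"
  proof -
    have "case_nat X (skip 0 E) = E(0 := X)" by (auto simp: fun_eq_iff skip_def split: nat.split)
    then show ?thesis unfolding T_def by (subst wedge_covector_frame[OF b]) (use l in \<open>auto simp: b_def\<close>)
  qed
  have "T std_frame * wedge_power_fact CARD('n) flat_form E =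
      wedge_power_fact CARD('n) (flat_form :: 'n covec) std_frame * T E"
    by (rule top_forms_proportional[OF T alternating_wedge_power_fact[OF semipositive_alternating[OF semipositive_flat_form]] span])
  then have eq: "T std_frame = T E"
    using adapted_frame_power[OF semipositive_flat_form E(1)] pairing_const_pos[of "CARD('n)"]
    by (simp add: flat_power_std_frame mult.commute)
  have norm_i: "norm (\<i> *s v) = norm v" for v :: "complex ^ 'n"
    by (simp add: norm_eq_sqrt_inner inner_i_smult)
  have XE: "\<bar>bilin_of w X (\<i> *s v)\<bar> \<le> 2 * norm z" if "norm v = 1" for v
    using Cauchy_Schwarz_ineq2[of z "\<i> *s v"] that
    unfolding X_def sharp_eq[OF w pd linear_d_tau] d_tau_eq by (simp add: norm_i abs_mult)
  have le: "cmod (A (E(0 := X))) \<le> fact (2 * CARD('n)) * M ^ CARD('n)"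
    unfolding A_def
  proof (rule wedge_power_fact_le[OF semipositive_alternating[OF w]])
    fix a c assume ac: "a < 2 * CARD('n)" "c < 2 * CARD('n)"
    have M0: "0 \<le> M" using zM norm_ge_zero[of z] by linarith
    \<comment> \<open>Only the slot 0 carries \<open>X\<close>; a pair without it is bounded by
      \<open>M\<close>, a pair with it by \<open>2 * norm z\<close>, and \<open>X\<close> paired
      with itself gives 0.\<close>
    consider "a = 0" "c = 0" | "a = 0" "c \<noteq> 0" | "a \<noteq> 0" "c = 0" | "a \<noteq> 0" "c \<noteq> 0" by blast
    then have "\<bar>bilin_of w ((E(0 := X)) a) (\<i> *s (E(0 := X)) c)\<bar> \<le> M"
    proof cases
      case 1
      then show ?thesis using M0 by (simp add: bilin_i_smult_self[OF w])
    next
      case 2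
      then show ?thesis using XE[OF nE[OF ac(2)]] zM by simp
    next
      case 3
      have "\<bar>bilin_of w (E a) (\<i> *s X)\<bar> = \<bar>bilin_of w X (\<i> *s E a)\<bar>"
        using bilin_sym[OF w, of "E a" "\<i> *s X"] by (simp add: bilin_i_smult_left[OF w])
      then show ?thesis using XE[OF nE[OF ac(1)]] zM 3 by simp
    next
      case 4
      then show ?thesis using M[of "E a" "\<i> *s E c"] ac by (simp add: nE norm_i)
    qed
    then show "cmod (w (vec_pair ((E(0 := X)) a) ((E(0 := X)) c))) \<le> M"
      unfolding form_eq_bilin[OF w] by simp
  qed
  have "of_real ((colength (bilin_of w) (d_tau z))\<^sup>2 * volume_density w) = T std_frame"
    using star_flux[OF w pd linear_d_tau] by (simp add: T_def b_def A_def X_def)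
  then have "(colength (bilin_of w) (d_tau z))\<^sup>2 * volume_density w \<le> cmod (T std_frame)"
    by (metis norm_of_real abs_ge_self)
  also have "\<dots> = 2 * norm z * cmod (A (E(0 := X)))" unfolding eq TE by (simp add: norm_mult)
  also have "\<dots> \<le> 2 * norm z * (fact (2 * CARD('n)) * M ^ CARD('n))"
    by (intro mult_left_mono le) simp
  finally show ?thesis .
qed

section \<open>Integration over balls and spheres\<close>

text \<open>The unnormalised surface integral over the sphere of radius \<open>t\<close>, in the
  same ball encoding as \<open>sphere_surface_integral\<close>.\<close>

definition sphere_mean :: "real \<Rightarrow> ('a::euclidean_space \<Rightarrow> real) \<Rightarrow> real" where
  "sphere_mean t g = real DIM('a) * t ^ (DIM('a) - 1) * (LINT x:ball 0 1|lborel. g (t *\<^sub>R sgn x))"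

lemma set_integrable_ball_bounded:
  fixes f :: "'a::euclidean_space \<Rightarrow> real"
  assumes [measurable]: "f \<in> borel_measurable borel" and M: "\<And>x. x \<in> ball 0 t \<Longrightarrow> \<bar>f x\<bar> \<le> M"
  shows "set_integrable lborel (ball 0 t) f"
  unfolding set_integrable_def
proof (rule integrableI_bounded_set[where A="ball 0 t" and B=M])
  show "emeasure lborel (ball (0::'a) t) < \<infinity>"
    by (rule emeasure_bounded_finite) simp
  show "(\<lambda>x. indicator (ball 0 t) x *\<^sub>R f x) \<in> borel_measurable lborel"
    using assms(1) by (intro borel_measurable_scaleR borel_measurable_indicator) auto
qed (use M in auto)

lemma set_integrable_ball_continuous:
  fixes f :: "'a::euclidean_space \<Rightarrow> real"
  assumes "continuous_on UNIV f" shows "set_integrable lborel (ball 0 t) f"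
proof -
  have "compact (f ` cball 0 t)"
    using assms by (intro compact_continuous_image) (auto intro: continuous_on_subset)
  then obtain M where "\<forall>y\<in>f ` cball 0 t. \<bar>y\<bar> \<le> M"
    using compact_imp_bounded bounded_real by metis
  then show ?thesis
    using assms by (intro set_integrable_ball_bounded[where M=M] borel_measurable_continuous_onI) auto
qed

lemma measurable_sgn [measurable]: "(sgn :: 'a::euclidean_space \<Rightarrow> 'a) \<in> borel_measurable borel"
  unfolding sgn_div_norm by measurable

lemma set_integrable_sphere_bounded:
  fixes f :: "'a::euclidean_space \<Rightarrow> real"
  assumes [measurable]: "f \<in> borel_measurable borel" and M: "\<And>x. x \<in> cball 0 t \<Longrightarrow> \<bar>f x\<bar> \<le> M" and t: "0 \<le> t"
  shows "set_integrable lborel (ball 0 s) (\<lambda>x. f (t *\<^sub>R sgn x))"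
proof (rule set_integrable_ball_bounded[where M=M])
  show "\<bar>f (t *\<^sub>R sgn x)\<bar> \<le> M" for x using t by (intro M) (auto simp: norm_sgn)
qed measurable

lemma bounded_on_cball:
  fixes f :: "'a::euclidean_space \<Rightarrow> real"
  assumes "continuous_on UNIV f"
  obtains M where "\<And>x. x \<in> cball 0 t \<Longrightarrow> \<bar>f x\<bar> \<le> M"
proof -
  have "compact (f ` cball 0 t)"
    using assms by (intro compact_continuous_image) (auto intro: continuous_on_subset)
  then obtain M where "\<forall>y\<in>f ` cball 0 t. \<bar>y\<bar> \<le> M"
    using compact_imp_bounded bounded_real by metis
  with that show thesis by blast
qed

lemma set_integrable_sphere_continuous:
  fixes f :: "'a::euclidean_space \<Rightarrow> real"
  assumes f: "continuous_on UNIV f" and t: "0 \<le> t"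
  shows "set_integrable lborel (ball 0 s) (\<lambda>x. f (t *\<^sub>R sgn x))"
  using bounded_on_cball[OF f] f t
  by (metis set_integrable_sphere_bounded borel_measurable_continuous_onI)

lemma sphere_mean_mono:
  assumes "set_integrable lborel (ball 0 1) (\<lambda>x. f (t *\<^sub>R sgn x))"
    "set_integrable lborel (ball 0 1) (\<lambda>x. g (t *\<^sub>R sgn x))" "0 \<le> t" "\<And>x. f x \<le> g x"
  shows "sphere_mean t f \<le> sphere_mean t (g :: 'a::euclidean_space \<Rightarrow> real)"
  unfolding sphere_mean_def using assms by (intro mult_left_mono set_integral_mono) auto

lemma borel_measurable_indicator_ball:
  fixes f :: "'a::euclidean_space \<Rightarrow> real"
  assumes "f \<in> borel_measurable borel"
  shows "(\<lambda>x. indicator (ball 0 t) x * f x) \<in> borel_measurable borel"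
  by (intro borel_measurable_times borel_measurable_indicator borel_open open_ball assms)

lemma integral_ball_scale:
  fixes h :: "'a::euclidean_space \<Rightarrow> real"
  assumes [measurable]: "h \<in> borel_measurable borel" and t: "0 < t"
  shows "(LINT x:ball 0 t|lborel. h x) = t ^ DIM('a) * (LINT x:ball 0 1|lborel. h (t *\<^sub>R x))"
proof -
  have "(LINT x:ball 0 t|lborel. h x) = integral\<^sup>L (density (distr lborel borel (\<lambda>x. 0 + t *\<^sub>R x)) (\<lambda>_. \<bar>t\<bar> ^ DIM('a)))
      (\<lambda>x. indicator (ball 0 t) x *\<^sub>R h x)"
    unfolding set_lebesgue_integral_def using t by (subst lborel_affine[of t 0]) auto
  also have "\<dots> = t ^ DIM('a) * integral\<^sup>L (distr lborel borel (\<lambda>x. 0 + t *\<^sub>R x)) (\<lambda>x. indicator (ball 0 t) x *\<^sub>R h x)"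
  proof (subst integral_density)
    have "(\<lambda>x. indicator (ball 0 t) x * h x) \<in> borel_measurable borel"
      by (rule borel_measurable_indicator_ball[OF assms(1)])
    then show "(\<lambda>x. indicator (ball 0 t) x *\<^sub>R h x) \<in> borel_measurable (distr lborel borel (\<lambda>x. 0 + t *\<^sub>R x))"
      by (simp only: real_scaleR_def measurable_distr_eq1)
  qed (use t in auto)
  also have "integral\<^sup>L (distr lborel borel (\<lambda>x. 0 + t *\<^sub>R x)) (\<lambda>x. indicator (ball 0 t) x *\<^sub>R h x)
      = (LINT x|lborel. indicator (ball 0 t) (0 + t *\<^sub>R x) *\<^sub>R h (0 + t *\<^sub>R x))"
    using borel_measurable_indicator_ball[OF assms(1), of t] by (subst integral_distr) auto
  also have "\<dots> = (LINT x:ball 0 1|lborel. h (t *\<^sub>R x))"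
    unfolding set_lebesgue_integral_def using t
    by (intro Bochner_Integration.integral_cong) (auto split: split_indicator)
  finally show ?thesis .
qed

lemma integral_ball_sgn:
  fixes h :: "'a::euclidean_space \<Rightarrow> real"
  assumes [measurable]: "h \<in> borel_measurable borel" and s: "0 < s"
  shows "(LINT x:ball 0 s|lborel. h (t *\<^sub>R sgn x)) = s ^ DIM('a) * (LINT x:ball 0 1|lborel. h (t *\<^sub>R sgn x))"
proof -
  have "sgn (s *\<^sub>R x) = sgn x" for x :: 'a using s by (simp add: sgn_scaleR)
  then show ?thesis by (subst integral_ball_scale) (use s in auto)
qed

text \<open>Replace \<open>\<rho>\<close> by its values on the sphere of radius \<open>t\<close>,
  extended along rays: by homogeneity the integral over the ball of radius \<open>s\<close> is then
  exactly \<open>s ^ DIM('a) * c\<close>, with the desired derivative. The error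
  \<open>\<eta>\<close> is small near that sphere and contributes derivative 0.\<close>

lemma DERIV_integral_ball:
  fixes \<rho> :: "'a::euclidean_space \<Rightarrow> real"
  assumes \<rho>: "continuous_on UNIV \<rho>" and t: "0 < t"
  shows "((\<lambda>s. LINT x:ball 0 s|lborel. \<rho> x) has_real_derivative sphere_mean t \<rho>) (at t)"
proof -
  let ?n = "DIM('a)"
  have [measurable]: "\<rho> \<in> borel_measurable borel" using \<rho> by (rule borel_measurable_continuous_onI)
  define \<eta> where "\<eta> x = \<rho> x - \<rho> (t *\<^sub>R sgn x)" for x
  have [measurable]: "\<eta> \<in> borel_measurable borel" unfolding \<eta>_def by measurable
  define c where "c = (LINT x:ball 0 1|lborel. \<rho> (t *\<^sub>R sgn x))"
  define J where "J s = (LINT x:ball 0 s|lborel. \<eta> x)" for s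
  have int2: "set_integrable lborel (ball 0 s) (\<lambda>x. \<rho> (t *\<^sub>R sgn x))" for s
    using set_integrable_sphere_continuous[OF \<rho>] t by simp
  have int: "set_integrable lborel (ball 0 s) \<eta>" for s
    unfolding \<eta>_def by (intro set_integral_diff set_integrable_ball_continuous[OF \<rho>] int2)
  have I: "(LINT x:ball 0 s|lborel. \<rho> x) = J s + s ^ ?n * c" if "0 < s" for s
  proof -
    have "J s = (LINT x:ball 0 s|lborel. \<rho> x) - (LINT x:ball 0 s|lborel. \<rho> (t *\<^sub>R sgn x))"
      unfolding J_def \<eta>_def by (intro set_integral_diff set_integrable_ball_continuous[OF \<rho>] int2)
    then show ?thesis using integral_ball_sgn[of \<rho> s t] that by (simp add: c_def)
  qed
  define q where "q s = s ^ ?n * measure lborel (ball (0::'a) 1)" for s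
  \<comment> \<open>Increments of \<open>J\<close> are integrals over shells, and \<open>q\<close>
    measures the volume of a ball.\<close>
  have J_le: "\<bar>J b - J a\<bar> \<le> e * (q b - q a)"
    if ab: "0 \<le> a" "a \<le> b" and e: "\<And>x. a \<le> norm x \<Longrightarrow> norm x < b \<Longrightarrow> \<bar>\<eta> x\<bar> \<le> e" for a b e
  proof -
    let ?A = "ball 0 b - ball (0::'a) a"
    have iA: "set_integrable lborel ?A \<eta>" by (rule set_integrable_subset[OF int[of b]]) auto
    have "J b = (LINT x:ball 0 a \<union> ?A|lborel. \<eta> x)"
      unfolding J_def using ab by (intro arg_cong2[where f="set_lebesgue_integral lborel"]) auto
    also have "\<dots> = J a + (LINT x:?A|lborel. \<eta> x)"
      unfolding J_def by (rule set_integral_Un) (auto intro: int iA)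
    finally have "\<bar>J b - J a\<bar> = \<bar>LINT x:?A|lborel. \<eta> x\<bar>" by simp
    also have "\<dots> \<le> (LINT x:?A|lborel. \<bar>\<eta> x\<bar>)"
      using set_integral_norm_bound[OF iA] by simp
    also have "\<dots> \<le> (LINT x:?A|lborel. e)"
    proof (rule set_integral_mono)
      show "set_integrable lborel ?A (\<lambda>x. \<bar>\<eta> x\<bar>)" using set_integrable_norm[OF iA] by simp
      have "set_integrable lborel (ball (0::'a) b) (\<lambda>x. e)"
        by (rule set_integrable_ball_continuous) simp
      then show "set_integrable lborel ?A (\<lambda>x. e)" by (rule set_integrable_subset) auto
    qed (use e in auto)
    also have "\<dots> = e * measure lborel ?A"
    proof -
      have "emeasure lborel ?A < \<infinity>" by (rule emeasure_bounded_finite) auto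
      then show ?thesis by (simp add: set_lebesgue_integral_def)
    qed
    also have "measure lborel ?A = measure lborel (ball (0::'a) b) - measure lborel (ball (0::'a) a)"
      using ab by (intro measure_Diff) (auto simp: emeasure_ball)
    also have "\<dots> = q b - q a"
      unfolding q_def using ab by (subst (1 2) content_ball_conv_unit_ball) auto
    finally show ?thesis .
  qed
  have q: "(q has_real_derivative (?n * t ^ (?n - 1)) * measure lborel (ball (0::'a) 1)) (at t)"
    unfolding q_def by (auto intro!: derivative_eq_intros)
  have "(J has_real_derivative 0) (at t)"
  proof -
    define q' where "q' = (?n * t ^ (?n - 1)) * measure lborel (ball (0::'a) 1)"
    have lim: "((\<lambda>s. (q s - q t) / (s - t)) \<longlongrightarrow> q') (at t)"
      using q unfolding has_field_derivative_iff q'_def by simp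
    have "((\<lambda>s. \<bar>J s - J t\<bar> / \<bar>s - t\<bar>) \<longlongrightarrow> 0) (at t)"
    proof (rule tendstoI)
      fix e :: real assume e: "0 < e"
      \<comment> \<open>Bounds the difference quotients of \<open>q\<close> near \<open>t\<close>,
        so that an error of \<open>e / (2 * Q)\<close> per unit of shell volume is enough.\<close>
      define Q where "Q = \<bar>q'\<bar> + 1"
      have Q: "0 < Q" by (simp add: Q_def add_nonneg_pos)
      define e' where "e' = e / (2 * Q)"
      have e': "0 < e'" using e Q by (simp add: e'_def)
      have "uniformly_continuous_on (cball 0 (2 * t)) \<rho>"
        using \<rho> by (intro compact_uniformly_continuous) (auto intro: continuous_on_subset)
      then obtain d where d: "d > 0" "\<And>x y. x \<in> cball 0 (2 * t) \<Longrightarrow> y \<in> cball 0 (2 * t) \<Longrightarrow>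
          dist y x < d \<Longrightarrow> dist (\<rho> y) (\<rho> x) < e'"
        using e' unfolding uniformly_continuous_on_def by metis
      \<comment> \<open>The bound \<open>t / 2\<close> keeps points away from the origin and inside
        the ball of radius \<open>2 * t\<close>, where \<open>\<rho>\<close> is uniformly
        continuous.\<close>
      define r where "r = min d (t / 2)"
      have r: "0 < r" "r \<le> d" "r \<le> t / 2" using d t by (auto simp: r_def)
      have \<eta>: "\<bar>\<eta> x\<bar> \<le> e'" if x: "\<bar>norm x - t\<bar> < r" for x
      proof -
        have "norm x > 0" using x r t by linarith
        then have "x - t *\<^sub>R sgn x = (norm x - t) *\<^sub>R sgn x"
          by (simp add: sgn_div_norm algebra_simps)
        then have "dist x (t *\<^sub>R sgn x) = \<bar>norm x - t\<bar>"
          using \<open>norm x > 0\<close> by (simp add: dist_norm norm_sgn)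
        then have "dist (\<rho> x) (\<rho> (t *\<^sub>R sgn x)) < e'"
          using x r t by (intro d(2)) (auto simp: norm_sgn)
        then show ?thesis by (simp add: \<eta>_def dist_real_def)
      qed
      have Jq: "\<bar>J s - J t\<bar> \<le> e' * \<bar>q s - q t\<bar>" if s: "\<bar>s - t\<bar> < r" for s
      proof (cases "s \<le> t")
        case True
        have "\<bar>J t - J s\<bar> \<le> e' * (q t - q s)"
          using True s r t by (intro J_le \<eta>) auto
        also have "\<dots> \<le> e' * \<bar>q s - q t\<bar>" using e' by (intro mult_left_mono) auto
        finally show ?thesis by (simp add: abs_minus_commute)
      next
        case False
        have "\<bar>J s - J t\<bar> \<le> e' * (q s - q t)"
          using False s r t by (intro J_le \<eta>) auto
        also have "\<dots> \<le> e' * \<bar>q s - q t\<bar>" using e' by (intro mult_left_mono) auto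
        finally show ?thesis .
      qed
      have "\<forall>\<^sub>F s in at t. dist ((q s - q t) / (s - t)) q' < 1"
        using lim by (rule tendstoD) simp
      moreover have "\<forall>\<^sub>F s in at t. \<bar>s - t\<bar> < r"
        using r by (auto simp: eventually_at dist_real_def)
      ultimately show "\<forall>\<^sub>F s in at t. dist (\<bar>J s - J t\<bar> / \<bar>s - t\<bar>) 0 < e"
      proof eventually_elim
        case (elim s)
        have "\<bar>(q s - q t) / (s - t)\<bar> \<le> Q" using elim(1) unfolding Q_def dist_real_def by linarith
        then have "\<bar>q s - q t\<bar> / \<bar>s - t\<bar> \<le> Q" by (simp only: abs_divide)
        then have "e' * (\<bar>q s - q t\<bar> / \<bar>s - t\<bar>) \<le> e' * Q"
          using e' by (intro mult_left_mono) auto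
        moreover have "\<bar>J s - J t\<bar> / \<bar>s - t\<bar> \<le> e' * (\<bar>q s - q t\<bar> / \<bar>s - t\<bar>)"
          using divide_right_mono[OF Jq[OF elim(2)], of "\<bar>s - t\<bar>"] by simp
        moreover have "e' * Q = e / 2" using Q by (simp add: e'_def)
        ultimately have "\<bar>J s - J t\<bar> / \<bar>s - t\<bar> \<le> e / 2" by linarith
        then have "\<bar>J s - J t\<bar> / \<bar>s - t\<bar> < e" using e by linarith
        then show ?case by (simp add: dist_real_def)
      qed
    qed
    then have "((\<lambda>s. norm ((J s - J t) / (s - t))) \<longlongrightarrow> 0) (at t)" by (simp add: abs_divide)
    then have "((\<lambda>s. (J s - J t) / (s - t)) \<longlongrightarrow> 0) (at t)" by (rule tendsto_norm_zero_cancel)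
    then show ?thesis unfolding has_field_derivative_iff .
  qed
  then have "((\<lambda>s. J s + s ^ ?n * c) has_real_derivative 0 + ?n * t ^ (?n - 1) * c) (at t)"
    by (auto intro!: derivative_eq_intros)
  then have "((\<lambda>s. LINT x:ball 0 s|lborel. \<rho> x) has_real_derivative 0 + ?n * t ^ (?n - 1) * c) (at t)"
    by (rule has_field_derivative_transform_within_open[where S="{0<..}"]) (use t I in auto)
  then show ?thesis by (simp add: sphere_mean_def c_def)
qed

section \<open>The divergence theorem on balls\<close>

lemma sphere_mean_norm_mult:
  fixes D :: "'a::euclidean_space \<Rightarrow> real"
  assumes "0 < t"
  shows "sphere_mean t (\<lambda>x. (norm x)\<^sup>2 * D x) = t\<^sup>2 * sphere_mean t D"
proof -
  have "(LINT x:ball 0 1|lborel. (norm (t *\<^sub>R sgn x))\<^sup>2 * D (t *\<^sub>R sgn x)) =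
      (LINT x:ball (0::'a) 1|lborel. t\<^sup>2 * D (t *\<^sub>R sgn x))"
    unfolding set_lebesgue_integral_def
  \<comment> \<open>Since \<open>sgn 0 = 0\<close>, the point \<open>t *\<^sub>R sgn x\<close>
    leaves the sphere at the origin, which is a null set.\<close>
  proof (rule integral_discrete_difference[where X="{0}"])
    fix x :: 'a assume "x \<notin> {0}"
    then show "indicator (ball 0 1) x *\<^sub>R ((norm (t *\<^sub>R sgn x))\<^sup>2 * D (t *\<^sub>R sgn x)) =
        indicator (ball 0 1) x *\<^sub>R (t\<^sup>2 * D (t *\<^sub>R sgn x))"
      by (simp add: norm_sgn)
  qed auto
  then show ?thesis by (simp add: sphere_mean_def)
qed

text \<open>Translation invariance of Lebesgue measure annihilates the integral of the derivative of the compactly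
  supported function \<open>max 0 (R\<^sup>2 - |x|\<^sup>2) f\<close>.\<close>

lemma integral_ball_by_parts:
  fixes f D :: "'a::euclidean_space \<Rightarrow> real"
  assumes f: "continuous_on UNIV f" and D: "continuous_on UNIV D" and b: "b \<in> Basis" and R: "0 < R"
    and der: "\<And>x. ((\<lambda>h. f (x + h *\<^sub>R b)) has_real_derivative D x) (at 0)"
  shows "(LINT x:ball 0 R|lborel. (R\<^sup>2 - (norm x)\<^sup>2) * D x - 2 * (x \<bullet> b) * f x) = 0"
proof -
  define m where "m x = max 0 (R\<^sup>2 - (norm x)\<^sup>2)" for x :: 'a
  define u where "u x = m x * f x" for x
  have nb: "norm b = 1" using b by (rule norm_Basis)
  have cm: "continuous_on UNIV m" unfolding m_def by (intro continuous_intros)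
  have cu: "continuous_on UNIV u" unfolding u_def by (intro continuous_intros cm f)
  have [measurable]: "f \<in> borel_measurable borel" "D \<in> borel_measurable borel" "u \<in> borel_measurable borel"
    using f D cu by (auto intro: borel_measurable_continuous_onI)
  have u0: "u x = 0" if "R \<le> norm x" for x
    using power_mono[OF that, of 2] R by (simp add: u_def m_def max_def)
  have iu: "integrable lborel u"
  proof -
    have "set_integrable lborel (ball 0 R) u" by (rule set_integrable_ball_continuous[OF cu])
    moreover have "(\<lambda>x. indicator (ball 0 R) x *\<^sub>R u x) = u"
      using u0 by (auto simp: fun_eq_iff split: split_indicator)
    ultimately show ?thesis by (simp add: set_integrable_def)
  qed
  have shift: "integrable lborel (\<lambda>x. u (x + a))" "(LINT x|lborel. u (x + a)) = integral\<^sup>L lborel u" for a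
  proof -
    have "integrable (distr lborel borel ((+) a)) u" using iu by (simp add: lborel_distr_plus)
    then show "integrable lborel (\<lambda>x. u (x + a))"
      by (subst (asm) integrable_distr_eq) (auto simp: add.commute)
    have "integral\<^sup>L lborel u = integral\<^sup>L (distr lborel borel ((+) a)) u" by (simp add: lborel_distr_plus)
    also have "\<dots> = (LINT x|lborel. u (x + a))" by (subst integral_distr) (auto simp: add.commute)
    finally show "(LINT x|lborel. u (x + a)) = integral\<^sup>L lborel u" by simp
  qed
  define h where "h k = 1 / real (Suc k)" for k
  have h: "0 < h k" "h k \<le> 1" for k by (auto simp: h_def)
  define s where "s k x = (u (x + h k *\<^sub>R b) - u x) / h k" for k x
  define L where "L x = indicator (ball 0 R) x *\<^sub>R ((R\<^sup>2 - (norm x)\<^sup>2) * D x - 2 * (x \<bullet> b) * f x)" for x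
  obtain M where M: "\<And>x. x \<in> cball 0 (R + 2) \<Longrightarrow> \<bar>f x\<bar> \<le> M" using bounded_on_cball[OF f] by metis
  obtain M' where M': "\<And>x. x \<in> cball 0 (R + 2) \<Longrightarrow> \<bar>D x\<bar> \<le> M'" using bounded_on_cball[OF D] by metis
  have M0: "0 \<le> M" "0 \<le> M'" using M[of 0] M'[of 0] R by auto
  \<comment> \<open>A Lipschitz constant of \<open>u\<close> along \<open>b\<close>: the cut-off
    weight varies at rate at most \<open>2 * R + 4\<close> against the bound \<open>M\<close> of
    \<open>f\<close>, and \<open>f\<close> at rate \<open>M'\<close> against the bound
    \<open>R\<^sup>2\<close> of the weight. It dominates all difference quotients.\<close>
  define C where "C = (2 * R + 4) * M + R\<^sup>2 * M'"
  have derf: "((\<lambda>h. f (x + h *\<^sub>R b)) has_real_derivative D (x + y *\<^sub>R b)) (at y)" for x y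
  proof -
    have "((\<lambda>h. f ((x + y *\<^sub>R b) + (h - y) *\<^sub>R b)) has_real_derivative D (x + y *\<^sub>R b) * (1 - 0)) (at y)"
      by (rule DERIV_chain'[where f="\<lambda>h. h - y" and g="\<lambda>h. f ((x + y *\<^sub>R b) + h *\<^sub>R b)"])
        (use der in \<open>auto intro!: derivative_eq_intros\<close>)
    then show ?thesis by (simp add: algebra_simps)
  qed
  have bound: "\<bar>s k x\<bar> \<le> indicator (cball 0 (R + 1)) x * C" for k x
  proof (cases "norm x \<le> R + 1")
    case False
    have "norm x - norm (h k *\<^sub>R b) \<le> norm (x + h k *\<^sub>R b)"
      using norm_diff_ineq by blast
    then have "R \<le> norm (x + h k *\<^sub>R b)" using False h[of k] nb by simp
    then show ?thesis using False u0[of x] u0[of "x + h k *\<^sub>R b"] by (simp add: s_def)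
  next
    case True
    let ?y = "x + h k *\<^sub>R b"
    have ny: "norm ?y \<le> R + 2" using norm_triangle_ineq[of x "h k *\<^sub>R b"] True h[of k] nb by simp
    have "\<bar>m ?y - m x\<bar> \<le> \<bar>(norm ?y)\<^sup>2 - (norm x)\<^sup>2\<bar>" unfolding m_def by linarith
    also have "\<dots> = \<bar>norm ?y - norm x\<bar> * (norm ?y + norm x)"
      by (simp add: power2_eq_square square_diff_square_factored abs_mult mult.commute)
    also have "\<dots> \<le> h k * (2 * R + 4)"
      using norm_triangle_ineq3[of ?y x] nb h[of k] ny True R by (intro mult_mono) auto
    finally have 1: "\<bar>m ?y - m x\<bar> \<le> h k * (2 * R + 4)" .
    have "\<exists>z. 0 < z \<and> z < h k \<and> f (x + h k *\<^sub>R b) - f (x + 0 *\<^sub>R b) = (h k - 0) * D (x + z *\<^sub>R b)"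
      by (rule MVT2) (use h derf in auto)
    then obtain z where z: "0 < z" "z < h k" "f ?y - f x = h k * D (x + z *\<^sub>R b)" by auto
    have "norm (x + z *\<^sub>R b) \<le> R + 2"
      using norm_triangle_ineq[of x "z *\<^sub>R b"] True z h[of k] nb by simp
    then have 2: "\<bar>f ?y - f x\<bar> \<le> h k * M'"
      unfolding z(3) using M' h[of k] by (simp add: abs_mult)
    have 3: "0 \<le> m x" "m x \<le> R\<^sup>2" by (auto simp: m_def)
    have "\<bar>u ?y - u x\<bar> = \<bar>(m ?y - m x) * f ?y + m x * (f ?y - f x)\<bar>"
      by (simp add: u_def algebra_simps)
    also have "\<dots> \<le> \<bar>m ?y - m x\<bar> * \<bar>f ?y\<bar> + m x * \<bar>f ?y - f x\<bar>"
      using abs_triangle_ineq[of "(m ?y - m x) * f ?y" "m x * (f ?y - f x)"] 3 by (simp add: abs_mult)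
    also have "\<dots> \<le> (h k * (2 * R + 4)) * M + R\<^sup>2 * (h k * M')"
      using 1 2 3 M[of ?y] ny M0 R h[of k] by (intro add_mono mult_mono) auto
    also have "\<dots> = h k * C" by (simp add: C_def algebra_simps)
    finally have "\<bar>u ?y - u x\<bar> / h k \<le> C" using h[of k] by (simp add: field_simps)
    then show ?thesis using True h[of k] by (simp add: s_def abs_divide)
  qed
  \<comment> \<open>The weight has a corner on the sphere of radius \<open>R\<close>, where the
    quotients may fail to converge.\<close>
  have AE0: "AE x in lborel. x \<notin> sphere (0::'a) R"
  proof (rule AE_not_in)
    show "sphere (0::'a) R \<in> null_sets lborel"
      using negligible_sphere[of 0 R] by (auto simp: null_sets_completion_iff negligible_iff_null_sets)
  qed
  have hlim: "h \<longlonglongrightarrow> 0" unfolding h_def by (rule LIMSEQ_Suc[OF lim_1_over_n])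
  have lim: "(\<lambda>k. s k x) \<longlonglongrightarrow> L x" if x: "x \<notin> sphere 0 R" for x
  proof -
    have "((\<lambda>h. u (x + h *\<^sub>R b)) has_real_derivative L x) (at 0)"
    proof (cases "norm x < R")
      case True
      have "((\<lambda>h. (R\<^sup>2 - (x + h *\<^sub>R b) \<bullet> (x + h *\<^sub>R b)) * f (x + h *\<^sub>R b)) has_real_derivative
          (R\<^sup>2 - x \<bullet> x) * D x + - (2 * (x \<bullet> b)) * f x) (at 0)"
        using der[of x] by (auto intro!: derivative_eq_intros simp: inner_add_left inner_add_right inner_commute)
      then have *: "((\<lambda>h. (R\<^sup>2 - (x + h *\<^sub>R b) \<bullet> (x + h *\<^sub>R b)) * f (x + h *\<^sub>R b)) has_real_derivative L x) (at 0)"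
        using True by (simp add: L_def power2_norm_eq_inner algebra_simps)
      show ?thesis
      proof (rule has_field_derivative_transform_within_open[OF *, where S="(\<lambda>h. x + h *\<^sub>R b) -` ball 0 R"])
        show "open ((\<lambda>h. x + h *\<^sub>R b) -` ball 0 R)"
          by (intro open_vimage continuous_intros) auto
        fix h assume "h \<in> (\<lambda>h. x + h *\<^sub>R b) -` ball 0 R"
        then have "norm (x + h *\<^sub>R b) ^ 2 \<le> R ^ 2" by (intro power_mono) auto
        then show "(R\<^sup>2 - (x + h *\<^sub>R b) \<bullet> (x + h *\<^sub>R b)) * f (x + h *\<^sub>R b) = u (x + h *\<^sub>R b)"
          by (simp add: u_def m_def power2_norm_eq_inner)
      qed (use True in auto)
    next
      case False
      then have "norm x > R" using x by auto
      have "((\<lambda>h. 0) has_real_derivative 0) (at (0::real))" by simp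
      then have "((\<lambda>h. u (x + h *\<^sub>R b)) has_real_derivative 0) (at 0)"
      proof (rule has_field_derivative_transform_within_open[where S="(\<lambda>h. x + h *\<^sub>R b) -` (- cball 0 R)"])
        show "open ((\<lambda>h. x + h *\<^sub>R b) -` (- cball 0 R))"
          by (intro open_vimage continuous_intros) auto
      qed (use \<open>norm x > R\<close> u0 in auto)
      then show ?thesis using False by (simp add: L_def)
    qed
    then have "((\<lambda>h. (u (x + h *\<^sub>R b) - u x) / h) \<longlongrightarrow> L x) (at 0)"
      unfolding has_field_derivative_iff by simp
    then show ?thesis
      unfolding s_def by (rule filterlim_compose[of _ _ "at 0"]) (use h hlim in \<open>auto simp: filterlim_at intro!: always_eventually less_imp_neq[THEN not_sym]\<close>)
  qed
  have "(\<lambda>k. integral\<^sup>L lborel (s k)) \<longlonglongrightarrow> integral\<^sup>L lborel L"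
  proof (rule integral_dominated_convergence)
    show "AE x in lborel. (\<lambda>k. s k x) \<longlonglongrightarrow> L x" using AE0 by eventually_elim (rule lim)
    show "AE x in lborel. norm (s k x) \<le> indicator (cball 0 (R + 1)) x * C" for k using bound by simp
    have "integrable lborel (\<lambda>x. indicator (cball (0::'a) (R + 1)) x *\<^sub>R C)"
      by (rule borel_integrable_compact) auto
    then show "integrable lborel (\<lambda>x. indicator (cball (0::'a) (R + 1)) x * C)" by simp
    show "L \<in> borel_measurable lborel"
    proof -
      have "(\<lambda>x. (R\<^sup>2 - (norm x)\<^sup>2) * D x - 2 * (x \<bullet> b) * f x) \<in> borel_measurable borel" by measurable
      from borel_measurable_indicator_ball[OF this, of R] show ?thesis by (simp add: L_def[abs_def])
    qed
  qed (simp add: s_def[abs_def])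
  moreover have "integral\<^sup>L lborel (s k) = 0" for k
  proof -
    have "integral\<^sup>L lborel (s k) = ((LINT x|lborel. u (x + h k *\<^sub>R b)) - integral\<^sup>L lborel u) / h k"
      unfolding s_def[abs_def] using shift(1)[of "h k *\<^sub>R b"] iu by simp
    then show ?thesis by (simp only: shift(2)) simp
  qed
  ultimately have "integral\<^sup>L lborel L = 0" by (simp add: LIMSEQ_const_iff)
  then show ?thesis by (simp add: L_def[abs_def] set_lebesgue_integral_def)
qed

text \<open>Summing the weighted integration by parts over the basis gives
  \<open>r^2 \<integral>E - \<integral>|x|^2 E = \<integral>N\<close> for every radius
  \<open>r\<close>. Differentiation in \<open>r\<close> turns the right side into the surface
  integral of \<open>N\<close>.\<close>

theorem divergence_theorem_ball:
  fixes f D :: "'a \<Rightarrow> 'a::euclidean_space \<Rightarrow> real"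
  assumes f: "\<And>b. b \<in> Basis \<Longrightarrow> continuous_on UNIV (f b)" and D: "\<And>b. b \<in> Basis \<Longrightarrow> continuous_on UNIV (D b)"
    and der: "\<And>b x. b \<in> Basis \<Longrightarrow> ((\<lambda>h. f b (x + h *\<^sub>R b)) has_real_derivative D b x) (at 0)"
    and R: "0 < R"
  shows "2 * R * (LINT x:ball 0 R|lborel. \<Sum>b\<in>Basis. D b x) = sphere_mean R (\<lambda>x. \<Sum>b\<in>Basis. 2 * (x \<bullet> b) * f b x)"
proof -
  define E where "E x = (\<Sum>b\<in>Basis. D b x)" for x
  define N where "N x = (\<Sum>b\<in>Basis. 2 * (x \<bullet> b) * f b x)" for x
  have cE: "continuous_on UNIV E" unfolding E_def by (intro continuous_intros D)
  have cN: "continuous_on UNIV N" unfolding N_def by (intro continuous_intros f)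
  have cEn: "continuous_on UNIV (\<lambda>x. (norm x)\<^sup>2 * E x)" by (intro continuous_intros cE)
  note int = set_integrable_ball_continuous
  have eq: "r\<^sup>2 * (LINT x:ball 0 r|lborel. E x) - (LINT x:ball 0 r|lborel. (norm x)\<^sup>2 * E x) = (LINT x:ball 0 r|lborel. N x)"
    if r: "0 < r" for r
  proof -
    have "0 = (\<Sum>b\<in>Basis. LINT x:ball 0 r|lborel. (r\<^sup>2 - (norm x)\<^sup>2) * D b x - 2 * (x \<bullet> b) * f b x)"
      using integral_ball_by_parts[OF f D _ r der] by simp
    also have "\<dots> = (LINT x:ball 0 r|lborel. \<Sum>b\<in>Basis. (r\<^sup>2 - (norm x)\<^sup>2) * D b x - 2 * (x \<bullet> b) * f b x)"
    proof -
      have "set_integrable lborel (ball 0 r) (\<lambda>x. (r\<^sup>2 - (norm x)\<^sup>2) * D b x - 2 * (x \<bullet> b) * f b x)"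
        if "b \<in> Basis" for b
        using that by (intro int continuous_intros f D)
      then show ?thesis
        unfolding set_lebesgue_integral_def set_integrable_def scaleR_sum_right
        by (subst Bochner_Integration.integral_sum) auto
    qed
    also have "\<dots> = (LINT x:ball 0 r|lborel. (r\<^sup>2 * E x - (norm x)\<^sup>2 * E x) - N x)"
      by (simp add: E_def N_def sum_subtractf sum_distrib_left left_diff_distrib)
    also have "\<dots> = (LINT x:ball 0 r|lborel. r\<^sup>2 * E x - (norm x)\<^sup>2 * E x) - (LINT x:ball 0 r|lborel. N x)"
      by (intro set_integral_diff int continuous_intros cE cN)
    also have "(LINT x:ball 0 r|lborel. r\<^sup>2 * E x - (norm x)\<^sup>2 * E x) =
        (LINT x:ball 0 r|lborel. r\<^sup>2 * E x) - (LINT x:ball 0 r|lborel. (norm x)\<^sup>2 * E x)"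
      by (intro set_integral_diff int continuous_intros cE)
    finally show ?thesis by simp
  qed
  have "((\<lambda>r. r\<^sup>2 * (LINT x:ball 0 r|lborel. E x) - (LINT x:ball 0 r|lborel. (norm x)\<^sup>2 * E x)) has_real_derivative
      (2 * R * (LINT x:ball 0 R|lborel. E x) + R\<^sup>2 * sphere_mean R E) - sphere_mean R (\<lambda>x. (norm x)\<^sup>2 * E x)) (at R)"
  proof (rule DERIV_diff[OF _ DERIV_integral_ball[OF cEn R]])
    have "((\<lambda>r. r\<^sup>2) has_real_derivative 2 * R) (at R)" by (auto intro!: derivative_eq_intros)
    from DERIV_mult[OF this DERIV_integral_ball[OF cE R]]
    show "((\<lambda>r. r\<^sup>2 * (LINT x:ball 0 r|lborel. E x)) has_real_derivative
      2 * R * (LINT x:ball 0 R|lborel. E x) + R\<^sup>2 * sphere_mean R E) (at R)"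
      by (simp only: mult.commute[of "sphere_mean R E"])
  qed
  then have "((\<lambda>r. r\<^sup>2 * (LINT x:ball 0 r|lborel. E x) - (LINT x:ball 0 r|lborel. (norm x)\<^sup>2 * E x)) has_real_derivative
      2 * R * (LINT x:ball 0 R|lborel. E x)) (at R)"
    \<comment> \<open>On the sphere \<open>|x| = R\<close>, so both boundary terms cancel and only
      the derivative of the weight \<open>r\<^sup>2\<close> is left.\<close>
    unfolding sphere_mean_norm_mult[OF R] by (simp only: add_diff_cancel_right')
  then have "((\<lambda>r. LINT x:ball 0 r|lborel. N x) has_real_derivative 2 * R * (LINT x:ball 0 R|lborel. E x)) (at R)"
    by (rule has_field_derivative_transform_within_open[where S="{0<..}"]) (use eq R in auto)
  then have "2 * R * (LINT x:ball 0 R|lborel. E x) = sphere_mean R N"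
    using DERIV_integral_ball[OF cN R] DERIV_unique by blast
  then show ?thesis by (simp add: E_def[abs_def] N_def[abs_def])
qed

section \<open>Lifting through coverings\<close>

text \<open>The set of agreement is closed by the Hausdorff property and open because
  \<open>\<pi>\<close> is injective near each point.\<close>

lemma covering_lift_unique:
  fixes \<pi> :: "'y::t2_space \<Rightarrow> 'x::topological_space" and g1 g2 :: "'v::topological_space \<Rightarrow> 'y"
  assumes cov: "covering_space UNIV \<pi> UNIV" and T: "connected T" "a \<in> T" "x \<in> T"
    and g: "continuous_on T g1" "continuous_on T g2"
    and eq: "\<And>z. z \<in> T \<Longrightarrow> \<pi> (g1 z) = \<pi> (g2 z)" "g1 a = g2 a"
  shows "g1 x = g2 x"
proof -
  let ?E = "{z \<in> T. g1 z = g2 z}"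
  have "closedin (top_of_set T) ?E"
  proof -
    have "closed {p :: 'y \<times> 'y. fst p = snd p}" by (intro closed_Collect_eq continuous_intros)
    then have "closedin (top_of_set T) (T \<inter> (\<lambda>z. (g1 z, g2 z)) -` {p. fst p = snd p})"
      by (intro continuous_closedin_preimage continuous_intros g)
    moreover have "T \<inter> (\<lambda>z. (g1 z, g2 z)) -` {p. fst p = snd p} = ?E" by auto
    ultimately show ?thesis by simp
  qed
  moreover have "openin (top_of_set T) ?E"
  proof (subst openin_subopen, intro ballI)
    fix z assume z: "z \<in> ?E"
    obtain U V q where U: "g1 z \<in> U" "openin (top_of_set UNIV) U" "homeomorphism U V \<pi> q"
      by (rule covering_space_local_homeomorphism[OF cov UNIV_I, of "g1 z"])
    have inj: "inj_on \<pi> U" by (rule inj_on_inverseI[of U q]) (rule homeomorphism_apply1[OF U(3)])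
    let ?W = "(T \<inter> g1 -` U) \<inter> (T \<inter> g2 -` U)"
    have "openin (top_of_set T) ?W"
      using U(2) by (intro openin_Int continuous_openin_preimage_gen g) auto
    moreover have "z \<in> ?W" using z U by auto
    moreover have "?W \<subseteq> ?E" using inj eq by (auto simp: inj_on_def)
    ultimately show "\<exists>W. openin (top_of_set T) W \<and> z \<in> W \<and> W \<subseteq> ?E" by blast
  qed
  ultimately have "?E = {} \<or> ?E = T" using T(1) connected_clopen by blast
  then show ?thesis using T eq by blast
qed

text \<open>The radius \<open>d\<close> is a Lebesgue number for the cover of the compact ball by
  preimages of evenly covered sets; its uniformity lets finitely many extensions reach radius
  \<open>R\<close>.\<close>

lemma covering_local_lifts:
  fixes \<pi> :: "'y::topological_space \<Rightarrow> 'x::topological_space" and f :: "'v::euclidean_space \<Rightarrow> 'x"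
  assumes cov: "covering_space UNIV \<pi> UNIV" and f: "continuous_on UNIV f"
  obtains d where "d > 0" "\<And>x q y. \<lbrakk>x \<in> cball 0 R; q \<in> ball x d; \<pi> y = f q\<rbrakk> \<Longrightarrow>
      \<exists>l. continuous_on (ball x d) l \<and> (\<forall>z\<in>ball x d. \<pi> (l z) = f z) \<and> l q = y"
proof -
  define ev where "ev T \<longleftrightarrow> open T \<and> (\<exists>v. \<Union>v = \<pi> -` T \<and> (\<forall>u \<in> v. \<exists>q. homeomorphism u T \<pi> q))" for T
  have "\<exists>T. x \<in> T \<and> ev T" for x
    using cov unfolding covering_space_def ev_def by (simp add: openin_open_eq) (metis)
  then obtain T where T: "\<And>x. x \<in> T x \<and> ev (T x)" by metis
  have "\<exists>e>0. \<forall>x\<in>cball 0 R. \<exists>G\<in>range (\<lambda>x. f -` T x). ball x e \<subseteq> G"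
  proof (rule Heine_Borel_lemma)
    show "compact (cball (0::'v) R)" by simp
    show "cball 0 R \<subseteq> \<Union> (range (\<lambda>x. f -` T x))" using T by blast
    show "open G" if "G \<in> range (\<lambda>x. f -` T x)" for G
      using that T f unfolding ev_def by (auto intro: open_vimage)
  qed blast
  then obtain d where d: "d > 0" "\<And>x. x \<in> cball 0 R \<Longrightarrow> \<exists>t. ball x d \<subseteq> f -` T t" by blast
  show thesis
  proof (rule that[OF d(1)])
    fix x q y assume x: "x \<in> cball 0 R" "q \<in> ball x d" "\<pi> y = f q"
    from d(2)[OF x(1)] obtain t where t: "ball x d \<subseteq> f -` T t" by blast
    obtain v where v: "\<Union>v = \<pi> -` T t" "\<forall>u \<in> v. \<exists>q. homeomorphism u (T t) \<pi> q"
      using T[of t] unfolding ev_def by blast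
    have "y \<in> \<Union>v" using v x t by auto
    then obtain u s where u: "u \<in> v" "y \<in> u" "homeomorphism u (T t) \<pi> s" using v by blast
    have "continuous_on (ball x d) (s \<circ> f)"
      using u(3) t f
      by (intro continuous_on_compose) (auto simp: homeomorphism_def intro: continuous_on_subset)
    moreover have "\<pi> (s (f z)) = f z" if "z \<in> ball x d" for z
      using u(3) t that unfolding homeomorphism_def by blast
    moreover have "s (f q) = y"
      using u x unfolding homeomorphism_def by metis
    ultimately show "\<exists>l. continuous_on (ball x d) l \<and> (\<forall>z\<in>ball x d. \<pi> (l z) = f z) \<and> l q = y"
      by (intro exI[of _ "s \<circ> f"]) auto
  qed
qed

lemma continuous_on_local:
  fixes g :: "'a::t2_space \<Rightarrow> 'b::t2_space"
  assumes "\<And>x. x \<in> S \<Longrightarrow> \<exists>W. open W \<and> x \<in> W \<and> continuous_on W g"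
  shows "continuous_on S g"
  unfolding continuous_on_eq_continuous_within
proof (rule ballI)
  fix x assume "x \<in> S"
  from assms[OF this] show "continuous (at x within S) g"
    by (metis continuous_at_imp_continuous_at_within continuous_on_eq_continuous_at)
qed

text \<open>Local lifts around the points of the closed ball agree with \<open>g\<close> and with
  each other, by uniqueness on convex intersections. They are glued by using at \<open>z\<close> the
  lift around the point of the closed ball nearest to \<open>z\<close>.\<close>

lemma covering_lift_extend:
  fixes \<pi> :: "'y::t2_space \<Rightarrow> 'x::topological_space" and f :: "'v::euclidean_space \<Rightarrow> 'x"
  assumes cov: "covering_space UNIV \<pi> UNIV" and d: "d > 0" and r: "0 < r" "r \<le> R"
    and loc: "\<forall>x\<in>cball 0 R. \<forall>q\<in>ball x d. \<forall>y. \<pi> y = f q \<longrightarrow>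
      (\<exists>l. continuous_on (ball x d) l \<and> (\<forall>z\<in>ball x d. \<pi> (l z) = f z) \<and> l q = y)"
    and g: "continuous_on (ball 0 r) g" "\<forall>z\<in>ball 0 r. \<pi> (g z) = f z"
  shows "\<exists>g'. continuous_on (ball 0 (r + d)) g' \<and> (\<forall>z\<in>ball 0 (r + d). \<pi> (g' z) = f z) \<and> g' 0 = g 0"
proof -
  note unique = covering_lift_unique[OF cov convex_connected]
  \<comment> \<open>Two local lifts are compared at a point of the open ball where \<open>g\<close>
    is defined; such a point is found by moving \<open>x\<close> slightly towards the
    origin.\<close>
  have near: "\<exists>q. q \<in> ball 0 r \<and> q \<in> ball x d \<and> q \<in> ball x' d"
    if x: "x \<in> cball 0 r" "dist x x' < d" for x x' :: 'v
  proof -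
    \<comment> \<open>The second bound limits the displacement to half of the slack
      \<open>d - dist x x'\<close>.\<close>
    define \<eta> where "\<eta> = min (1 / 2) ((d - dist x x') / (2 * r))"
    have \<eta>: "0 < \<eta>" "\<eta> < 1" "\<eta> * r \<le> (d - dist x x') / 2"
    proof -
      show "0 < \<eta>" "\<eta> < 1" using x r by (auto simp: \<eta>_def)
      have "\<eta> * r \<le> (d - dist x x') / (2 * r) * r" using r by (intro mult_right_mono) (auto simp: \<eta>_def)
      then show "\<eta> * r \<le> (d - dist x x') / 2" using r by simp
    qed
    let ?q = "(1 - \<eta>) *\<^sub>R x"
    have nx: "norm x \<le> r" using x by simp
    have "norm ?q = (1 - \<eta>) * norm x" using \<eta> by simp
    also have "\<dots> \<le> (1 - \<eta>) * r" using \<eta> nx by (intro mult_left_mono) auto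
    also have "\<dots> < r" using \<eta> r by simp
    finally have 1: "norm ?q < r" .
    have "dist x ?q = norm (\<eta> *\<^sub>R x)" by (simp add: dist_norm algebra_simps)
    also have "\<dots> \<le> \<eta> * r" using \<eta> nx by (simp add: mult_left_mono)
    finally have 2: "dist x ?q \<le> (d - dist x x') / 2" using \<eta> by linarith
    have "dist x' ?q \<le> dist x x' + dist x ?q" by (metis dist_commute dist_triangle)
    moreover have "a < d" if "a \<le> c + b" "b \<le> (d - c) / 2" "c < d" for a b c :: real
      using that by (simp add: field_simps)
    ultimately have "dist x' ?q < d" using 2 x(2) by blast
    moreover have "b < d" if "b \<le> (d - c) / 2" "c < d" "0 \<le> c" for b c :: real
      using that d by (simp add: field_simps)
    then have "dist x ?q < d" using 2 x(2) zero_le_dist by blast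
    ultimately show ?thesis using 1 by (intro exI[of _ ?q]) simp
  qed
  have "\<exists>l. continuous_on (ball x d) l \<and> (\<forall>z\<in>ball x d. \<pi> (l z) = f z) \<and> (\<forall>z\<in>ball x d \<inter> ball 0 r. l z = g z)"
    if x: "x \<in> cball 0 r" for x
  proof -
    obtain q where q: "q \<in> ball 0 r" "q \<in> ball x d" using near[OF x, of x] d by auto
    then obtain l where l: "continuous_on (ball x d) l" "\<forall>z\<in>ball x d. \<pi> (l z) = f z" "l q = g q"
      using loc x r g(2) q(1) by (metis cball_subset_cball_iff mem_cball dist_self order_trans)
    have "l z = g z" if z: "z \<in> ball x d \<inter> ball 0 r" for z
    proof (rule unique[of "ball x d \<inter> ball 0 r" q])
      show "convex (ball x d \<inter> ball 0 r)" by (intro convex_Int) auto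
    qed (use z q l g in \<open>auto intro: continuous_on_subset\<close>)
    with l show ?thesis by blast
  qed
  then obtain l where l: "\<And>x. x \<in> cball 0 r \<Longrightarrow> continuous_on (ball x d) (l x)"
    "\<And>x z. x \<in> cball 0 r \<Longrightarrow> z \<in> ball x d \<Longrightarrow> \<pi> (l x z) = f z"
    "\<And>x z. x \<in> cball 0 r \<Longrightarrow> z \<in> ball x d \<Longrightarrow> z \<in> ball 0 r \<Longrightarrow> l x z = g z"
    by (metis IntI)
  have agree: "l x z = l x' z"
    if x: "x \<in> cball 0 r" "x' \<in> cball 0 r" "dist x x' < d" "z \<in> ball x d" "z \<in> ball x' d" for x x' z
  proof -
    obtain q where q: "q \<in> ball 0 r" "q \<in> ball x d" "q \<in> ball x' d" using near[OF x(1,3)] by blast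
    show ?thesis
    proof (rule unique[of "ball x d \<inter> ball x' d" q])
      show "convex (ball x d \<inter> ball x' d)" by (intro convex_Int) auto
      show "continuous_on (ball x d \<inter> ball x' d) (l x)" "continuous_on (ball x d \<inter> ball x' d) (l x')"
        using l(1) x by (auto intro: continuous_on_subset)
    qed (use x q l in auto)
  qed
  define c where "c = closest_point (cball (0::'v) r)"
  have c: "c z \<in> cball 0 r" for z
    unfolding c_def by (rule closest_point_in_set) (use r in auto)
  have cd: "dist (c z) z < d" if "z \<in> ball 0 (r + d)" for z
  proof (cases "z \<in> cball 0 r")
    case True
    then show ?thesis using d by (simp add: c_def closest_point_self)
  next
    case False
    then have z: "norm z > r" by simp
    have "dist z (c z) \<le> dist z ((r / norm z) *\<^sub>R z)"
      unfolding c_def by (rule closest_point_le) (use z r in auto)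
    also have "\<dots> = norm ((1 - r / norm z) *\<^sub>R z)" by (simp add: dist_norm algebra_simps)
    also have "\<dots> = norm z - r"
    proof -
      have "norm z > 0" using z r by linarith
      then have "r / norm z \<le> 1" using z by (simp add: divide_le_eq)
      then have "\<bar>1 - r / norm z\<bar> = 1 - r / norm z" by simp
      then show ?thesis using \<open>norm z > 0\<close> unfolding norm_scaleR by (simp add: left_diff_distrib)
    qed
    also have "\<dots> < d" using that by simp
    finally show ?thesis by (simp add: dist_commute)
  qed
  have cc: "continuous_on UNIV c"
    unfolding c_def by (rule continuous_on_closest_point) (use r in auto)
  define g' where "g' z = l (c z) z" for z
  show ?thesis
  proof (intro exI[of _ g'] conjI ballI)
    show "\<pi> (g' z) = f z" if "z \<in> ball 0 (r + d)" for z
      unfolding g'_def using l(2)[OF c] cd[OF that] by simp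
    have "c 0 = 0" unfolding c_def by (rule closest_point_self) (use r in simp)
    then show "g' 0 = g 0" using l(3)[of 0 0] r d by (simp add: g'_def)
    show "continuous_on (ball 0 (r + d)) g'"
    proof (rule continuous_on_local)
      fix z0 assume z0: "z0 \<in> ball (0::'v) (r + d)"
      \<comment> \<open>Where \<open>c z\<close> stays within \<open>d\<close> of
        \<open>c z0\<close>, \<open>agree\<close> replaces the varying local lift by the fixed one
        around \<open>c z0\<close>.\<close>
      let ?W = "ball 0 (r + d) \<inter> ball (c z0) d \<inter> c -` ball (c z0) d"
      have "open ?W" using cc by (intro open_Int open_vimage) auto
      have "z0 \<in> ?W" using z0 cd[OF z0] d by auto
      have "g' z = l (c z0) z" if "z \<in> ?W" for z
        unfolding g'_def using that cd[of z] c by (intro agree) (auto simp: dist_commute)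
      then have "continuous_on ?W g' \<longleftrightarrow> continuous_on ?W (l (c z0))"
        by (rule continuous_on_cong[OF refl])
      moreover have "continuous_on ?W (l (c z0))"
        using l(1)[OF c[of z0]] by (rule continuous_on_subset) auto
      ultimately have "continuous_on ?W g'" by blast
      with \<open>open ?W\<close> \<open>z0 \<in> ?W\<close> show "\<exists>W. open W \<and> z0 \<in> W \<and> continuous_on W g'" by blast
    qed
  qed
qed

text \<open>For each \<open>R\<close> the radius grows in steps of \<open>d\<close>. Lifts over
  balls of integer radius share the value \<open>y0\<close> at 0, so they are compatible and define
  a global lift.\<close>

lemma covering_lift:
  fixes \<pi> :: "'y::t2_space \<Rightarrow> 'x::topological_space" and f :: "'v::euclidean_space \<Rightarrow> 'x"
  assumes cov: "covering_space UNIV \<pi> UNIV" and f: "continuous_on UNIV f"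
  obtains g where "continuous_on UNIV g" "\<And>z. \<pi> (g z) = f z"
proof -
  have "f 0 \<in> range \<pi>" using covering_space_imp_surjective[OF cov] by simp
  then obtain y0 where y0: "\<pi> y0 = f 0" by auto
  define lift where "lift r g \<longleftrightarrow> continuous_on (ball 0 r) g \<and> (\<forall>z\<in>ball 0 r. \<pi> (g z) = f z) \<and> g 0 = y0" for r g
  have sub: "lift r' g" if "lift r g" "r' \<le> r" for r r' g
    using that unfolding lift_def by (auto intro: continuous_on_subset[OF _ subset_ball])
  have "\<exists>g. lift R g" if R: "R > 0" for R
  proof -
    obtain d where d: "d > 0" "\<And>x q y. \<lbrakk>x \<in> cball 0 R; q \<in> ball x d; \<pi> y = f q\<rbrakk> \<Longrightarrow>
      \<exists>l. continuous_on (ball x d) l \<and> (\<forall>z\<in>ball x d. \<pi> (l z) = f z) \<and> l q = y"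
      using covering_local_lifts[OF cov f] by metis
    have "\<exists>g. lift (min R (real (Suc k) * d)) g" for k
    proof (induction k)
      case 0
      have "\<exists>g. lift d g" unfolding lift_def using d(2)[of 0 0 y0] y0 d(1) R by auto
      then show ?case using sub by (metis One_nat_def min.cobounded2 mult_1 of_nat_1)
    next
      case (Suc k)
      then obtain g where g: "lift (min R (real (Suc k) * d)) g" by blast
      have r: "0 < min R (real (Suc k) * d)" "min R (real (Suc k) * d) \<le> R" using R d by auto
      have g1: "continuous_on (ball 0 (min R (real (Suc k) * d))) g"
        "\<forall>z\<in>ball 0 (min R (real (Suc k) * d)). \<pi> (g z) = f z" "g 0 = y0"
        using g unfolding lift_def by blast+
      obtain g' where "lift (min R (real (Suc k) * d) + d) g'"
        using covering_lift_extend[OF cov d(1) r _ g1(1,2)] d(2) g1(3) unfolding lift_def by metis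
      moreover have "min R (real (Suc (Suc k)) * d) \<le> min R (real (Suc k) * d) + d"
        using d by (auto simp: min_def algebra_simps)
      ultimately show ?case using sub by blast
    qed
    moreover obtain k where "R / d < real k" using reals_Archimedean2 by blast
    then have "R \<le> real (Suc k) * d" using d by (simp add: field_simps)
    then have "min R (real (Suc k) * d) = R" by simp
    ultimately show ?thesis by metis
  qed
  then have "\<exists>g. lift (real (Suc n)) g" for n by simp
  then obtain G where G: "\<And>n. lift (real (Suc n)) (G n)" by metis
  have GG: "G m z = G n z" if mn: "m \<le> n" "z \<in> ball 0 (real (Suc m))" for m n z
  proof (rule covering_lift_unique[OF cov, of "ball 0 (real (Suc m))" 0])
    have Gn: "lift (real (Suc m)) (G n)" using sub[OF G[of n]] mn by simp
    show "continuous_on (ball 0 (real (Suc m))) (G m)" "continuous_on (ball 0 (real (Suc m))) (G n)"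
      "\<And>z. z \<in> ball 0 (real (Suc m)) \<Longrightarrow> \<pi> (G m z) = \<pi> (G n z)" "G m 0 = G n 0"
      using G[of m] Gn unfolding lift_def by auto
  qed (use mn in auto)
  define N where "N z = nat \<lceil>norm z\<rceil>" for z :: 'v
  have N: "z \<in> ball 0 (real (Suc (N z)))" for z
    unfolding N_def by simp linarith
  define g where "g z = G (N z) z" for z
  have gG: "g z = G n z" if z: "z \<in> ball 0 (real (Suc n))" for n z
  proof (cases "N z \<le> n")
    case True
    then show ?thesis unfolding g_def by (rule GG[OF _ N])
  next
    case False
    then have "n \<le> N z" by simp
    then show ?thesis unfolding g_def by (rule GG[OF _ z, symmetric])
  qed
  show thesis
  proof (rule that)
    show "\<pi> (g z) = f z" for z
      unfolding g_def using G[of "N z"] N[of z] unfolding lift_def by blast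
    show "continuous_on UNIV g"
    proof (rule continuous_on_local)
      fix z :: 'v
      have "continuous_on (ball 0 (real (Suc (N z)))) g \<longleftrightarrow> continuous_on (ball 0 (real (Suc (N z)))) (G (N z))"
        by (rule continuous_on_cong[OF refl]) (rule gG)
      then have "continuous_on (ball 0 (real (Suc (N z)))) g"
        using G[of "N z"] unfolding lift_def by blast
      then show "\<exists>W. open W \<and> z \<in> W \<and> continuous_on W g" using N[of z] by blast
    qed
  qed
qed

section \<open>Holomorphic functions of several variables\<close>

text \<open>Complex differentiability phrased through the real derivative, since that is what the
  calculus of forms uses.\<close>

definition holomorphic_fun_on :: "(complex ^ 'm::finite \<Rightarrow> complex) \<Rightarrow> (complex ^ 'm) set \<Rightarrow> bool" where
  "holomorphic_fun_on f S \<longleftrightarrow>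
     (\<forall>y\<in>S. f differentiable (at y) \<and> (\<forall>u. frechet_derivative f (at y) (\<i> *s u) = \<i> * frechet_derivative f (at y) u))"

lemma holomorphic_fun_has_derivative:
  "holomorphic_fun_on f S \<Longrightarrow> y \<in> S \<Longrightarrow> (f has_derivative frechet_derivative f (at y)) (at y)"
  by (simp add: holomorphic_fun_on_def frechet_derivative_works[symmetric])

lemma complex_smult_eq: "c *s u = Re c *\<^sub>R u + Im c *\<^sub>R (\<i> *s (u :: complex ^ 'm))"
  by (simp add: vec_eq_iff complex_eq_iff)

lemma holomorphic_fun_derivative_smult:
  assumes f: "holomorphic_fun_on f S" "y \<in> S"
  shows "frechet_derivative f (at y) (c *s u) = c * frechet_derivative f (at y) u"
proof -
  let ?L = "frechet_derivative f (at y)"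
  have lin: "linear ?L" using has_derivative_linear[OF holomorphic_fun_has_derivative[OF f]] .
  have "?L (c *s u) = Re c *\<^sub>R ?L u + Im c *\<^sub>R ?L (\<i> *s u)"
    by (subst complex_smult_eq) (simp add: linear_add[OF lin] linear_scale[OF lin])
  also have "\<dots> = c * ?L u"
    using f by (simp add: holomorphic_fun_on_def scaleR_conv_of_real complex_eq_iff algebra_simps)
  finally show ?thesis .
qed

section \<open>Cauchy's integral formula along complex lines\<close>

definition circ :: "real \<Rightarrow> real \<Rightarrow> complex" where
  "circ r t = of_real r * exp (2 * of_real pi * \<i> * of_real t)"

lemma norm_circ: "r \<ge> 0 \<Longrightarrow> cmod (circ r t) = r"
  by (simp add: circ_def norm_mult)

lemma continuous_circ: "continuous_on A (\<lambda>x. circ r (h x))" if "continuous_on A h"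
  unfolding circ_def using that by (intro continuous_intros)

text \<open>Cauchy's integral of \<open>f (z + \<zeta> u) / \<zeta>^2\<close> over the circle of
  radius \<open>r\<close>, divided by \<open>2 \<pi> \<i>\<close>: one power of
  \<open>\<zeta>\<close> cancels against the velocity of the parametrisation.\<close>

definition circle_mean :: "real \<Rightarrow> (complex ^ 'm::finite \<Rightarrow> complex) \<Rightarrow> complex ^ 'm \<Rightarrow> complex ^ 'm \<Rightarrow> complex" where
  "circle_mean r f z u = integral (cbox 0 1) (\<lambda>t. f (z + circ r t *s u) / circ r t)"

lemma holomorphic_fun_slice:
  assumes f: "holomorphic_fun_on f S" and z: "z + \<zeta> *s u \<in> S"
  shows "((\<lambda>\<zeta>. f (z + \<zeta> *s u)) has_field_derivative frechet_derivative f (at (z + \<zeta> *s u)) u) (at \<zeta>)"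
proof -
  have "((\<lambda>\<zeta>. z + \<zeta> *s u) has_derivative (\<lambda>h. h *s u)) (at \<zeta>)"
  proof -
    have "bounded_linear (\<lambda>h. h *s u)"
      unfolding linear_conv_bounded_linear[symmetric]
      by (simp add: linear_iff vec_eq_iff algebra_simps)
    then have "((\<lambda>\<zeta>. \<zeta> *s u) has_derivative (\<lambda>h. h *s u)) (at \<zeta>)"
      by (rule bounded_linear_imp_has_derivative)
    then show ?thesis by (auto intro!: derivative_eq_intros)
  qed
  from has_derivative_compose[OF this holomorphic_fun_has_derivative[OF f z]]
  have "((\<lambda>\<zeta>. f (z + \<zeta> *s u)) has_derivative (\<lambda>h. frechet_derivative f (at (z + \<zeta> *s u)) (h *s u))) (at \<zeta>)" .
  then show ?thesis
    unfolding has_field_derivative_def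
    by (simp only: holomorphic_fun_derivative_smult[OF f z] mult.commute[of _ "frechet_derivative f (at (z + \<zeta> *s u)) u"])
qed

text \<open>The directional derivative becomes an integral of \<open>f\<close> alone, so regularity
  of the derivative follows although only differentiability of \<open>f\<close> is assumed.\<close>

lemma holomorphic_fun_derivative_eq:
  assumes f: "holomorphic_fun_on f S" and r: "0 < r" and sub: "\<And>\<zeta>. cmod \<zeta> \<le> r \<Longrightarrow> z + \<zeta> *s u \<in> S"
  shows "frechet_derivative f (at z) u = circle_mean r f z u"
proof -
  let ?F = "\<lambda>\<zeta>. f (z + \<zeta> *s u)"
  have der: "(?F has_field_derivative frechet_derivative f (at (z + \<zeta> *s u)) u) (at \<zeta>)" if "cmod \<zeta> \<le> r" for \<zeta>
    by (rule holomorphic_fun_slice[OF f sub[OF that]])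
  have "continuous_on (cball 0 r) ?F"
    by (intro continuous_at_imp_continuous_on ballI DERIV_isCont[OF der]) (simp add: dist_norm)
  moreover have "?F holomorphic_on ball 0 r"
    unfolding holomorphic_on_open[OF open_ball] by (intro ballI exI, rule der) (simp add: dist_norm)
  ultimately have "contour_integral (circlepath 0 r) (\<lambda>\<zeta>. ?F \<zeta> / (\<zeta> - 0)\<^sup>2) = 2 * pi * \<i> * deriv ?F 0"
    using r by (intro Cauchy_contour_integral_circlepath_2) auto
  moreover have "deriv ?F 0 = frechet_derivative f (at z) u"
    using DERIV_imp_deriv[OF der[of 0]] r by simp
  moreover have "contour_integral (circlepath 0 r) (\<lambda>\<zeta>. ?F \<zeta> / (\<zeta> - 0)\<^sup>2) = 2 * pi * \<i> * circle_mean r f z u"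
  proof -
    have "contour_integral (circlepath 0 r) (\<lambda>\<zeta>. ?F \<zeta> / (\<zeta> - 0)\<^sup>2)
        = integral {0..1} (\<lambda>t. ?F (circ r t) / (circ r t)\<^sup>2 * (2 * pi * \<i> * circ r t))"
    proof -
      have "circlepath 0 r t = circ r t" for t by (simp add: circlepath circ_def)
      moreover have "vector_derivative (circlepath 0 r) (at t) = 2 * pi * \<i> * circ r t" for t
        using vector_derivative_at[OF has_vector_derivative_circlepath[of 0 r t UNIV]]
        by (simp add: circ_def mult.assoc)
      ultimately show ?thesis unfolding contour_integral_integral by simp
    qed
    also have "\<dots> = integral {0..1} (\<lambda>t. (2 * pi * \<i>) * (?F (circ r t) / circ r t))"
      using r by (intro integral_cong) (simp add: circ_def power2_eq_square divide_simps)
    also have "\<dots> = 2 * pi * \<i> * circle_mean r f z u"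
      unfolding circle_mean_def cbox_interval by (rule integral_mult_right)
    finally show ?thesis .
  qed
  ultimately show ?thesis by simp
qed

lemma norm_smult_vec: "norm (c *s u) = cmod c * norm (u :: complex ^ 'm::finite)"
  by (simp add: norm_vec_def L2_set_def norm_mult power_mult_distrib sum_distrib_left[symmetric] real_sqrt_mult)

text \<open>One circle radius serves all centres near \<open>z0\<close>, as differentiation under
  the integral sign requires.\<close>

lemma circle_neighbourhood:
  fixes z0 u :: "complex ^ 'm::finite"
  assumes "open S" "z0 \<in> S"
  obtains e r where "0 < e" "0 < r" "ball z0 e \<subseteq> S" "\<And>z \<zeta>. z \<in> ball z0 e \<Longrightarrow> cmod \<zeta> \<le> r \<Longrightarrow> z + \<zeta> *s u \<in> S"
proof -
  obtain e where e: "0 < e" "ball z0 e \<subseteq> S" using assms openE by blast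
  define r where "r = e / 2 / (norm u + 1)"
  have r: "0 < r" "r * norm u < e / 2"
    using e(1) by (auto simp: r_def divide_simps add_nonneg_pos add_nonneg_eq_0_iff)
  show thesis
  proof (rule that[of "e / 2" r])
    show "ball z0 (e / 2) \<subseteq> S" using e by (auto simp: subset_iff)
    fix z \<zeta> assume z: "z \<in> ball z0 (e / 2)" "cmod \<zeta> \<le> r"
    have "norm (\<zeta> *s u) \<le> r * norm u" using z by (simp add: norm_smult_vec mult_right_mono)
    then have "dist z0 (z + \<zeta> *s u) < e"
      using z r(2) norm_triangle_ineq[of "z - z0" "\<zeta> *s u"] by (simp add: dist_norm norm_minus_commute algebra_simps)
    then show "z + \<zeta> *s u \<in> S" using e by auto
  qed (use e r in auto)
qed

lemma holomorphic_fun_continuous: "holomorphic_fun_on f S \<Longrightarrow> continuous_on S f"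
  by (meson continuous_at_imp_continuous_on has_derivative_continuous holomorphic_fun_has_derivative)

lemma continuous_on_smult_vec:
  "continuous_on A c \<Longrightarrow> continuous_on A (\<lambda>x. c x *s (u :: complex ^ 'm::finite))"
  unfolding vector_scalar_mult_def by (intro continuous_intros)

lemma continuous_on_slice:
  assumes f: "continuous_on S f" and r: "0 < r"
    and sub: "\<And>z \<zeta>. z \<in> B \<Longrightarrow> cmod \<zeta> \<le> r \<Longrightarrow> z + \<zeta> *s u \<in> S"
  shows "continuous_on (B \<times> cbox 0 1) (\<lambda>(z, t). f (z + circ r t *s u) / circ r t)"
  unfolding split_beta
proof (intro continuous_intros continuous_circ continuous_on_compose2[OF f] continuous_on_smult_vec)
  show "(\<lambda>x. fst x + circ r (snd x) *s u) ` (B \<times> cbox 0 1) \<subseteq> S"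
    using r by (auto simp: norm_circ intro!: sub)
  show "\<forall>x\<in>B \<times> cbox 0 1. circ r (snd x) \<noteq> 0" using r by (simp add: circ_def)
qed

lemma holomorphic_fun_derivative_continuous:
  assumes f: "holomorphic_fun_on f S" and S: "open S"
  shows "continuous_on S (\<lambda>z. frechet_derivative f (at z) u)"
proof (rule continuous_on_local)
  fix z0 assume "z0 \<in> S"
  then obtain e r where e: "0 < e" "0 < r" "\<And>z \<zeta>. z \<in> ball z0 e \<Longrightarrow> cmod \<zeta> \<le> r \<Longrightarrow> z + \<zeta> *s u \<in> S"
    using circle_neighbourhood[OF S] by metis
  have "continuous_on (ball z0 e) (\<lambda>z. circle_mean r f z u)"
    unfolding circle_mean_def
    by (rule integral_continuous_on_param) (rule continuous_on_slice[OF holomorphic_fun_continuous[OF f] e(2,3)])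
  moreover have "frechet_derivative f (at z) u = circle_mean r f z u" if "z \<in> ball z0 e" for z
    by (rule holomorphic_fun_derivative_eq[OF f e(2) e(3)[OF that]])
  then have "continuous_on (ball z0 e) (\<lambda>z. frechet_derivative f (at z) u) \<longleftrightarrow> continuous_on (ball z0 e) (\<lambda>z. circle_mean r f z u)"
    by (rule continuous_on_cong[OF refl])
  ultimately show "\<exists>W. open W \<and> z0 \<in> W \<and> continuous_on W (\<lambda>z. frechet_derivative f (at z) u)"
    using e(1) by (intro exI[of _ "ball z0 e"]) auto
qed

text \<open>Differentiation of Cauchy's integral formula under the integral sign.\<close>

lemma holomorphic_fun_second_derivative:
  assumes f: "holomorphic_fun_on f S" and S: "open S" and z0: "z0 \<in> S"
    and e: "0 < e" "0 < r" "ball z0 e \<subseteq> S" "\<And>z \<zeta>. z \<in> ball z0 e \<Longrightarrow> cmod \<zeta> \<le> r \<Longrightarrow> z + \<zeta> *s u \<in> S"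
  shows "((\<lambda>z. frechet_derivative f (at z) u) has_derivative
     (\<lambda>v. circle_mean r (\<lambda>z. frechet_derivative f (at z) v) z0 u)) (at z0)"
proof -
  let ?D = "\<lambda>y. frechet_derivative f (at y)"
  define fx where "fx z t = Blinfun (\<lambda>v. ?D (z + circ r t *s u) v / circ r t)" for z t
  have cS: "z + circ r t *s u \<in> S" if "z \<in> ball z0 e" for z t
    using e that by (simp add: norm_circ)
  have bl: "bounded_linear (?D (z + circ r t *s u))" if "z \<in> ball z0 e" for z t
    using has_derivative_bounded_linear[OF holomorphic_fun_has_derivative[OF f cS[OF that]]] .
  have fx: "blinfun_apply (fx z t) = (\<lambda>v. ?D (z + circ r t *s u) v / circ r t)" if "z \<in> ball z0 e" for z t
    unfolding fx_def using bl[OF that]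
    by (intro bounded_linear_Blinfun_apply bounded_linear_compose[OF bounded_linear_divide, of _ "circ r t", unfolded o_def])
  have "((\<lambda>z. integral (cbox 0 1) (\<lambda>t. f (z + circ r t *s u) / circ r t)) has_derivative
      blinfun_apply (integral (cbox 0 1) (fx z0))) (at z0 within ball z0 e)"
  proof (rule leibniz_rule)
    fix z and t :: real assume z: "z \<in> ball z0 e" "t \<in> cbox 0 1"
    have "((\<lambda>z. f (z + circ r t *s u)) has_derivative ?D (z + circ r t *s u)) (at z)"
      by (rule has_derivative_compose[of "\<lambda>z. z + circ r t *s u" "\<lambda>v. v", OF _ holomorphic_fun_has_derivative[OF f cS[OF z(1)]]])
        (auto intro!: derivative_eq_intros)
    then have "((\<lambda>z. f (z + circ r t *s u) / circ r t) has_derivative (\<lambda>v. ?D (z + circ r t *s u) v / circ r t)) (at z)"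
      using e(2) by (auto intro!: derivative_eq_intros simp: circ_def)
    then show "((\<lambda>z. f (z + circ r t *s u) / circ r t) has_derivative blinfun_apply (fx z t)) (at z within ball z0 e)"
      unfolding fx[OF z(1)] by (rule has_derivative_at_withinI)
  next
    fix z assume z: "z \<in> ball z0 e"
    have "continuous_on (ball z0 e \<times> cbox 0 1) (\<lambda>(z, t). f (z + circ r t *s u) / circ r t)"
      by (rule continuous_on_slice[OF holomorphic_fun_continuous[OF f] e(2,4)])
    from continuous_on_compose2[OF this, where s="cbox 0 1" and f="\<lambda>t. (z, t)"] z
    have "continuous_on (cbox 0 1) (\<lambda>t. f (z + circ r t *s u) / circ r t)"
      by (simp add: continuous_on_Pair image_subset_iff)
    then show "(\<lambda>t. f (z + circ r t *s u) / circ r t) integrable_on cbox 0 1" by (rule integrable_continuous)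
  next
    show "continuous_on (ball z0 e \<times> cbox 0 1) (\<lambda>(z, t). fx z t)"
    proof (rule continuous_on_blinfun_componentwise)
      fix v :: "complex ^ 'a"
      have "continuous_on (ball z0 e \<times> cbox 0 1) (\<lambda>(z, t). ?D (z + circ r t *s u) v / circ r t)"
        by (rule continuous_on_slice[OF holomorphic_fun_derivative_continuous[OF f S] e(2,4)])
      moreover have "continuous_on (ball z0 e \<times> cbox 0 1) (\<lambda>x. blinfun_apply (case x of (z, t) \<Rightarrow> fx z t) v)
          \<longleftrightarrow> continuous_on (ball z0 e \<times> cbox 0 1) (\<lambda>(z, t). ?D (z + circ r t *s u) v / circ r t)"
        by (rule continuous_on_cong[OF refl]) (auto simp: fx)
      ultimately show "continuous_on (ball z0 e \<times> cbox 0 1) (\<lambda>x. blinfun_apply (case x of (z, t) \<Rightarrow> fx z t) v)" by blast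
    qed
  qed (use e in auto)
  then have "((\<lambda>z. circle_mean r f z u) has_derivative blinfun_apply (integral (cbox 0 1) (fx z0))) (at z0)"
    unfolding circle_mean_def using e(1) by (subst (asm) at_within_open) auto
  moreover have "blinfun_apply (integral (cbox 0 1) (fx z0)) = (\<lambda>v. circle_mean r (\<lambda>z. ?D z v) z0 u)"
  proof (rule ext)
    fix v
    have "continuous_on (cbox 0 1) (fx z0)"
    proof (rule continuous_on_blinfun_componentwise)
      fix v :: "complex ^ 'a"
      have "continuous_on (ball z0 e \<times> cbox 0 1) (\<lambda>(z, t). ?D (z + circ r t *s u) v / circ r t)"
        by (rule continuous_on_slice[OF holomorphic_fun_derivative_continuous[OF f S] e(2,4)])
      from continuous_on_compose2[OF this, where s="cbox 0 1" and f="\<lambda>t. (z0, t)"] e(1)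
      have "continuous_on (cbox 0 1) (\<lambda>t. ?D (z0 + circ r t *s u) v / circ r t)"
        by (simp add: continuous_on_Pair image_subset_iff)
      then show "continuous_on (cbox 0 1) (\<lambda>t. blinfun_apply (fx z0 t) v)" using e(1) by (simp add: fx)
    qed
    then have "fx z0 integrable_on cbox 0 1" by (rule integrable_continuous)
    then show "blinfun_apply (integral (cbox 0 1) (fx z0)) v = circle_mean r (\<lambda>z. ?D z v) z0 u"
      using e(1) by (simp add: blinfun_apply_integral fx circle_mean_def)
  qed
  ultimately have "((\<lambda>z. circle_mean r f z u) has_derivative (\<lambda>v. circle_mean r (\<lambda>z. ?D z v) z0 u)) (at z0)"
    by (simp only:)
  then show ?thesis
    by (rule has_derivative_transform_within_open[of _ _ _ _ "ball z0 e"])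
      (use e(1) holomorphic_fun_derivative_eq[OF f e(2) e(4)] in auto)
qed

text \<open>The second derivative is a circle mean of first derivatives and inherits their complex
  linearity.\<close>

lemma holomorphic_fun_directional_derivative:
  assumes f: "holomorphic_fun_on f S" and S: "open S"
  shows "holomorphic_fun_on (\<lambda>z. frechet_derivative f (at z) u) S"
  unfolding holomorphic_fun_on_def
proof
  fix z0 assume z0: "z0 \<in> S"
  obtain e r where e: "0 < e" "0 < r" "ball z0 e \<subseteq> S" "\<And>z \<zeta>. z \<in> ball z0 e \<Longrightarrow> cmod \<zeta> \<le> r \<Longrightarrow> z + \<zeta> *s u \<in> S"
    using circle_neighbourhood[OF S z0] by metis
  let ?M = "\<lambda>v. circle_mean r (\<lambda>z. frechet_derivative f (at z) v) z0 u"
  have der: "((\<lambda>z. frechet_derivative f (at z) u) has_derivative ?M) (at z0)"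
    by (rule holomorphic_fun_second_derivative[OF f S z0 e])
  have "frechet_derivative f (at (z0 + circ r t *s u)) (\<i> *s v) = \<i> * frechet_derivative f (at (z0 + circ r t *s u)) v" for t v
    using e by (intro holomorphic_fun_derivative_smult[OF f]) (simp add: norm_circ)
  then have "?M (\<i> *s v) = \<i> * ?M v" for v
    by (simp add: circle_mean_def times_divide_eq_right[symmetric] del: times_divide_eq_right)
  then have "frechet_derivative (\<lambda>z. frechet_derivative f (at z) u) (at z0) (\<i> *s v) =
      \<i> * frechet_derivative (\<lambda>z. frechet_derivative f (at z) u) (at z0) v" for v
    unfolding frechet_derivative_at[OF der, symmetric] .
  then show "(\<lambda>z. frechet_derivative f (at z) u) differentiable (at z0) \<and>
      (\<forall>v. frechet_derivative (\<lambda>z. frechet_derivative f (at z) u) (at z0) (\<i> *s v) =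
           \<i> * frechet_derivative (\<lambda>z. frechet_derivative f (at z) u) (at z0) v)"
    using der by (auto simp: differentiable_def)
qed

text \<open>Differentiating Cauchy's integral for the direction \<open>u\<close> along
  \<open>v\<close> gives the circle mean of the \<open>v\<close>-derivative, and this is Cauchy's
  integral for its derivative along \<open>u\<close>.\<close>

lemma holomorphic_fun_second_derivative_symmetric:
  assumes f: "holomorphic_fun_on f S" and S: "open S" and z0: "z0 \<in> S"
  shows "frechet_derivative (\<lambda>z. frechet_derivative f (at z) u) (at z0) v =
         frechet_derivative (\<lambda>z. frechet_derivative f (at z) v) (at z0) u"
proof -
  obtain e r where e: "0 < e" "0 < r" "ball z0 e \<subseteq> S" "\<And>z \<zeta>. z \<in> ball z0 e \<Longrightarrow> cmod \<zeta> \<le> r \<Longrightarrow> z + \<zeta> *s u \<in> S"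
    using circle_neighbourhood[OF S z0] by metis
  have "frechet_derivative (\<lambda>z. frechet_derivative f (at z) u) (at z0) v =
      circle_mean r (\<lambda>z. frechet_derivative f (at z) v) z0 u"
    using frechet_derivative_at[OF holomorphic_fun_second_derivative[OF f S z0 e]] by metis
  also have "\<dots> = frechet_derivative (\<lambda>z. frechet_derivative f (at z) v) (at z0) u"
    by (rule holomorphic_fun_derivative_eq[OF holomorphic_fun_directional_derivative[OF f S], symmetric]) (use e in auto)
  finally show ?thesis .
qed

lemma holomorphic_vec_has_derivative:
  assumes "holomorphic_vec_on \<phi> S" "y \<in> S"
  shows "(\<phi> has_derivative frechet_derivative \<phi> (at y)) (at y)"
    "Vector_Spaces.linear (*s) (*s) (frechet_derivative \<phi> (at y))"
proof -
  obtain L where L: "(\<phi> has_derivative L) (at y)" "Vector_Spaces.linear (*s) (*s) L"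
    using assms unfolding holomorphic_vec_on_def by blast
  with frechet_derivative_at[OF L(1)] show "(\<phi> has_derivative frechet_derivative \<phi> (at y)) (at y)"
    "Vector_Spaces.linear (*s) (*s) (frechet_derivative \<phi> (at y))" by simp_all
qed

lemma has_derivative_vec_nth: "(\<phi> has_derivative L) F \<Longrightarrow> ((\<lambda>y. \<phi> y $ k) has_derivative (\<lambda>u. L u $ k)) F"
  by (rule bounded_linear.has_derivative[OF bounded_linear_vec_nth])

lemma has_derivative_vecI:
  fixes \<phi> :: "'a::real_normed_vector \<Rightarrow> complex ^ 'n::finite"
  assumes "\<And>k. ((\<lambda>y. \<phi> y $ k) has_derivative (\<lambda>u. L u $ k)) (at y)"
  shows "(\<phi> has_derivative L) (at y)"
proof -
  have "((\<lambda>x. \<phi> x \<bullet> i) has_derivative (\<lambda>u. L u \<bullet> i)) (at y within UNIV)" if "i \<in> Basis" for i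
  proof -
    from that obtain k b where i: "i = axis k b" by (auto simp: Basis_vec_def)
    show ?thesis unfolding i inner_axis
      by (rule has_derivative_inner_left[OF assms])
  qed
  then show ?thesis by (subst has_derivative_componentwise_within) blast
qed

lemma frechet_derivative_vec_nth:
  assumes "\<phi> differentiable (at y)"
  shows "frechet_derivative (\<lambda>y. \<phi> y $ k) (at y) u = frechet_derivative \<phi> (at y) u $ k"
  using frechet_derivative_at[OF has_derivative_vec_nth[OF assms[unfolded frechet_derivative_works]]] by metis

lemma holomorphic_vec_nth:
  fixes \<phi> :: "complex ^ 'm::finite \<Rightarrow> complex ^ 'n::finite"
  assumes \<phi>: "holomorphic_vec_on \<phi> S"
  shows "holomorphic_fun_on (\<lambda>y. \<phi> y $ k) S"
  unfolding holomorphic_fun_on_def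
proof
  fix y assume y: "y \<in> S"
  note d = holomorphic_vec_has_derivative[OF \<phi> y]
  have "\<phi> differentiable (at y)" using d(1) by (auto simp: differentiable_def)
  note n = frechet_derivative_vec_nth[OF this]
  interpret Vector_Spaces.linear "(*s)" "(*s)" "frechet_derivative \<phi> (at y)" by (rule d(2))
  show "(\<lambda>y. \<phi> y $ k) differentiable (at y) \<and>
      (\<forall>u. frechet_derivative (\<lambda>y. \<phi> y $ k) (at y) (\<i> *s u) = \<i> * frechet_derivative (\<lambda>y. \<phi> y $ k) (at y) u)"
    using has_derivative_vec_nth[OF d(1)] by (auto simp: differentiable_def n scale)
qed

lemma holomorphic_vec_directional_derivative:
  fixes \<phi> :: "complex ^ 'm::finite \<Rightarrow> complex ^ 'n::finite"
  assumes \<phi>: "holomorphic_vec_on \<phi> S" and S: "open S" and z: "z \<in> S"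
  shows "((\<lambda>y. frechet_derivative \<phi> (at y) u) has_derivative frechet_derivative (\<lambda>y. frechet_derivative \<phi> (at y) u) (at z)) (at z)"
    "frechet_derivative (\<lambda>y. frechet_derivative \<phi> (at y) u) (at z) v = frechet_derivative (\<lambda>y. frechet_derivative \<phi> (at y) v) (at z) u"
    "continuous_on S (\<lambda>y. frechet_derivative (\<lambda>y. frechet_derivative \<phi> (at y) u) (at y) v)"
proof -
  let ?D = "\<lambda>f y. frechet_derivative f (at y)"
  note h = holomorphic_vec_nth[OF \<phi>]
  note h' = holomorphic_fun_directional_derivative[OF h S]
  have n: "?D (\<lambda>y. \<phi> y $ k) y u = ?D \<phi> y u $ k" if "y \<in> S" for k y u
    using holomorphic_vec_has_derivative(1)[OF \<phi> that] by (intro frechet_derivative_vec_nth) (auto simp: differentiable_def)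
  have d1: "((\<lambda>y. ?D \<phi> y u $ k) has_derivative ?D (\<lambda>y. ?D (\<lambda>y. \<phi> y $ k) y u) y) (at y)" if "y \<in> S" for u k y
    by (rule has_derivative_transform_within_open[OF holomorphic_fun_has_derivative[OF h' that] S that]) (simp add: n)
  have d2: "((\<lambda>y. ?D \<phi> y u) has_derivative (\<lambda>v. \<chi> k. ?D (\<lambda>y. ?D (\<lambda>y. \<phi> y $ k) y u) y v)) (at y)" if "y \<in> S" for u y
    by (rule has_derivative_vecI) (simp add: d1[OF that])
  have eq: "?D (\<lambda>y. ?D \<phi> y u) y v = (\<chi> k. ?D (\<lambda>y. ?D (\<lambda>y. \<phi> y $ k) y u) y v)" if "y \<in> S" for u v y
    using frechet_derivative_at[OF d2[OF that]] by metis
  show "((\<lambda>y. ?D \<phi> y u) has_derivative ?D (\<lambda>y. ?D \<phi> y u) z) (at z)"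
    using d2[OF z] frechet_derivative_at[OF d2[OF z]] by metis
  show "?D (\<lambda>y. ?D \<phi> y u) z v = ?D (\<lambda>y. ?D \<phi> y v) z u"
    unfolding eq[OF z] using holomorphic_fun_second_derivative_symmetric[OF h S z, of _ u v] by simp
  have "continuous_on S (\<lambda>y. \<chi> k. ?D (\<lambda>y. ?D (\<lambda>y. \<phi> y $ k) y u) y v)"
    by (intro continuous_on_vec_lambda holomorphic_fun_derivative_continuous[OF h' S])
  moreover have "continuous_on S (\<lambda>y. ?D (\<lambda>y. ?D \<phi> y u) y v) \<longleftrightarrow> continuous_on S (\<lambda>y. \<chi> k. ?D (\<lambda>y. ?D (\<lambda>y. \<phi> y $ k) y u) y v)"
    by (rule continuous_on_cong[OF refl]) (rule eq)
  ultimately show "continuous_on S (\<lambda>y. ?D (\<lambda>y. ?D \<phi> y u) y v)" by blast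
qed

section \<open>Pullback of forms\<close>

text \<open>Regularity of a form is given for fixed arguments only. Expansion in the basis turns a
  moving argument into fixed vectors with moving coefficients.\<close>

lemma multilinear_slot_expand:
  assumes "multilinear_form k a" "m < k"
  shows "a (v(m := x)) = (\<Sum>b\<in>Basis. (x \<bullet> b) *\<^sub>R a (v(m := b)))"
proof -
  note lin = multilinear_linear[OF assms, of v]
  have "a (v(m := \<Sum>b\<in>Basis. (x \<bullet> b) *\<^sub>R b)) = (\<Sum>b\<in>Basis. (x \<bullet> b) *\<^sub>R a (v(m := b)))"
    by (simp add: linear_sum[OF lin] linear_scale[OF lin])
  then show ?thesis by (simp only: euclidean_representation)
qed

lemma multilinear_continuous:
  fixes a :: "complex ^ 'n::finite \<Rightarrow> 'n covec" and w :: "'b::topological_space \<Rightarrow> nat \<Rightarrow> complex ^ 'n"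
  assumes a: "\<And>y. y \<in> T \<Longrightarrow> multilinear_form k (a y)" and c: "\<And>v. continuous_on T (\<lambda>y. a y v)"
    and \<phi>: "continuous_on S \<phi>" "\<phi> ` S \<subseteq> T" and w: "\<And>j. j < k \<Longrightarrow> continuous_on S (\<lambda>z. w z j)"
  shows "continuous_on S (\<lambda>z. a (\<phi> z) (w z))"
proof -
  \<comment> \<open>The first \<open>m\<close> arguments move and the others are frozen; the slot
    expansion releases one more at each step.\<close>
  have "continuous_on S (\<lambda>z. a (\<phi> z) (\<lambda>j. if j < m then w z j else v j))" if "m \<le> k" for m v
    using that
  proof (induction m arbitrary: v)
    case 0
    show ?case using continuous_on_compose2[OF c \<phi>] by simp
  next
    case (Suc m)
    let ?W = "\<lambda>v z j. if j < m then w z j else v j"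
    have "a (\<phi> z) (\<lambda>j. if j < Suc m then w z j else v j) = (\<Sum>b\<in>Basis. (w z m \<bullet> b) *\<^sub>R a (\<phi> z) (?W (v(m := b)) z))"
      if z: "z \<in> S" for z
    proof -
      have 1: "(\<lambda>j. if j < Suc m then w z j else v j) = (?W v z)(m := w z m)"
        by (auto simp: fun_eq_iff less_Suc_eq)
      have 2: "(?W v z)(m := b) = ?W (v(m := b)) z" for b
        by (auto simp: fun_eq_iff)
      show ?thesis unfolding 1
        by (subst multilinear_slot_expand[OF a]) (use z \<phi> Suc.prems in \<open>auto simp: 2\<close>)
    qed
    then have "continuous_on S (\<lambda>z. a (\<phi> z) (\<lambda>j. if j < Suc m then w z j else v j)) \<longleftrightarrow>
        continuous_on S (\<lambda>z. \<Sum>b\<in>Basis. (w z m \<bullet> b) *\<^sub>R a (\<phi> z) (?W (v(m := b)) z))"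
      by (rule continuous_on_cong[OF refl])
    moreover have "continuous_on S (\<lambda>z. \<Sum>b\<in>Basis. (w z m \<bullet> b) *\<^sub>R a (\<phi> z) (?W (v(m := b)) z))"
      using Suc by (intro continuous_intros w) auto
    ultimately show ?case by blast
  qed
  from this[of k] have "continuous_on S (\<lambda>z. a (\<phi> z) (\<lambda>j. if j < k then w z j else 0))" by simp
  moreover have "a (\<phi> z) (w z) = a (\<phi> z) (\<lambda>j. if j < k then w z j else 0)" if "z \<in> S" for z
    by (rule multilinear_cong[OF a]) (use that \<phi> in auto)
  then have "continuous_on S (\<lambda>z. a (\<phi> z) (w z)) \<longleftrightarrow> continuous_on S (\<lambda>z. a (\<phi> z) (\<lambda>j. if j < k then w z j else 0))"
    by (rule continuous_on_cong[OF refl])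
  ultimately show ?thesis by blast
qed

text \<open>The linear relations between the coefficient functions pass to their derivatives by
  uniqueness of the derivative.\<close>

lemma multilinear_frechet_derivative:
  fixes a :: "complex ^ 'n::finite \<Rightarrow> 'n covec"
  assumes T: "open T" "y \<in> T" and a: "\<And>y. y \<in> T \<Longrightarrow> multilinear_form k (a y)"
    and d: "\<And>v. (\<lambda>y. a y v) differentiable (at y)"
  shows "multilinear_form k (\<lambda>v. frechet_derivative (\<lambda>y. a y v) (at y) u)"
proof -
  let ?D = "\<lambda>v. frechet_derivative (\<lambda>y. a y v) (at y)"
  have der: "((\<lambda>y. a y v) has_derivative ?D v) (at y)" for v
    using d by (simp add: frechet_derivative_works)
  have uniq: "?D v = L" if "(f has_derivative L) (at y)" "\<And>y. y \<in> T \<Longrightarrow> f y = a y v" for v f L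
    using has_derivative_transform_within_open[OF that(1) T that(2)] frechet_derivative_at by metis
  have "?D v = ?D w" if "\<forall>j<k. v j = w j" for v w
    by (rule uniq[OF der]) (use that in \<open>auto intro!: multilinear_cong[OF a]\<close>)
  moreover have "linear (\<lambda>x. ?D (v(j := x)) u)" if j: "j < k" for v j
  proof -
    note lin = multilinear_linear[OF a j, of _ v]
    have "?D (v(j := x + x')) = (\<lambda>u. ?D (v(j := x)) u + ?D (v(j := x')) u)" for x x'
      by (rule uniq[OF has_derivative_add[OF der der]]) (simp add: linear_add[OF lin])
    moreover have "?D (v(j := c *\<^sub>R x)) = (\<lambda>u. c *\<^sub>R ?D (v(j := x)) u)" for c x
      by (rule uniq[OF has_derivative_scaleR_right[OF der]]) (simp add: linear_scale[OF lin])
    ultimately show ?thesis by (simp add: linear_iff)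
  qed
  ultimately show ?thesis unfolding multilinear_form_def by metis
qed

text \<open>The product rule: the form is differentiated along \<open>\<phi>\<close>, and each
  argument in its own slot. The slots are released one after the other, as for continuity.\<close>

lemma multilinear_has_derivative:
  fixes a :: "complex ^ 'n::finite \<Rightarrow> 'n covec" and \<phi> :: "'b::real_normed_vector \<Rightarrow> complex ^ 'n"
  assumes T: "open T" "\<phi> z \<in> T" and a: "\<And>y. y \<in> T \<Longrightarrow> multilinear_form k (a y)"
    and d: "\<And>v. (\<lambda>y. a y v) differentiable (at (\<phi> z))"
    and S: "open S" "z \<in> S" "\<phi> ` S \<subseteq> T"
    and \<phi>: "(\<phi> has_derivative \<phi>') (at z)"
    and w: "\<And>j. j < k \<Longrightarrow> ((\<lambda>z. w z j) has_derivative w' j) (at z)"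
  shows "((\<lambda>z. a (\<phi> z) (w z)) has_derivative
     (\<lambda>u. frechet_derivative (\<lambda>y. a y (w z)) (at (\<phi> z)) (\<phi>' u) + (\<Sum>j<k. a (\<phi> z) ((w z)(j := w' j u))))) (at z)"
proof -
  let ?D = "\<lambda>v. frechet_derivative (\<lambda>y. a y v) (at (\<phi> z))"
  have der: "((\<lambda>y. a y v) has_derivative ?D v) (at (\<phi> z))" for v
    using d by (simp add: frechet_derivative_works)
  note Dmult = multilinear_frechet_derivative[OF T a d]
  have "((\<lambda>z. a (\<phi> z) (\<lambda>j. if j < m then w z j else v j)) has_derivative
     (\<lambda>u. ?D (\<lambda>j. if j < m then w z j else v j) (\<phi>' u) +
       (\<Sum>j<m. a (\<phi> z) ((\<lambda>j. if j < m then w z j else v j)(j := w' j u))))) (at z)" if "m \<le> k" for m v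
    using that
  proof (induction m arbitrary: v)
    case 0
    show ?case using has_derivative_compose[OF \<phi> der] by simp
  next
    case (Suc m)
    let ?W = "\<lambda>v z j. if j < m then w z j else v j"
    have m: "m < k" using Suc by simp
    have 1: "(\<lambda>j. if j < Suc m then w z j else v j) = (?W v z)(m := w z m)" for z
      by (auto simp: fun_eq_iff less_Suc_eq)
    have 2: "?W (v(m := b)) z = (?W v z)(m := b)" for b z
      by (auto simp: fun_eq_iff)
    let ?V = "?W v z"
    have "((\<lambda>z. \<Sum>b\<in>Basis. (w z m \<bullet> b) *\<^sub>R a (\<phi> z) (?W (v(m := b)) z)) has_derivative
      (\<lambda>u. \<Sum>b\<in>Basis. (w z m \<bullet> b) *\<^sub>R (?D (?W (v(m := b)) z) (\<phi>' u) + (\<Sum>j<m. a (\<phi> z) ((?W (v(m := b)) z)(j := w' j u))))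
          + (w' m u \<bullet> b) *\<^sub>R a (\<phi> z) (?W (v(m := b)) z))) (at z)"
      by (intro has_derivative_sum has_derivative_scaleR has_derivative_inner_left w m Suc.IH) (use Suc in auto)
    moreover have "(\<Sum>b\<in>Basis. (w z m \<bullet> b) *\<^sub>R (?D (?W (v(m := b)) z) (\<phi>' u) + (\<Sum>j<m. a (\<phi> z) ((?W (v(m := b)) z)(j := w' j u))))
          + (w' m u \<bullet> b) *\<^sub>R a (\<phi> z) (?W (v(m := b)) z))
        = ?D (?V(m := w z m)) (\<phi>' u) + (\<Sum>j<Suc m. a (\<phi> z) ((?V(m := w z m))(j := w' j u)))" for u
    proof -
      have "(\<Sum>b\<in>Basis. (w z m \<bullet> b) *\<^sub>R a (\<phi> z) ((?V(m := b))(j := w' j u))) = a (\<phi> z) ((?V(m := w z m))(j := w' j u))"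
        if "j < m" for j
        using multilinear_slot_expand[OF a[OF T(2)] m, of "?V(j := w' j u)" "w z m"] that
        by (simp add: fun_upd_twist)
      then have "(\<Sum>b\<in>Basis. (w z m \<bullet> b) *\<^sub>R (\<Sum>j<m. a (\<phi> z) ((?V(m := b))(j := w' j u)))) =
          (\<Sum>j<m. a (\<phi> z) ((?V(m := w z m))(j := w' j u)))"
        unfolding scaleR_sum_right by (subst sum.swap) simp
      moreover have "(\<Sum>b\<in>Basis. (w z m \<bullet> b) *\<^sub>R ?D (?V(m := b)) (\<phi>' u)) = ?D (?V(m := w z m)) (\<phi>' u)"
        by (rule multilinear_slot_expand[OF Dmult m, symmetric])
      moreover have "(\<Sum>b\<in>Basis. (w' m u \<bullet> b) *\<^sub>R a (\<phi> z) (?V(m := b))) = a (\<phi> z) (?V(m := w' m u))"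
        by (rule multilinear_slot_expand[OF a[OF T(2)] m, symmetric])
      ultimately show ?thesis
        unfolding 2 by (simp add: sum.distrib scaleR_add_right)
    qed
    ultimately have "((\<lambda>z. \<Sum>b\<in>Basis. (w z m \<bullet> b) *\<^sub>R a (\<phi> z) (?W (v(m := b)) z)) has_derivative
      (\<lambda>u. ?D (?V(m := w z m)) (\<phi>' u) + (\<Sum>j<Suc m. a (\<phi> z) ((?V(m := w z m))(j := w' j u))))) (at z)"
      by (simp only:)
    then have "((\<lambda>z. a (\<phi> z) (\<lambda>j. if j < Suc m then w z j else v j)) has_derivative
      (\<lambda>u. ?D (?V(m := w z m)) (\<phi>' u) + (\<Sum>j<Suc m. a (\<phi> z) ((?V(m := w z m))(j := w' j u))))) (at z)"
    proof (rule has_derivative_transform_within_open[OF _ S(1,2)])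
      fix x assume "x \<in> S"
      then have "multilinear_form k (a (\<phi> x))" using S a by blast
      from multilinear_slot_expand[OF this m, of "?W v x" "w x m"]
      show "(\<Sum>b\<in>Basis. (w x m \<bullet> b) *\<^sub>R a (\<phi> x) (?W (v(m := b)) x)) = a (\<phi> x) (\<lambda>j. if j < Suc m then w x j else v j)"
        unfolding 1 2 by simp
    qed
    then show ?case unfolding 1[of z] .
  qed
  from this[of k "w z"]
  have "((\<lambda>x. a (\<phi> x) (\<lambda>j. if j < k then w x j else w z j)) has_derivative
     (\<lambda>u. ?D (w z) (\<phi>' u) + (\<Sum>j<k. a (\<phi> z) ((w z)(j := w' j u))))) (at z)" by simp
  then show ?thesis
  proof (rule has_derivative_transform_within_open[OF _ S(1,2)])
    fix x assume "x \<in> S"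
    then have "multilinear_form k (a (\<phi> x))" using S a by blast
    then show "a (\<phi> x) (\<lambda>j. if j < k then w x j else w z j) = a (\<phi> x) (w x)"
      by (rule multilinear_cong) simp
  qed
qed

lemma skip_compose: "skip i (\<lambda>j. f (v j)) = (\<lambda>j. f (skip i v j))"
  by (auto simp: skip_def)

text \<open>These are the terms in which \<open>d\<close> of a pullback differentiates the
  differential of the map. Second derivatives are symmetric in the pair of indices, an alternating
  form is antisymmetric in it.\<close>

lemma alternating_second_order_cancel:
  fixes b :: "'n::finite covec" and h :: "nat \<Rightarrow> nat \<Rightarrow> complex ^ 'n"
  assumes b: "alternating_form k b" and h: "\<And>i m. h i m = h m i"
  shows "(\<Sum>i\<le>k. (-1) ^ i * (\<Sum>j<k. b ((skip i V)(j := skip i (h i) j)))) = 0"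
proof -
  \<comment> \<open>Entry \<open>i\<close> is omitted and entry \<open>m\<close> replaced by the
    second derivative; the diagonal is set to 0 to obtain a full square of indices.\<close>
  define t where "t i m = (if i = m then 0 else (-1) ^ i * b (skip i (V(m := h i m))))" for i m
  have anti: "t i m = - t m i" if "i \<le> k" "m \<le> k" for i m
  proof (cases "i = m")
    case True
    then show ?thesis by (simp add: t_def)
  next
    case False
    let ?U = "\<lambda>j. (V(m := h i m)) (Transposition.transpose i m j)"
    have "(\<lambda>j. ?U (Transposition.transpose i m j)) = V(m := h i m)" by (simp add: fun_eq_iff)
    moreover have "skip m ?U = skip m (V(i := h i m))"
      using False by (auto simp: skip_def fun_eq_iff Transposition.transpose_def)
    ultimately show ?thesis
      using skip_transpose[OF b that False, of ?U] False h[of i m] by (simp add: t_def)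
  qed
  have "(\<Sum>j<k. b ((skip i V)(j := skip i (h i) j))) = (\<Sum>m\<in>{..k} - {i}. b (skip i (V(m := h i m))))" if i: "i \<le> k" for i
  \<comment> \<open>Translates positions after the omission of \<open>i\<close> into original
    indices.\<close>
  proof (rule sum.reindex_bij_witness[where i="\<lambda>m. if m < i then m else m - 1" and j="\<lambda>j. if j < i then j else Suc j"])
    fix j assume "j \<in> {..<k}"
    have "skip i (V((if j < i then j else Suc j) := h i (if j < i then j else Suc j))) = (skip i V)(j := skip i (h i) j)"
      by (auto simp: skip_def fun_eq_iff)
    then show "b (skip i (V((if j < i then j else Suc j) := h i (if j < i then j else Suc j)))) =
        b ((skip i V)(j := skip i (h i) j))" by simp
  qed (use i in auto)
  then have "(\<Sum>i\<le>k. (-1) ^ i * (\<Sum>j<k. b ((skip i V)(j := skip i (h i) j)))) =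
      (\<Sum>i\<le>k. (-1) ^ i * (\<Sum>m\<in>{..k} - {i}. b (skip i (V(m := h i m)))))"
    by (intro sum.cong refl) simp
  also have "\<dots> = (\<Sum>i\<le>k. \<Sum>m\<le>k. t i m)"
  proof (intro sum.cong refl)
    fix i assume "i \<in> {..k}"
    then have "(\<Sum>m\<le>k. t i m) = t i i + (\<Sum>m\<in>{..k} - {i}. t i m)" by (intro sum.remove) auto
    then show "(-1) ^ i * (\<Sum>m\<in>{..k} - {i}. b (skip i (V(m := h i m)))) = (\<Sum>m\<le>k. t i m)"
      by (auto simp: t_def sum_distrib_left intro!: sum.cong)
  qed
  finally have 1: "(\<Sum>i\<le>k. (-1) ^ i * (\<Sum>j<k. b ((skip i V)(j := skip i (h i) j)))) = (\<Sum>i\<le>k. \<Sum>m\<le>k. t i m)" .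
  have "(\<Sum>i\<le>k. \<Sum>m\<le>k. t i m) = (\<Sum>m\<le>k. \<Sum>i\<le>k. t i m)" by (rule sum.swap)
  also have "\<dots> = (\<Sum>m\<le>k. \<Sum>i\<le>k. - t m i)" by (intro sum.cong refl anti) auto
  also have "\<dots> = - (\<Sum>i\<le>k. \<Sum>m\<le>k. t i m)" by (simp add: sum_negf)
  finally show ?thesis unfolding 1 by simp
qed

section \<open>Pullback by a holomorphic map between coordinate spaces\<close>

context
  fixes \<phi> :: "complex ^ 'm::finite \<Rightarrow> complex ^ 'n::finite" and S T k and \<beta> :: "complex ^ 'n \<Rightarrow> 'n covec"
  assumes S: "open S" and T: "open T" "\<phi> ` S \<subseteq> T" and \<phi>: "holomorphic_vec_on \<phi> S"
    and \<beta>: "\<And>y. y \<in> T \<Longrightarrow> alternating_form k (\<beta> y)" and d: "\<And>y v. y \<in> T \<Longrightarrow> (\<lambda>y. \<beta> y v) differentiable (at y)"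
begin

private abbreviation (input) "D\<phi> z \<equiv> frechet_derivative \<phi> (at z)"

lemma pullback_has_derivative:
  assumes z: "z \<in> S"
  shows "((\<lambda>z. \<beta> (\<phi> z) (\<lambda>j. D\<phi> z (v j))) has_derivative
    (\<lambda>u. frechet_derivative (\<lambda>y. \<beta> y (\<lambda>j. D\<phi> z (v j))) (at (\<phi> z)) (D\<phi> z u) +
       (\<Sum>j<k. \<beta> (\<phi> z) ((\<lambda>j. D\<phi> z (v j))(j := frechet_derivative (\<lambda>y. D\<phi> y (v j)) (at z) u))))) (at z)"
proof (rule multilinear_has_derivative[OF T(1) _ _ _ S z T(2)])
  show "\<phi> z \<in> T" using z T by auto
  then show "(\<lambda>y. \<beta> y v) differentiable at (\<phi> z)" for v using d by blast
  show "multilinear_form k (\<beta> y)" if "y \<in> T" for y using alternating_multilinear[OF \<beta>[OF that]] .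
  show "(\<phi> has_derivative D\<phi> z) (at z)" by (rule holomorphic_vec_has_derivative[OF \<phi> z])
  show "((\<lambda>z. D\<phi> z (v j)) has_derivative frechet_derivative (\<lambda>y. D\<phi> y (v j)) (at z)) (at z)" for j
    by (rule holomorphic_vec_directional_derivative[OF \<phi> S z])
qed

text \<open>Naturality of \<open>d\<close>: the product rule gives the pulled back exterior
  derivative plus second derivatives of \<open>\<phi>\<close>, which cancel.\<close>

lemma ext_deriv_pullback:
  assumes z: "z \<in> S"
  shows "(\<Sum>i\<le>k. (-1) ^ i * frechet_derivative (\<lambda>z. \<beta> (\<phi> z) (\<lambda>j. D\<phi> z (skip i v j))) (at z) (v i)) =
    ext_deriv k \<beta> (\<phi> z) (\<lambda>j. D\<phi> z (v j))"
proof -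
  let ?H = "\<lambda>i m. frechet_derivative (\<lambda>y. D\<phi> y (v m)) (at z) (v i)"
  let ?V = "\<lambda>j. D\<phi> z (v j)"
  have \<phi>z: "\<phi> z \<in> T" using z T by auto
  have eq: "frechet_derivative (\<lambda>z. \<beta> (\<phi> z) (\<lambda>j. D\<phi> z (skip i v j))) (at z) (v i) =
      frechet_derivative (\<lambda>y. \<beta> y (skip i ?V)) (at (\<phi> z)) (?V i) +
      (\<Sum>j<k. \<beta> (\<phi> z) ((skip i ?V)(j := skip i (?H i) j)))" for i
  proof -
    have "skip i (?H i) j = frechet_derivative (\<lambda>y. D\<phi> y (skip i v j)) (at z) (v i)" for j
      by (simp add: skip_def)
    then show ?thesis
      using frechet_derivative_at[OF pullback_has_derivative[OF z, of "skip i v"], symmetric]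
      by (simp add: skip_compose)
  qed
  have "(\<Sum>i\<le>k. (-1) ^ i * (\<Sum>j<k. \<beta> (\<phi> z) ((skip i ?V)(j := skip i (?H i) j)))) = 0"
    by (rule alternating_second_order_cancel[OF \<beta>[OF \<phi>z]])
      (rule holomorphic_vec_directional_derivative(2)[OF \<phi> S z])
  then show ?thesis unfolding eq by (simp add: ext_deriv_def distrib_left sum.distrib)
qed

lemma pullback_derivative_continuous:
  assumes c: "\<And>u v. continuous_on T (\<lambda>y. frechet_derivative (\<lambda>y. \<beta> y v) (at y) u)"
  shows "continuous_on S (\<lambda>z. frechet_derivative (\<lambda>z. \<beta> (\<phi> z) (\<lambda>j. D\<phi> z (v j))) (at z) u)"
proof -
  let ?D = "\<lambda>y v. frechet_derivative (\<lambda>y. \<beta> y v) (at y)"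
  have c\<phi>: "continuous_on S \<phi>"
    using holomorphic_vec_has_derivative(1)[OF \<phi>] by (meson continuous_at_imp_continuous_on has_derivative_continuous)
  have cD: "continuous_on S (\<lambda>z. D\<phi> z x)" for x
    using holomorphic_vec_directional_derivative(1)[OF \<phi> S] by (meson continuous_at_imp_continuous_on has_derivative_continuous)
  have c\<beta>: "continuous_on T (\<lambda>y. \<beta> y v)" for v
    using d by (meson continuous_at_imp_continuous_on differentiable_imp_continuous_within)
  \<comment> \<open>The direction \<open>D\<phi> z u\<close> moves as well, so it is expanded in the
    basis before the hypothesis for fixed directions is applied.\<close>
  have "frechet_derivative (\<lambda>z. \<beta> (\<phi> z) (\<lambda>j. D\<phi> z (v j))) (at z) u =
    (\<Sum>b\<in>Basis. (D\<phi> z u \<bullet> b) *\<^sub>R ?D (\<phi> z) (\<lambda>j. D\<phi> z (v j)) b) +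
    (\<Sum>j<k. \<beta> (\<phi> z) ((\<lambda>j. D\<phi> z (v j))(j := frechet_derivative (\<lambda>y. D\<phi> y (v j)) (at z) u)))" if z: "z \<in> S" for z
  proof -
    have "linear (?D (\<phi> z) (\<lambda>j. D\<phi> z (v j)))"
      using d T z by (intro linear_frechet_derivative) auto
    then have "?D (\<phi> z) (\<lambda>j. D\<phi> z (v j)) (\<Sum>b\<in>Basis. (D\<phi> z u \<bullet> b) *\<^sub>R b) =
        (\<Sum>b\<in>Basis. (D\<phi> z u \<bullet> b) *\<^sub>R ?D (\<phi> z) (\<lambda>j. D\<phi> z (v j)) b)"
      by (simp add: linear_sum linear_scale)
    then show ?thesis
      using frechet_derivative_at[OF pullback_has_derivative[OF z, of v], symmetric]
      by (simp add: euclidean_representation)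
  qed
  then have "continuous_on S (\<lambda>z. frechet_derivative (\<lambda>z. \<beta> (\<phi> z) (\<lambda>j. D\<phi> z (v j))) (at z) u) \<longleftrightarrow>
    continuous_on S (\<lambda>z. (\<Sum>b\<in>Basis. (D\<phi> z u \<bullet> b) *\<^sub>R ?D (\<phi> z) (\<lambda>j. D\<phi> z (v j)) b) +
    (\<Sum>j<k. \<beta> (\<phi> z) ((\<lambda>j. D\<phi> z (v j))(j := frechet_derivative (\<lambda>y. D\<phi> y (v j)) (at z) u))))"
    by (rule continuous_on_cong[OF refl])
  moreover have "continuous_on S (\<lambda>z. ?D (\<phi> z) (\<lambda>j. D\<phi> z (v j)) b)" for b
    by (rule multilinear_continuous[where a="\<lambda>y v. ?D y v b" and k=k and T=T, OF _ c c\<phi> T(2) cD])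
      (rule multilinear_frechet_derivative[OF T(1) _ alternating_multilinear[OF \<beta>] d])
  moreover have "continuous_on S (\<lambda>z. \<beta> (\<phi> z) ((\<lambda>j. D\<phi> z (v j))(j := frechet_derivative (\<lambda>y. D\<phi> y (v j)) (at z) u)))" for j
  proof (rule multilinear_continuous[OF alternating_multilinear[OF \<beta>] c\<beta> c\<phi> T(2)])
    fix i
    have "continuous_on S (\<lambda>z. frechet_derivative (\<lambda>y. D\<phi> y (v j)) (at z) u)"
      using holomorphic_vec_directional_derivative(3)[OF \<phi> S] by (cases "S = {}") auto
    then show "continuous_on S (\<lambda>z. ((\<lambda>j. D\<phi> z (v j))(j := frechet_derivative (\<lambda>y. D\<phi> y (v j)) (at z) u)) i)"
      using cD by (cases "i = j") auto
  qed
  ultimately show ?thesis using cD by (auto intro!: continuous_intros)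
qed

end

section \<open>Local expressions on manifolds\<close>

lemma scaleR_eq_smult: "c *\<^sub>R v = complex_of_real c *s v"
  by (simp add: vec_eq_iff complex_eq_iff)

lemma complex_linear_linear:
  assumes "Vector_Spaces.linear (*s) (*s) (L :: complex ^ 'm::finite \<Rightarrow> complex ^ 'n::finite)"
  shows "linear L" "L (\<i> *s u) = \<i> *s L u"
proof -
  interpret Vector_Spaces.linear "(*s)" "(*s)" L by (rule assms)
  show "linear L" by (simp add: linear_iff add scale scaleR_eq_smult)
  show "L (\<i> *s u) = \<i> *s L u" by (rule scale)
qed

lemma chart_inv_std: "chart_inv std_chart z = z"
  unfolding chart_inv_def std_chart_def by (simp add: inv_into_f_eq)

lemma differential_std: "differential std_chart c f z = frechet_derivative (snd c \<circ> f) (at z)"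
  by (simp add: differential_def o_def chart_inv_std)

lemma chart_at_in:
  assumes "complex_atlas A" shows "chart_at A x \<in> A" "x \<in> fst (chart_at A x)"
proof -
  have "\<exists>c. c \<in> A \<and> x \<in> fst c" using assms unfolding complex_atlas_def by (metis UN_E UNIV_I)
  from someI_ex[OF this] show "chart_at A x \<in> A" "x \<in> fst (chart_at A x)"
    unfolding chart_at_def by auto
qed

lemma atlas_chart:
  assumes "complex_atlas A" "c \<in> A"
  shows "open (fst c)" "open (chart_image c)" "continuous_on (fst c) (snd c)"
    "x \<in> fst c \<Longrightarrow> chart_inv c (snd c x) = x" "x \<in> fst c \<Longrightarrow> snd c x \<in> chart_image c"
  using assms unfolding complex_atlas_def homeomorphism_def chart_image_def by auto

lemma holomorphic_map_std:
  assumes "holomorphic_map {std_chart} A f" "c \<in> A"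
  shows "holomorphic_vec_on (snd c \<circ> f) (f -` fst c)"
proof -
  have "holomorphic_vec_on (snd c \<circ> f \<circ> chart_inv std_chart) (snd std_chart ` (fst std_chart \<inter> f -` fst c))"
    using assms unfolding holomorphic_map_def by blast
  moreover have "snd c \<circ> f \<circ> chart_inv std_chart = snd c \<circ> f" by (simp add: fun_eq_iff chart_inv_std)
  moreover have "snd std_chart ` (fst std_chart \<inter> f -` fst c) = f -` fst c" by (simp add: std_chart_def)
  ultimately show ?thesis by simp
qed

lemma holomorphic_map_continuous: "holomorphic_map A B f \<Longrightarrow> continuous_on UNIV f"
  by (simp add: holomorphic_map_def)

text \<open>With \<open>F\<close> the identity this compares the local expressions of \<open>g\<close> in two charts.\<close>

lemma chart_chain_rule:
  fixes g :: "complex ^ 'm::finite \<Rightarrow> 'y::t2_space" and F :: "'y \<Rightarrow> 'x::t2_space"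
  assumes c: "\<And>x. x \<in> fst c \<Longrightarrow> chart_inv c (snd c x) = x" "open (fst c)"
    and g: "continuous_on UNIV g" "holomorphic_vec_on (snd c \<circ> g) (g -` fst c)"
    and F: "holomorphic_vec_on (snd c' \<circ> F \<circ> chart_inv c) (snd c ` (fst c \<inter> F -` fst c'))"
    and z: "g z \<in> fst c" "F (g z) \<in> fst c'"
  shows "((snd c' \<circ> (F \<circ> g)) has_derivative
     (\<lambda>u. differential c c' F (snd c (g z)) (frechet_derivative (snd c \<circ> g) (at z) u))) (at z)"
    "frechet_derivative (snd c' \<circ> (F \<circ> g)) (at z) u =
     differential c c' F (snd c (g z)) (frechet_derivative (snd c \<circ> g) (at z) u)"
proof -
  let ?P = "snd c' \<circ> F \<circ> chart_inv c"
  have "((\<lambda>z. ?P ((snd c \<circ> g) z)) has_derivative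
     (\<lambda>u. frechet_derivative ?P (at ((snd c \<circ> g) z)) (frechet_derivative (snd c \<circ> g) (at z) u))) (at z)"
    by (rule has_derivative_compose[OF holomorphic_vec_has_derivative(1)[OF g(2)] holomorphic_vec_has_derivative(1)[OF F]])
      (use z in auto)
  then show der: "((snd c' \<circ> (F \<circ> g)) has_derivative
     (\<lambda>u. differential c c' F (snd c (g z)) (frechet_derivative (snd c \<circ> g) (at z) u))) (at z)"
    unfolding differential_def comp_apply[of "snd c" g z]
  proof (rule has_derivative_transform_within_open)
    show "open (g -` fst c)" using g(1) c(2) by (intro open_vimage) auto
  qed (use z c in auto)
  show "frechet_derivative (snd c' \<circ> (F \<circ> g)) (at z) u =
     differential c c' F (snd c (g z)) (frechet_derivative (snd c \<circ> g) (at z) u)"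
    using frechet_derivative_at[OF der] by metis
qed

lemma smooth_form_alternating: "smooth_form A k \<alpha> \<Longrightarrow> c \<in> A \<Longrightarrow> y \<in> chart_image c \<Longrightarrow> alternating_form k (\<alpha> c y)"
  by (simp add: smooth_form_def)

lemma smooth_form_C1:
  assumes "smooth_form A k \<alpha>" "c \<in> A"
  shows "y \<in> chart_image c \<Longrightarrow> (\<lambda>y. \<alpha> c y v) differentiable (at y)"
    "continuous_on (chart_image c) (\<lambda>y. \<alpha> c y v)"
    "continuous_on (chart_image c) (\<lambda>y. frechet_derivative (\<lambda>y. \<alpha> c y v) (at y) u)"
proof -
  have "smooth_on (\<lambda>y. \<alpha> c y v) (chart_image c)" using assms by (simp add: smooth_form_def)
  then have "C_k_on 0 (\<lambda>y. \<alpha> c y v) (chart_image c)" "C_k_on (Suc 0) (\<lambda>y. \<alpha> c y v) (chart_image c)"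
    unfolding smooth_on_def by blast+
  then show "y \<in> chart_image c \<Longrightarrow> (\<lambda>y. \<alpha> c y v) differentiable (at y)"
    "continuous_on (chart_image c) (\<lambda>y. \<alpha> c y v)"
    "continuous_on (chart_image c) (\<lambda>y. frechet_derivative (\<lambda>y. \<alpha> c y v) (at y) u)"
    by simp_all
qed

section \<open>Pullback from a manifold to coordinate space\<close>

context
  fixes A :: "('x::{t2_space, second_countable_topology}, 'n::finite) chart set" and f :: "complex ^ 'm::finite \<Rightarrow> 'x"
  assumes A: "complex_atlas A" and f: "holomorphic_map {std_chart} A f"
begin

lemma pullback_eq_chart:
  assumes \<alpha>: "smooth_form A k \<alpha>" and c: "c \<in> A" "f z \<in> fst c"
  shows "pullback A f \<alpha> std_chart z v = \<alpha> c (snd c (f z)) (\<lambda>j. frechet_derivative (snd c \<circ> f) (at z) (v j))"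
proof -
  let ?c = "chart_at A (f z)"
  note ch = chart_at_in[OF A, of "f z"]
  have "holomorphic_vec_on (snd c \<circ> chart_inv ?c) (snd ?c ` (fst ?c \<inter> fst c))"
    using A c ch unfolding complex_atlas_def by blast
  then have "frechet_derivative (snd c \<circ> ((\<lambda>x. x) \<circ> f)) (at z) u =
     differential ?c c (\<lambda>x. x) (snd ?c (f z)) (frechet_derivative (snd ?c \<circ> f) (at z) u)" for u
    by (intro chart_chain_rule atlas_chart[OF A ch(1)] holomorphic_map_continuous[OF f] holomorphic_map_std[OF f ch(1)])
      (use c ch in \<open>simp_all add: o_def\<close>)
  moreover have "\<alpha> ?c (snd ?c (f z)) v = \<alpha> c (snd c (f z)) (\<lambda>j. differential ?c c (\<lambda>x. x) (snd ?c (f z)) (v j))" for v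
    using \<alpha> c ch unfolding smooth_form_def by blast
  ultimately show ?thesis
    by (simp add: pullback_def Let_def chart_inv_std differential_std o_def)
qed

lemma pullback_multilinear:
  assumes \<alpha>: "smooth_form A k \<alpha>"
  shows "alternating_form k (pullback A f \<alpha> std_chart z)"
proof -
  let ?c = "chart_at A (f z)"
  note ch = chart_at_in[OF A, of "f z"]
  let ?D = "frechet_derivative (snd ?c \<circ> f) (at z)"
  have lin: "linear ?D"
    using holomorphic_vec_has_derivative(2)[OF holomorphic_map_std[OF f ch(1)]] ch complex_linear_linear by auto
  have a: "alternating_form k (\<alpha> ?c (snd ?c (f z)))"
    using \<alpha> ch atlas_chart[OF A ch(1)] by (intro smooth_form_alternating) auto
  let ?a = "\<lambda>v. \<alpha> ?c (snd ?c (f z)) (\<lambda>j. ?D (v j))"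
  have "?a v = ?a w" if "\<forall>j<k. v j = w j" for v w
    by (rule alternating_cong[OF a]) (use that in simp)
  moreover have "linear (\<lambda>u. ?a (v(j := u)))" if "j < k" for v j
  proof -
    have "(\<lambda>i. ?D ((v(j := u)) i)) = (\<lambda>i. ?D (v i))(j := ?D u)" for u by (auto simp: fun_eq_iff)
    then show ?thesis
      using linear_compose[OF lin alternating_linear[OF a that, of "\<lambda>i. ?D (v i)"]] by (simp add: o_def)
  qed
  moreover have "?a v = 0" if "i < k" "j < k" "i \<noteq> j" "v i = v j" for v i j
    by (rule alternating_eq_0[OF a that(1-3)]) (use that in simp)
  ultimately have "alternating_form k ?a" unfolding alternating_form_def by blast
  moreover have "pullback A f \<alpha> std_chart z = ?a"
    by (rule ext) (rule pullback_eq_chart[OF \<alpha> ch])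
  ultimately show ?thesis by simp
qed

lemma pullback_continuous:
  assumes \<alpha>: "smooth_form A k \<alpha>"
  shows "continuous_on UNIV (\<lambda>z. pullback A f \<alpha> std_chart z v)"
proof (rule continuous_on_local)
  fix z0
  let ?c = "chart_at A (f z0)"
  note ch = chart_at_in[OF A, of "f z0"]
  note at = atlas_chart[OF A ch(1)]
  let ?S = "f -` fst ?c"
  have S: "open ?S" using holomorphic_map_continuous[OF f] at(1) by (intro open_vimage) auto
  note h = holomorphic_map_std[OF f ch(1)]
  have "continuous_on ?S (\<lambda>z. \<alpha> ?c ((snd ?c \<circ> f) z) (\<lambda>j. frechet_derivative (snd ?c \<circ> f) (at z) (v j)))"
  proof (rule multilinear_continuous[where a="\<alpha> ?c" and T="chart_image ?c" and k=k])
    show "multilinear_form k (\<alpha> ?c y)" if "y \<in> chart_image ?c" for y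
      using smooth_form_alternating[OF \<alpha> ch(1) that] by (rule alternating_multilinear)
    show "continuous_on (chart_image ?c) (\<lambda>y. \<alpha> ?c y v)" for v by (rule smooth_form_C1[OF \<alpha> ch(1)])
    show "continuous_on ?S (snd ?c \<circ> f)"
      using holomorphic_vec_has_derivative(1)[OF h] by (meson continuous_at_imp_continuous_on has_derivative_continuous)
    show "(snd ?c \<circ> f) ` ?S \<subseteq> chart_image ?c" using at by auto
    show "continuous_on ?S (\<lambda>z. frechet_derivative (snd ?c \<circ> f) (at z) (v j))" for j
      using holomorphic_vec_directional_derivative(1)[OF h S] by (meson continuous_at_imp_continuous_on has_derivative_continuous)
  qed
  moreover have "continuous_on ?S (\<lambda>z. pullback A f \<alpha> std_chart z v) \<longleftrightarrow>
     continuous_on ?S (\<lambda>z. \<alpha> ?c ((snd ?c \<circ> f) z) (\<lambda>j. frechet_derivative (snd ?c \<circ> f) (at z) (v j)))"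
    by (rule continuous_on_cong[OF refl]) (simp add: pullback_eq_chart[OF \<alpha> ch(1)])
  ultimately show "\<exists>W. open W \<and> z0 \<in> W \<and> continuous_on W (\<lambda>z. pullback A f \<alpha> std_chart z v)"
    using S ch by blast
qed

lemma pullback_local:
  assumes \<alpha>: "smooth_form A k \<alpha>" and c: "c \<in> A"
  defines "D \<equiv> \<lambda>z. frechet_derivative (snd c \<circ> f) (at z)"
  defines "b \<equiv> \<lambda>v z. \<alpha> c ((snd c \<circ> f) z) (\<lambda>j. D z (v j))"
  shows "open (f -` fst c)" (is "open ?S")
    "z \<in> f -` fst c \<Longrightarrow> ((\<lambda>z. pullback A f \<alpha> std_chart z v) has_derivative frechet_derivative (b v) (at z)) (at z)"
    "z \<in> f -` fst c \<Longrightarrow> (\<Sum>i\<le>k. (-1) ^ i * frechet_derivative (b (skip i v)) (at z) (v i)) =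
      ext_deriv k (\<alpha> c) (snd c (f z)) (\<lambda>j. D z (v j))"
    "continuous_on (f -` fst c) (\<lambda>z. frechet_derivative (b v) (at z) u)"
proof -
  note at = atlas_chart[OF A c]
  show S: "open ?S" using holomorphic_map_continuous[OF f] at(1) by (intro open_vimage) auto
  have T: "(snd c \<circ> f) ` ?S \<subseteq> chart_image c" using at by auto
  note * = S at(2) T holomorphic_map_std[OF f c] smooth_form_alternating[OF \<alpha> c] smooth_form_C1(1)[OF \<alpha> c]
  show "continuous_on (f -` fst c) (\<lambda>z. frechet_derivative (b v) (at z) u)"
    unfolding b_def D_def
    by (rule pullback_derivative_continuous[OF *]) (assumption | rule smooth_form_C1(3)[OF \<alpha> c])+
  assume z: "z \<in> ?S"
  show "(\<Sum>i\<le>k. (-1) ^ i * frechet_derivative (b (skip i v)) (at z) (v i)) =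
      ext_deriv k (\<alpha> c) (snd c (f z)) (\<lambda>j. D z (v j))"
    unfolding b_def D_def using ext_deriv_pullback[OF * z, of v] by simp
  have "(b v has_derivative frechet_derivative (b v) (at z)) (at z)"
    unfolding b_def D_def using pullback_has_derivative[OF * z, of v] frechet_derivative_at
    by (metis (no_types, lifting))
  then show "((\<lambda>z. pullback A f \<alpha> std_chart z v) has_derivative frechet_derivative (b v) (at z)) (at z)"
    by (rule has_derivative_transform_within_open[OF _ S z])
      (simp add: b_def D_def pullback_eq_chart[OF \<alpha> c])
qed

lemma pullback_differentiable:
  assumes \<alpha>: "smooth_form A k \<alpha>"
  shows "((\<lambda>z. pullback A f \<alpha> std_chart z v) has_derivative frechet_derivative (\<lambda>z. pullback A f \<alpha> std_chart z v) (at z)) (at z)"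
  using pullback_local(2)[OF \<alpha> chart_at_in(1)[OF A, of "f z"], of z v] chart_at_in(2)[OF A, of "f z"]
    by (simp add: frechet_derivative_works[symmetric] differentiable_def) blast

lemma pullback_form_derivative_continuous:
  assumes \<alpha>: "smooth_form A k \<alpha>"
  shows "continuous_on UNIV (\<lambda>z. frechet_derivative (\<lambda>z. pullback A f \<alpha> std_chart z v) (at z) u)"
proof (rule continuous_on_local)
  fix z0
  let ?c = "chart_at A (f z0)"
  note ch = chart_at_in[OF A, of "f z0"]
  note l = pullback_local[OF \<alpha> ch(1)]
  have "continuous_on (f -` fst ?c) (\<lambda>z. frechet_derivative (\<lambda>z. pullback A f \<alpha> std_chart z v) (at z) u)"
    by (rule iffD1[OF continuous_on_cong[OF refl] l(4)[of v u]]) (rule fun_cong[OF frechet_derivative_at[OF l(2)]])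
  then show "\<exists>W. open W \<and> z0 \<in> W \<and> continuous_on W (\<lambda>z. frechet_derivative (\<lambda>z. pullback A f \<alpha> std_chart z v) (at z) u)"
    using l(1) ch(2) by blast
qed

lemma ext_deriv_pullback_form:
  assumes \<alpha>: "smooth_form A k \<alpha>" and c: "c \<in> A" "f z \<in> fst c"
  shows "ext_deriv k (pullback A f \<alpha> std_chart) z v =
      ext_deriv k (\<alpha> c) (snd c (f z)) (\<lambda>j. frechet_derivative (snd c \<circ> f) (at z) (v j))"
proof -
  note l = pullback_local[OF \<alpha> c(1)]
  have z: "z \<in> f -` fst c" using c by simp
  have "ext_deriv k (pullback A f \<alpha> std_chart) z v = (\<Sum>i\<le>k. (-1) ^ i *
      frechet_derivative (\<lambda>z. \<alpha> c ((snd c \<circ> f) z) (\<lambda>j. frechet_derivative (snd c \<circ> f) (at z) (skip i v j))) (at z) (v i))"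
    unfolding ext_deriv_def by (simp only: frechet_derivative_at[OF l(2)[OF z], symmetric])
  then show ?thesis using l(3)[OF z, of v] by simp
qed

end

text \<open>The differentiability part of the inverse function theorem: a continuous
  \<open>\<psi>\<close> is recovered from \<open>P \<circ> \<psi>\<close> when the derivative of
  \<open>P\<close> has a left inverse. A Lipschitz bound on \<open>\<psi>\<close> at
  \<open>z\<close> comes out of the first-order estimate and is fed back into it.\<close>

lemma has_derivative_of_composite:
  fixes \<psi> :: "'a::real_normed_vector \<Rightarrow> 'b::real_normed_vector" and P :: "'b \<Rightarrow> 'c::real_normed_vector"
  assumes P: "(P has_derivative L) (at (\<psi> z))" and F: "(F has_derivative F') (at z)"
    and M: "bounded_linear M" "\<And>v. M (L v) = v" and \<psi>: "isCont \<psi> z"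
    and S: "open S" "z \<in> S" "\<And>x. x \<in> S \<Longrightarrow> P (\<psi> x) = F x"
  shows "(\<psi> has_derivative (\<lambda>h. M (F' h))) (at z)"
  unfolding has_derivative_at_alt
proof (intro conjI allI impI)
  have blF: "bounded_linear F'" using F by (rule has_derivative_bounded_linear)
  show "bounded_linear (\<lambda>h. M (F' h))" by (rule bounded_linear_compose[OF M(1) blF])
  fix e :: real assume e: "e > 0"
  obtain B where B: "B > 0" "\<And>x. norm (M x) \<le> norm x * B" using bounded_linear.pos_bounded[OF M(1)] by blast
  obtain C where C: "C > 0" "\<And>x. norm (F' x) \<le> norm x * C" using bounded_linear.pos_bounded[OF blF] by blast
  \<comment> \<open>The Lipschitz constant of \<open>\<psi>\<close> at \<open>z\<close>:
    \<open>B\<close> bounds \<open>M\<close>, \<open>C + 1\<close> the growth of \<open>F\<close>,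
    and 2 comes from absorbing half of \<open>norm k\<close>.\<close>
  define K where "K = 2 * B * (C + 1)"
  have K: "K > 0" using B C by (simp add: K_def)
  \<comment> \<open>The first bound permits the absorption, the second makes the remainder of
    \<open>P\<close> at most \<open>e / 2\<close> once \<open>norm k\<close> is bounded by
    \<open>K\<close>.\<close>
  define e1 where "e1 = min (1 / (2 * B)) (e / (2 * B * K))"
  have e1: "e1 > 0" "B * e1 \<le> 1 / 2" "B * e1 * K \<le> e / 2"
  proof -
    show "e1 > 0" using e B K by (simp add: e1_def)
    have "B * e1 \<le> B * (1 / (2 * B))" using B by (intro mult_left_mono) (auto simp: e1_def)
    then show "B * e1 \<le> 1 / 2" using B by simp
    have "B * e1 * K \<le> B * (e / (2 * B * K)) * K" using B K by (intro mult_right_mono mult_left_mono) (auto simp: e1_def)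
    then show "B * e1 * K \<le> e / 2" using B K by (simp add: field_simps)
  qed
  define e2 where "e2 = min 1 (e / (2 * B))"
  have e2: "e2 > 0" "e2 \<le> 1" "B * e2 \<le> e / 2"
  proof -
    show "e2 > 0" "e2 \<le> 1" using e B by (auto simp: e2_def)
    have "B * e2 \<le> B * (e / (2 * B))" using B by (intro mult_left_mono) (auto simp: e2_def)
    then show "B * e2 \<le> e / 2" using B by simp
  qed
  obtain d1 where d1: "d1 > 0" "\<And>y. norm (y - \<psi> z) < d1 \<Longrightarrow> norm (P y - P (\<psi> z) - L (y - \<psi> z)) \<le> e1 * norm (y - \<psi> z)"
    using P e1(1) unfolding has_derivative_at_alt by blast
  obtain d2 where d2: "d2 > 0" "\<And>x. norm (x - z) < d2 \<Longrightarrow> norm (F x - F z - F' (x - z)) \<le> e2 * norm (x - z)"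
    using F e2(1) unfolding has_derivative_at_alt by blast
  obtain d3 where d3: "d3 > 0" "\<And>x. dist x z < d3 \<Longrightarrow> dist (\<psi> x) (\<psi> z) < d1"
    using \<psi> d1(1) unfolding continuous_at_eps_delta by blast
  obtain d4 where d4: "d4 > 0" "ball z d4 \<subseteq> S" using S openE by blast
  show "\<exists>d>0. \<forall>x. norm (x - z) < d \<longrightarrow> norm (\<psi> x - \<psi> z - M (F' (x - z))) \<le> e * norm (x - z)"
  proof (intro exI[of _ "min d2 (min d3 d4)"] conjI allI impI)
    fix x assume x: "norm (x - z) < min d2 (min d3 d4)"
    then have "x \<in> S" using d4 by (auto simp: dist_norm norm_minus_commute)
    define k where "k = \<psi> x - \<psi> z"
    have "norm (P (\<psi> x) - P (\<psi> z) - L k) \<le> e1 * norm k"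
      unfolding k_def using x d3(2)[of x] by (intro d1(2)) (simp add: dist_norm)
    then have 1: "norm (F x - F z - L k) \<le> e1 * norm k" using S(2,3) \<open>x \<in> S\<close> by simp
    have "M (F x - F z - L k) = M (F x - F z) - k"
      using M by (simp add: linear_diff[OF bounded_linear.linear])
    then have "norm (M (F x - F z) - k) \<le> norm (F x - F z - L k) * B" using B(2) by metis
    also have "\<dots> \<le> e1 * norm k * B" using 1 B by (intro mult_right_mono) auto
    finally have 2: "norm (M (F x - F z) - k) \<le> B * e1 * norm k" by (simp add: mult_ac)
    have 3: "norm (F x - F z - F' (x - z)) \<le> e2 * norm (x - z)" using x by (intro d2(2)) simp
    have "norm (F x - F z) \<le> norm (F' (x - z)) + norm (F x - F z - F' (x - z))"
      by (metis norm_triangle_sub)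
    also have "\<dots> \<le> norm (x - z) * C + 1 * norm (x - z)"
      using 3 C(2)[of "x - z"] mult_right_mono[OF e2(2), of "norm (x - z)"] by (intro add_mono) auto
    finally have "norm (F x - F z) * B \<le> ((C + 1) * norm (x - z)) * B"
      using B by (intro mult_right_mono) (auto simp: algebra_simps)
    then have 4: "norm (M (F x - F z)) \<le> (C + 1) * norm (x - z) * B" using B(2)[of "F x - F z"] by linarith
    have "norm k \<le> norm (M (F x - F z)) + norm (M (F x - F z) - k)"
      by (metis norm_triangle_sub norm_minus_commute)
    also have "norm (M (F x - F z) - k) \<le> 1 / 2 * norm k"
      using 2 mult_right_mono[OF e1(2), of "norm k"] by simp
    finally have "norm k \<le> 2 * ((C + 1) * norm (x - z) * B)" using 4 by linarith
    also have "\<dots> = K * norm (x - z)" by (simp add: K_def)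
    finally have "norm k \<le> K * norm (x - z)" .
    then have "B * e1 * norm k \<le> B * e1 * (K * norm (x - z))" using B e1 by (intro mult_left_mono) auto
    also have "\<dots> \<le> e / 2 * norm (x - z)" using mult_right_mono[OF e1(3), of "norm (x - z)"] by (simp add: mult_ac)
    finally have 5: "norm (M (F x - F z) - k) \<le> e / 2 * norm (x - z)" using 2 by linarith
    have "M (F x - F z - F' (x - z)) = M (F x - F z) - M (F' (x - z))"
      using M by (simp add: linear_diff[OF bounded_linear.linear])
    then have "norm (M (F x - F z) - M (F' (x - z))) \<le> norm (F x - F z - F' (x - z)) * B" using B(2) by metis
    also have "\<dots> \<le> e2 * norm (x - z) * B" using 3 B by (intro mult_right_mono) auto
    also have "\<dots> \<le> e / 2 * norm (x - z)" using mult_right_mono[OF e2(3), of "norm (x - z)"] by (simp add: mult_ac)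
    finally have 6: "norm (M (F x - F z) - M (F' (x - z))) \<le> e / 2 * norm (x - z)" .
    have "\<psi> x - \<psi> z - M (F' (x - z)) = (M (F x - F z) - M (F' (x - z))) - (M (F x - F z) - k)"
      by (simp add: k_def)
    then have "norm (\<psi> x - \<psi> z - M (F' (x - z))) \<le> norm (M (F x - F z) - M (F' (x - z))) + norm (M (F x - F z) - k)"
      by (metis norm_triangle_ineq4)
    then show "norm (\<psi> x - \<psi> z - M (F' (x - z))) \<le> e * norm (x - z)" using 5 6 by linarith
  qed (use d2 d3 d4 in auto)
qed

text \<open>In charts \<open>\<pi> \<circ> g = f\<close> with invertible differential of
  \<open>\<pi>\<close>. Hence \<open>g\<close> has the derivative of \<open>f\<close> followed by
  that inverse, and the inverse of a complex linear bijection is complex linear.\<close>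

lemma lift_holomorphic:
  fixes A :: "('x::{t2_space, second_countable_topology}, 'n::finite) chart set"
    and B :: "('y::{t2_space, second_countable_topology}, 'n) chart set" and f :: "complex ^ 'm::finite \<Rightarrow> 'x"
  assumes A: "complex_atlas A" and f: "holomorphic_map {std_chart} A f" and cov: "universal_covering B A \<pi>"
    and g: "continuous_on UNIV g" "\<And>z. \<pi> (g z) = f z"
  shows "holomorphic_map {std_chart} B g"
proof -
  have B: "complex_atlas B" and \<pi>: "holomorphic_map B A \<pi>"
    and bij: "\<And>c c' y. c \<in> B \<Longrightarrow> c' \<in> A \<Longrightarrow> y \<in> fst c \<Longrightarrow> \<pi> y \<in> fst c' \<Longrightarrow> bij (differential c c' \<pi> (snd c y))"
    using cov unfolding universal_covering_def by blast+
  have "holomorphic_vec_on (snd c \<circ> g) (g -` fst c)" if c: "c \<in> B" for c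
    unfolding holomorphic_vec_on_def
  proof
    fix z assume z: "z \<in> g -` fst c"
    define c' where "c' = chart_at A (f z)"
    have c': "c' \<in> A" "f z \<in> fst c'" using chart_at_in[OF A, of "f z"] by (auto simp: c'_def)
    let ?P = "snd c' \<circ> \<pi> \<circ> chart_inv c" and ?F = "snd c' \<circ> f"
    note at = atlas_chart[OF B c]
    have hP: "holomorphic_vec_on ?P (snd c ` (fst c \<inter> \<pi> -` fst c'))"
      using \<pi> c c' unfolding holomorphic_map_def by blast
    have mem: "snd c (g z) \<in> snd c ` (fst c \<inter> \<pi> -` fst c')" using z c' g(2) by auto
    define L where "L = frechet_derivative ?P (at (snd c (g z)))"
    have L: "(?P has_derivative L) (at (snd c (g z)))" "Vector_Spaces.linear (*s) (*s) L"
      unfolding L_def using holomorphic_vec_has_derivative[OF hP mem] by auto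
    have "bij L" unfolding L_def using bij[OF c c'(1), of "g z"] z c' g(2) by (simp add: differential_def)
    define M where "M = inv L"
    have invs: "M (L v) = v" "L (M v) = v" for v
      using \<open>bij L\<close> by (auto simp: M_def bij_def surj_f_inv_f)
    interpret L: Vector_Spaces.linear "(*s)" "(*s)" L by (rule L(2))
    have Mlin: "Vector_Spaces.linear (*s) (*s) M"
    proof -
      have "M (x + y) = M x + M y" for x y
        using invs(1)[of "M x + M y"] by (simp add: L.add invs(2))
      moreover have "M (r *s x) = r *s M x" for r x
        using invs(1)[of "r *s M x"] by (simp add: L.scale invs(2))
      ultimately show ?thesis
        by (simp add: Vector_Spaces.linear_iff vec.vector_space_axioms)
    qed
    let ?D = "frechet_derivative ?F (at z)"
    have F: "(?F has_derivative ?D) (at z)" "Vector_Spaces.linear (*s) (*s) ?D"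
      using holomorphic_vec_has_derivative[OF holomorphic_map_std[OF f c'(1)], of z] c' by auto
    have "((snd c \<circ> g) has_derivative (\<lambda>h. M (?D h))) (at z)"
    proof (rule has_derivative_of_composite[where P="?P" and L=L and M=M and F="?F" and F'="?D" and S="g -` fst c \<inter> f -` fst c'"])
      show "(?F has_derivative ?D) (at z)" by (rule F(1))
      show "(?P has_derivative L) (at ((snd c \<circ> g) z))" using L(1) by simp
      show "bounded_linear M" using complex_linear_linear(1)[OF Mlin] by (simp add: linear_conv_bounded_linear)
      show "open (g -` fst c \<inter> f -` fst c')"
        using g(1) holomorphic_map_continuous[OF f] at(1) atlas_chart(1)[OF A c'(1)] by (intro open_Int open_vimage) auto
      have "continuous_on (g -` fst c) (snd c \<circ> g)"
        using at(3) g(1) by (intro continuous_on_compose) (auto intro: continuous_on_subset)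
      then show "isCont (snd c \<circ> g) z"
        using z g(1) at(1) by (subst (asm) continuous_on_eq_continuous_at) (auto intro: open_vimage)
      show "?P ((snd c \<circ> g) x) = ?F x" if "x \<in> g -` fst c \<inter> f -` fst c'" for x
        using that at(4)[of "g x"] g(2)[of x] by simp
    qed (use invs z c' in auto)
    moreover have "Vector_Spaces.linear (*s) (*s) (\<lambda>h. M (?D h))"
      using Vector_Spaces.linear_compose[OF F(2) Mlin] by (simp add: o_def)
    ultimately show "\<exists>L. ((snd c \<circ> g) has_derivative L) (at z) \<and> Vector_Spaces.linear (*s) (*s) L" by blast
  qed
  moreover have "snd c \<circ> g \<circ> chart_inv std_chart = snd c \<circ> g" for c :: "('y, 'n) chart" by (simp add: fun_eq_iff chart_inv_std)
  moreover have "snd std_chart ` (fst std_chart \<inter> g -` fst c) = g -` fst c" for c :: "('y, 'n) chart" by (simp add: std_chart_def)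
  ultimately have "holomorphic_vec_on (snd c \<circ> g \<circ> chart_inv std_chart) (snd std_chart ` (fst std_chart \<inter> g -` fst c))"
    if "c \<in> B" for c
    using that by (simp only:)
  then show ?thesis using g(1) unfolding holomorphic_map_def by blast
qed

lemma wedge_power_fact_compose:
  "wedge_power_fact m w (\<lambda>j. T (v j)) = wedge_power_fact m (\<lambda>v. w (\<lambda>j. T (v j))) v"
  by (simp add: wedge_power_fact_def wedge_prod_compose)

text \<open>The complex linear factor contributes \<open>\<i>\<close>, the conjugate linear one
  \<open>- \<i>\<close>.\<close>

lemma form_1_1_i_smult:
  assumes "a \<in> forms_of_type 1 1"
  shows "a (\<lambda>j. \<i> *s v j) = a v"
  using assms
proof induction
  case zero
  show ?case by simp
next
  case (add a \<theta> c)
  interpret \<theta>0: Vector_Spaces.linear "(*s)" "(*)" "\<theta> 0" by (rule add(2)) simp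
  interpret \<theta>1: Vector_Spaces.linear "(*s)" "(*)" "\<lambda>u. cnj (\<theta> 1 u)" by (rule add(3)) simp_all
  have 0: "\<theta> 0 (\<i> *s u) = \<i> * \<theta> 0 u" for u by (rule \<theta>0.scale)
  have "cnj (\<theta> 1 (\<i> *s u)) = \<i> * cnj (\<theta> 1 u)" for u by (rule \<theta>1.scale)
  then have 1: "\<theta> 1 (\<i> *s u) = - \<i> * \<theta> 1 u" for u
    by (metis complex_cnj_cnj complex_cnj_i complex_cnj_mult)
  have "wedge_prod 1 (\<lambda>i. covector (\<theta> i)) (1 + 1) (\<lambda>j. \<i> *s v j) = wedge_prod 1 (\<lambda>i. covector (\<theta> i)) (1 + 1) v"
    by (simp add: wedge_def covector_def 0 1[unfolded One_nat_def] mult_ac sum_distrib_left[symmetric] sum_divide_distrib[symmetric])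
  then show ?case using add by simp
qed

lemma hermitian_metric_semipositive:
  assumes \<omega>: "hermitian_metric A \<omega>" and c: "c \<in> A" "y \<in> chart_image c"
  shows "semipositive_form (\<omega> c y)" "pos_def (bilin_of (\<omega> c y))"
proof -
  show pd: "pos_def (bilin_of (\<omega> c y))" using \<omega> c unfolding hermitian_metric_def by blast
  have alt: "alternating_form 2 (\<omega> c y)"
    using \<omega> c unfolding hermitian_metric_def smooth_form_of_type_def smooth_form_def by (simp add: numeral_2_eq_2)
  have "\<omega> c y \<in> forms_of_type 1 1" "\<forall>v. \<omega> c y v \<in> \<real>"
    using \<omega> c unfolding hermitian_metric_def smooth_form_of_type_def real_form_def by blast+
  moreover have "bilin_of (\<omega> c y) 0 0 = 0" using linear_0[OF bilin_linear(1)[OF alt]] .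
  then have "0 \<le> bilin_of (\<omega> c y) u u" for u
    using pd by (cases "u = 0") (auto simp: pos_def_def less_imp_le)
  ultimately show "semipositive_form (\<omega> c y)"
    using alt form_1_1_i_smult unfolding semipositive_form_def by blast
qed

section \<open>Pullback and comparison of metrics\<close>

lemma bilin_of_compose:
  assumes "\<And>u. L (\<i> *s u) = \<i> *s L u"
  shows "bilin_of (\<lambda>v. a (\<lambda>j. L (v j))) u v = bilin_of a (L u) (L v)"
  unfolding bilin_of_def using assms by (intro arg_cong[where f=Re] arg_cong[where f=a]) auto

lemma hermitian_metric_smooth: "hermitian_metric A \<omega> \<Longrightarrow> smooth_form A 2 \<omega>"
  by (simp add: hermitian_metric_def smooth_form_of_type_def numeral_2_eq_2)

context
  fixes A :: "('x::{t2_space, second_countable_topology}, 'n::finite) chart set" and f :: "complex ^ 'm::finite \<Rightarrow> 'x"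
  assumes A: "complex_atlas A" and f: "holomorphic_map {std_chart} A f"
begin

lemma pullback_metric_bilin:
  assumes \<omega>: "hermitian_metric A \<omega>" and c: "c \<in> A" "f z \<in> fst c"
  shows "bilin_of (pullback A f \<omega> std_chart z) u v =
    bilin_of (\<omega> c (snd c (f z))) (frechet_derivative (snd c \<circ> f) (at z) u) (frechet_derivative (snd c \<circ> f) (at z) v)"
proof -
  have "Vector_Spaces.linear (*s) (*s) (frechet_derivative (snd c \<circ> f) (at z))"
    using holomorphic_vec_has_derivative(2)[OF holomorphic_map_std[OF f c(1)]] c by auto
  note L = bilin_of_compose[where L="frechet_derivative (snd c \<circ> f) (at z)", OF complex_linear_linear(2)[OF this]]
  have "pullback A f \<omega> std_chart z = (\<lambda>v. \<omega> c (snd c (f z)) (\<lambda>j. frechet_derivative (snd c \<circ> f) (at z) (v j)))"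
    by (rule ext) (rule pullback_eq_chart[OF A f hermitian_metric_smooth[OF \<omega>] c])
  then show ?thesis by (simp only: L)
qed

lemma pullback_metric_semipositive:
  assumes \<omega>: "hermitian_metric A \<omega>"
  shows "semipositive_form (pullback A f \<omega> std_chart z)"
proof -
  let ?c = "chart_at A (f z)"
  note ch = chart_at_in[OF A, of "f z"]
  have y: "snd ?c (f z) \<in> chart_image ?c" using atlas_chart(5)[OF A ch(1)] ch(2) .
  note sp = hermitian_metric_semipositive(1)[OF \<omega> ch(1) y]
  have "Vector_Spaces.linear (*s) (*s) (frechet_derivative (snd ?c \<circ> f) (at z))"
    using holomorphic_vec_has_derivative(2)[OF holomorphic_map_std[OF f ch(1)]] ch by auto
  note L = complex_linear_linear(2)[OF this]
  have eq: "pullback A f \<omega> std_chart z v = \<omega> ?c (snd ?c (f z)) (\<lambda>j. frechet_derivative (snd ?c \<circ> f) (at z) (v j))" for v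
    by (rule pullback_eq_chart[OF A f hermitian_metric_smooth[OF \<omega>] ch])
  have "pullback A f \<omega> std_chart z (\<lambda>j. \<i> *s v j) = pullback A f \<omega> std_chart z v" for v
    unfolding eq L using sp by (simp add: semipositive_form_def)
  moreover have "pullback A f \<omega> std_chart z v \<in> \<real>" for v
    unfolding eq using sp unfolding semipositive_form_def by blast
  ultimately show ?thesis
    unfolding semipositive_form_def pullback_metric_bilin[OF \<omega> ch]
    using pullback_multilinear[OF A f hermitian_metric_smooth[OF \<omega>]] sp
    unfolding semipositive_form_def by blast
qed

lemma pullback_metric_pos_def:
  assumes \<omega>: "hermitian_metric A \<omega>" and nd: "nondegenerate_at A f z"
  shows "pos_def (bilin_of (pullback A f \<omega> std_chart z))"
proof -
  let ?c = "chart_at A (f z)"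
  note ch = chart_at_in[OF A, of "f z"]
  have y: "snd ?c (f z) \<in> chart_image ?c" using atlas_chart(5)[OF A ch(1)] ch(2) .
  note pd = hermitian_metric_semipositive(2)[OF \<omega> ch(1) y]
  have "inj (frechet_derivative (snd ?c \<circ> f) (at z))"
    using nd ch unfolding nondegenerate_at_def differential_std by blast
  moreover have "linear (frechet_derivative (snd ?c \<circ> f) (at z))"
    using holomorphic_vec_has_derivative(2)[OF holomorphic_map_std[OF f ch(1)]] ch complex_linear_linear(1) by auto
  ultimately have "frechet_derivative (snd ?c \<circ> f) (at z) v \<noteq> 0" if "v \<noteq> 0" for v
    using that by (metis linear_injective_0)
  then show ?thesis using pd unfolding pos_def_def pullback_metric_bilin[OF \<omega> ch] by blast
qed

end

text \<open>The quotient of two metrics is continuous, hence bounded on a compact manifold.\<close>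

lemma hermitian_metrics_comparable:
  fixes A :: "('x::{t2_space, second_countable_topology}, 'n::finite) chart set"
  assumes A: "complex_atlas A" and X: "compact (UNIV :: 'x set)"
    and \<omega>: "hermitian_metric A \<omega>" "hermitian_metric A \<omega>'"
  obtains K where "K > 0" "\<And>c x v. c \<in> A \<Longrightarrow> x \<in> fst c \<Longrightarrow>
    bilin_of (\<omega>' c (snd c x)) v v \<le> K * bilin_of (\<omega> c (snd c x)) v v"
proof -
  define le where "le K x \<longleftrightarrow> (\<forall>c\<in>A. x \<in> fst c \<longrightarrow> (\<forall>v.
    bilin_of (\<omega>' c (snd c x)) v v \<le> K * bilin_of (\<omega> c (snd c x)) v v))" for K x
  have "\<exists>W K. open W \<and> x \<in> W \<and> K > 0 \<and> (\<forall>x'\<in>W. le K x')" for x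
  proof -
    let ?c = "chart_at A x"
    note ch = chart_at_in[OF A, of x]
    note at = atlas_chart[OF A ch(1)]
    obtain r where r: "r > 0" "cball (snd ?c x) r \<subseteq> chart_image ?c"
      using at(2,5) ch(2) open_contains_cball by metis
    \<comment> \<open>Compact base times unit sphere: the quotient of the two quadratic forms is
      continuous here and homogeneity does the rest.\<close>
    let ?S = "cball (snd ?c x) r \<times> sphere (0 :: complex ^ 'n) 1"
    have cont: "continuous_on ?S (\<lambda>p. bilin_of (\<alpha> ?c (fst p)) (snd p) (snd p))" if \<alpha>: "hermitian_metric A \<alpha>" for \<alpha>
    proof -
      have "continuous_on ?S (\<lambda>p. \<alpha> ?c (fst p) (\<lambda>j. if j = 0 then snd p else \<i> *s snd p))"
      proof (rule multilinear_continuous[where a="\<alpha> ?c" and k=2 and T="chart_image ?c"])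
        show "multilinear_form 2 (\<alpha> ?c y)" if "y \<in> chart_image ?c" for y
          by (intro alternating_multilinear semipositive_alternating hermitian_metric_semipositive[OF \<alpha> ch(1) that])
        show "continuous_on (chart_image ?c) (\<lambda>y. \<alpha> ?c y v)" for v
          by (rule smooth_form_C1(2)[OF hermitian_metric_smooth[OF \<alpha>] ch(1)])
        show "fst ` ?S \<subseteq> chart_image ?c" using r by auto
        have "continuous_on ?S (\<lambda>p. \<i> *s snd p)"
          using linear_continuous_on_compose[OF continuous_on_snd linear_i_smult] continuous_on_id by blast
        then show "continuous_on ?S (\<lambda>p. if j = 0 then snd p else \<i> *s snd p)" for j :: nat
          by (cases "j = 0") (auto intro!: continuous_intros)
      qed (intro continuous_intros)
      then show ?thesis unfolding bilin_of_def by (intro continuous_intros)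
    qed
    have pos: "0 < bilin_of (\<omega> ?c (fst p)) (snd p) (snd p)" if "p \<in> ?S" for p
    proof -
      have "pos_def (bilin_of (\<omega> ?c (fst p)))"
        using that r by (intro hermitian_metric_semipositive[OF \<omega>(1) ch(1)]) auto
      moreover have "norm (snd p) = 1" using that by (simp add: mem_Times_iff)
      then have "snd p \<noteq> 0" by auto
      ultimately show ?thesis by (simp add: pos_def_def)
    qed
    let ?q = "\<lambda>p. bilin_of (\<omega>' ?c (fst p)) (snd p) (snd p) / bilin_of (\<omega> ?c (fst p)) (snd p) (snd p)"
    have "continuous_on ?S ?q"
      by (intro continuous_on_divide cont \<omega> ballI) (rule less_imp_neq[OF pos, symmetric])
    then have "compact (?q ` ?S)" by (intro compact_continuous_image compact_Times) auto
    then have "bounded (?q ` ?S)" by (rule compact_imp_bounded)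
    then obtain K where K: "\<forall>y\<in>?q ` ?S. \<bar>y\<bar> \<le> K" unfolding bounded_real by blast
    define K' where "K' = max K 1"
    have sph: "bilin_of (\<omega>' ?c y) v v \<le> K' * bilin_of (\<omega> ?c y) v v" if "y \<in> cball (snd ?c x) r" "norm v = 1" for y v
    proof -
      have p: "(y, v) \<in> ?S" using that by simp
      then have "\<bar>?q (y, v)\<bar> \<le> K" using K by blast
      then have "?q (y, v) \<le> K'" unfolding K'_def by linarith
      then show ?thesis using pos[OF p] by (simp add: divide_le_eq)
    qed
    have main: "bilin_of (\<omega>' ?c y) v v \<le> K' * bilin_of (\<omega> ?c y) v v" if y: "y \<in> cball (snd ?c x) r" for y v
    proof (cases "v = 0")
      case True
      have y': "y \<in> chart_image ?c" using y r by auto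
      have "bilin_of (\<alpha> ?c y) 0 0 = 0" if "hermitian_metric A \<alpha>" for \<alpha>
        by (rule linear_0[OF bilin_linear(1)]) (rule semipositive_alternating[OF hermitian_metric_semipositive(1)[OF that ch(1) y']])
      then show ?thesis using True \<omega> by simp
    next
      case False
      have y': "y \<in> chart_image ?c" using y r by auto
      note sp = hermitian_metric_semipositive(1)[OF \<omega>(1) ch(1) y'] hermitian_metric_semipositive(1)[OF \<omega>(2) ch(1) y']
      have v: "v = norm v *\<^sub>R sgn v" using False by (simp add: sgn_div_norm)
      have "bilin_of (\<omega>' ?c y) (sgn v) (sgn v) \<le> K' * bilin_of (\<omega> ?c y) (sgn v) (sgn v)"
        using False by (intro sph y) (simp add: norm_sgn)
      then have "(norm v)\<^sup>2 * bilin_of (\<omega>' ?c y) (sgn v) (sgn v) \<le> (norm v)\<^sup>2 * (K' * bilin_of (\<omega> ?c y) (sgn v) (sgn v))"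
        by (intro mult_left_mono) auto
      then show ?thesis
        by (subst (1 2 3 4) v) (simp add: bilin_scale[OF sp(1)] bilin_scale[OF sp(2)] power2_eq_square mult_ac)
    qed
    let ?W = "fst ?c \<inter> snd ?c -` ball (snd ?c x) r"
    have "open ?W" using at(1,3) by (intro continuous_open_preimage) auto
    moreover have "x \<in> ?W" using ch r by simp
    moreover have "le K' x'" if x': "x' \<in> ?W" for x'
      unfolding le_def
    proof (intro ballI impI allI)
      fix c v assume c: "c \<in> A" "x' \<in> fst c"
      \<comment> \<open>In any other chart both metrics are evaluated at the image of
        \<open>v\<close> under the same coordinate change, so the estimate carries over.\<close>
      let ?D = "differential c ?c (\<lambda>x. x) (snd c x')"
      have "holomorphic_vec_on (snd ?c \<circ> chart_inv c) (snd c ` (fst c \<inter> fst ?c))"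
        using A c ch unfolding complex_atlas_def by blast
      then have "Vector_Spaces.linear (*s) (*s) (frechet_derivative (snd ?c \<circ> chart_inv c) (at (snd c x')))"
        by (rule holomorphic_vec_has_derivative(2)) (use c x' in auto)
      then have "Vector_Spaces.linear (*s) (*s) ?D" by (simp add: differential_def o_def)
      note L = bilin_of_compose[where L="?D", OF complex_linear_linear(2)[OF this]]
      have eq: "bilin_of (\<alpha> c (snd c x')) v v = bilin_of (\<alpha> ?c (snd ?c x')) (?D v) (?D v)" if "hermitian_metric A \<alpha>" for \<alpha>
      proof -
        have "\<alpha> c (snd c x') = (\<lambda>v. \<alpha> ?c (snd ?c x') (\<lambda>j. ?D (v j)))"
          using hermitian_metric_smooth[OF that] c ch x' unfolding smooth_form_def by (intro ext) blast
        then show ?thesis by (simp only: L)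
      qed
      show "bilin_of (\<omega>' c (snd c x')) v v \<le> K' * bilin_of (\<omega> c (snd c x')) v v"
        unfolding eq[OF \<omega>(1)] eq[OF \<omega>(2)] using x' by (intro main) auto
    qed
    ultimately show ?thesis by (intro exI[of _ ?W] exI[of _ K']) (auto simp: K'_def)
  qed
  then obtain W K where WK: "\<And>x. open (W x)" "\<And>x. x \<in> W x" "\<And>x. K x > 0" "\<And>x x'. x' \<in> W x \<Longrightarrow> le (K x) x'" by metis
  obtain C where C: "finite C" "UNIV \<subseteq> (\<Union>x\<in>C. W x)"
    by (rule compactE_image[OF X, of UNIV W]) (use WK in auto)
  define K0 where "K0 = (\<Sum>x\<in>C. K x) + 1"
  have "(\<Sum>x\<in>C. K x) \<ge> 0" using WK by (intro sum_nonneg) (auto simp: less_imp_le)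
  then have "K0 > 0" by (simp add: K0_def)
  moreover have "bilin_of (\<omega>' c (snd c x)) v v \<le> K0 * bilin_of (\<omega> c (snd c x)) v v" if c: "c \<in> A" "x \<in> fst c" for c x v
  proof -
    obtain x0 where x0: "x0 \<in> C" "x \<in> W x0" using C by blast
    have "bilin_of (\<omega>' c (snd c x)) v v \<le> K x0 * bilin_of (\<omega> c (snd c x)) v v"
      using WK(4)[OF x0(2)] c unfolding le_def by blast
    also have "\<dots> \<le> K0 * bilin_of (\<omega> c (snd c x)) v v"
    proof (rule mult_right_mono)
      have "K x0 \<le> (\<Sum>x\<in>C. K x)" using x0 C WK by (intro member_le_sum) (auto simp: less_imp_le)
      then show "K x0 \<le> K0" by (simp add: K0_def)
      show "0 \<le> bilin_of (\<omega> c (snd c x)) v v"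
        using hermitian_metric_semipositive(1)[OF \<omega>(1) c(1) atlas_chart(5)[OF A c]] unfolding semipositive_form_def by blast
    qed
    finally show ?thesis .
  qed
  ultimately show thesis by (rule that)
qed

section \<open>Growth of the volume\<close>

text \<open>Lets the sum over \<open>Basis\<close> in the divergence theorem be matched with the
  indexed sum in \<open>ext_deriv\<close>.\<close>

lemma std_frame_bij: "bij_betw std_frame {..<2 * CARD('q::finite)} (Basis :: (complex ^ 'q) set)"
proof -
  have "card (std_frame ` {..<2 * CARD('q)} :: (complex ^ 'q) set) = 2 * CARD('q)"
    by (rule adapted_frame_independent(2)[OF semipositive_flat_form std_frame_adapted])
  then have inj: "inj_on (std_frame :: nat \<Rightarrow> complex ^ 'q) {..<2 * CARD('q)}"
    by (simp add: inj_on_iff_eq_card)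
  have sub: "std_frame ` {..<2 * CARD('q)} \<subseteq> (Basis :: (complex ^ 'q) set)"
    by (auto simp: std_frame_def axis_in_Basis_iff Basis_complex_def)
  have "std_frame ` {..<2 * CARD('q)} = (Basis :: (complex ^ 'q) set)"
    by (rule card_subset_eq[OF finite_Basis sub]) (simp add: card_image[OF inj])
  with inj show ?thesis by (simp add: bij_betw_def)
qed

lemma sum_Basis_std_frame: "(\<Sum>b\<in>Basis. F b) = (\<Sum>i<2 * CARD('q). F (std_frame i :: complex ^ 'q::finite))"
  by (rule sum.reindex_bij_betw[OF std_frame_bij, symmetric])

lemma colength_power2:
  assumes w: "semipositive_form w" and pd: "pos_def (bilin_of w)" and l: "linear l"
  shows "(colength (bilin_of w) l)\<^sup>2 = l (sharp (bilin_of w) l)"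
    "(colength (bilin_of w) l)\<^sup>2 = bilin_of w (sharp (bilin_of w) l) (sharp (bilin_of w) l)"
  using sharp_eq[OF w pd l, of "sharp (bilin_of w) l"] bilin_nonneg[OF w, of "sharp (bilin_of w) l"]
  by (simp_all add: colength_def)

text \<open>Nonnegativity on \<open>u\<close> minus its projection to the dual vector. With equality
  at the dual vector it describes the length of a covector as a supremum.\<close>

lemma colength_Cauchy_Schwarz:
  assumes w: "semipositive_form w" and pd: "pos_def (bilin_of w)" and l: "linear l"
  shows "(l u)\<^sup>2 \<le> (colength (bilin_of w) l)\<^sup>2 * bilin_of w u u"
proof -
  let ?X = "sharp (bilin_of w) l"
  define q where "q = bilin_of w ?X ?X"
  have X: "bilin_of w ?X v = l v" for v by (rule sharp_eq[OF w pd l])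
  have q: "(colength (bilin_of w) l)\<^sup>2 = q" unfolding q_def by (rule colength_power2(2)[OF assms])
  show ?thesis
  proof (cases "q = 0")
    case True
    then have "l u = 0" using bilin_degenerate[OF w, of ?X u] X by (simp add: q_def)
    then show ?thesis by (simp add: q True)
  next
    case False
    then have qp: "q > 0" using bilin_nonneg[OF w, of ?X] by (simp add: q_def)
    have "0 \<le> bilin_of w (u - (l u / q) *\<^sub>R ?X) (u - (l u / q) *\<^sub>R ?X)" by (rule bilin_nonneg[OF w])
    also have "\<dots> = bilin_of w u u - 2 * (l u / q) * l u + (l u / q)\<^sup>2 * q"
      using bilin_sym[OF w, of u ?X] X[of u]
      by (simp add: bilin_diff[OF w] bilin_scale[OF w] q_def[symmetric] power2_eq_square algebra_simps)
    also have "\<dots> = bilin_of w u u - (l u)\<^sup>2 / q" using qp by (simp add: power2_eq_square field_simps)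
    finally show ?thesis using qp by (simp add: q field_simps)
  qed
qed

section \<open>The length of \<open>d\<tau>\<close> and the density of
  \<open>d\<tau> \<and> \<star>d\<tau>\<close>\<close>

lemma wedge_scale_left: "wedge k l (\<lambda>v. c * a v) b v = c * wedge k l a b v"
  by (simp add: wedge_def sum_distrib_left mult_ac)

lemma d_tau_length_pos:
  assumes w: "semipositive_form (w z)" and pd: "pos_def (bilin_of (w z))" and z: "z \<noteq> 0"
  shows "d_tau_length w z > 0"
proof -
  have "d_tau z z \<noteq> 0" using z by (simp add: d_tau_eq)
  from sharp_frame[OF w pd linear_d_tau this] have "colength (bilin_of (w z)) (d_tau z) > 0" by metis
  then show ?thesis using pd by (simp add: d_tau_length_def)
qed

text \<open>The factor \<open>|d\<tau>|\<close> undoes the normalisation inside the star and leaves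
  \<open>\<star>d\<tau>\<close>.\<close>

lemma area_form_eq:
  fixes w :: "complex ^ 'q \<Rightarrow> 'q::finite covec"
  assumes w: "semipositive_form (w z)" and pd: "pos_def (bilin_of (w z))" and z: "z \<noteq> 0"
  shows "of_real (d_tau_length w z) * area_form w z v =
    wedge_power_fact CARD('q) (w z) (case_nat (sharp (bilin_of (w z)) (d_tau z)) v)"
proof -
  let ?g = "bilin_of (w z)" and ?L = "d_tau_length w z" and ?A = "wedge_power_fact CARD('q) (w z)"
  let ?X = "sharp ?g (d_tau z)"
  have L: "?L > 0" by (rule d_tau_length_pos[of w z, OF assms])
  have lin: "linear (\<lambda>u. d_tau z u / ?L)" by (simp add: linear_iff d_tau_eq inner_add_right add_divide_distrib)
  have "sharp ?g (\<lambda>u. d_tau z u / ?L) = (1 / ?L) *\<^sub>R ?X"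
    by (rule sharp_unique[OF w pd lin]) (simp add: bilin_scale[OF w] sharp_eq[OF w pd linear_d_tau])
  then have "area_form w z v = ?A (case_nat ((1 / ?L) *\<^sub>R ?X) v)"
    using pd by (simp add: area_form_def star_covector_def)
  also have "case_nat ((1 / ?L) *\<^sub>R ?X) v = (case_nat ?X v)(0 := (1 / ?L) *\<^sub>R ?X)"
    by (auto simp: fun_eq_iff split: nat.split)
  also have "?A \<dots> = (1 / ?L) *\<^sub>R ?A ((case_nat ?X v)(0 := ?X))"
    by (rule linear_scale[OF alternating_linear[OF alternating_wedge_power_fact[OF semipositive_alternating[OF w]]]]) simp
  also have "(case_nat ?X v)(0 := ?X) = case_nat ?X v"
    by (auto simp: fun_eq_iff split: nat.split)
  finally show ?thesis using L by (simp add: scaleR_conv_of_real)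
qed

text \<open>The density of \<open>d\<tau> \<and> \<star>d\<tau>\<close>, which is what the first
  growth condition controls on spheres.\<close>

definition energy_density :: "(complex ^ 'q \<Rightarrow> 'q::finite covec) \<Rightarrow> complex ^ 'q \<Rightarrow> real" where
  "energy_density w z = (d_tau_length w z)\<^sup>2 * volume_density (w z)"

text \<open>The Euclidean unit conormal is \<open>d\<tau> / (2 |z|)\<close>, so the integrand
  reduces to \<open>star_flux\<close>.\<close>

lemma sphere_integrand_eq:
  fixes w :: "complex ^ 'q \<Rightarrow> 'q::finite covec"
  assumes w: "semipositive_form (w z)"
  shows "wedge 1 (2 * CARD('q) - 1) (covector (\<lambda>u. of_real (sgn z \<bullet> u)))
      (\<lambda>v. of_real (d_tau_length w z) * area_form w z v) std_frame = of_real (energy_density w z / (2 * norm z))"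
proof (cases "pos_def (bilin_of (w z)) \<and> z \<noteq> 0")
  case False
  then show ?thesis by (auto simp: wedge_def covector_def energy_density_def d_tau_length_def)
next
  case True
  then have pd: "pos_def (bilin_of (w z))" and z: "z \<noteq> 0" by auto
  have "sgn z \<bullet> u = 1 / (2 * norm z) * d_tau z u" for u
    by (simp add: d_tau_eq sgn_div_norm inverse_eq_divide)
  then have "covector (\<lambda>u. complex_of_real (sgn z \<bullet> u)) = (\<lambda>v. of_real (1 / (2 * norm z)) * covector (\<lambda>u. of_real (d_tau z u)) v)"
    by (simp only: covector_def of_real_mult)
  moreover have "energy_density w z = (colength (bilin_of (w z)) (d_tau z))\<^sup>2 * volume_density (w z)"
    using pd by (simp add: energy_density_def d_tau_length_def)
  ultimately show ?thesis
    unfolding area_form_eq[where w=w and z=z, OF w pd z]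
    by (simp only: wedge_scale_left star_flux[OF w pd linear_d_tau] of_real_mult[symmetric]) simp
qed

text \<open>On the open set where \<open>w\<close> is nondegenerate, the length of \<open>d\<tau>\<close> is a supremum of continuous functions,
  hence lower semicontinuous.\<close>

lemma borel_measurable_d_tau_length:
  fixes w :: "complex ^ 'q \<Rightarrow> 'q::finite covec"
  assumes w: "\<And>z. semipositive_form (w z)" and cont: "\<And>v. continuous_on UNIV (\<lambda>z. w z v)"
    and cv: "continuous_on UNIV (\<lambda>z. volume_density (w z))"
  shows "d_tau_length w \<in> borel_measurable borel"
proof -
  have L0: "d_tau_length w z \<ge> 0" for z
    using bilin_nonneg[OF w] by (simp add: d_tau_length_def colength_def)
  have pd: "pos_def (bilin_of (w z)) \<longleftrightarrow> volume_density (w z) > 0" for z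
    using volume_density_pos[OF w, of z] wedge_power_degenerate[OF w, of z]
    by (cases "pos_def (bilin_of (w z))") (auto simp: volume_density_def)
  have "open {z. a < d_tau_length w z}" if a: "a \<ge> 0" for a
  proof -
    have "{z. a < d_tau_length w z} = {z. 0 < volume_density (w z)} \<inter>
        (\<Union>u. {z. a\<^sup>2 * bilin_of (w z) u u < (d_tau z u)\<^sup>2})" (is "?A = ?B")
    proof (intro set_eqI iffI)
      fix z assume "z \<in> ?A"
      then have az: "a < d_tau_length w z" by simp
      then have p: "pos_def (bilin_of (w z))" using a by (auto simp: d_tau_length_def split: if_splits)
      define X where "X = sharp (bilin_of (w z)) (d_tau z)"
      have L: "(d_tau_length w z)\<^sup>2 = d_tau z X" "(d_tau_length w z)\<^sup>2 = bilin_of (w z) X X"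
        unfolding X_def using colength_power2[OF w p linear_d_tau] p by (simp_all add: d_tau_length_def)
      have "a\<^sup>2 < (d_tau_length w z)\<^sup>2" using az a by (intro power_strict_mono) auto
      then have "a\<^sup>2 * (d_tau_length w z)\<^sup>2 < (d_tau_length w z)\<^sup>2 * (d_tau_length w z)\<^sup>2"
        using az a by (intro mult_strict_right_mono) auto
      then have "a\<^sup>2 * bilin_of (w z) X X < (d_tau z X)\<^sup>2" using L by (simp add: power2_eq_square)
      then show "z \<in> ?B" using p pd by auto
    next
      fix z assume "z \<in> ?B"
      then obtain u where p: "pos_def (bilin_of (w z))" and u: "a\<^sup>2 * bilin_of (w z) u u < (d_tau z u)\<^sup>2"
        using pd by auto
      have "a\<^sup>2 * bilin_of (w z) u u < (d_tau_length w z)\<^sup>2 * bilin_of (w z) u u"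
        using u colength_Cauchy_Schwarz[OF w p linear_d_tau, of z u] p by (simp add: d_tau_length_def)
      then have "a\<^sup>2 < (d_tau_length w z)\<^sup>2"
        using bilin_nonneg[OF w, of z u] by (simp add: mult_less_cancel_right)
      then have "a < d_tau_length w z" using L0 by (rule power_less_imp_less_base)
      then show "z \<in> ?A" by simp
    qed
    moreover have "open {z. a\<^sup>2 * bilin_of (w z) u u < (d_tau z u)\<^sup>2}" for u
      unfolding bilin_of_def d_tau_eq by (intro open_Collect_less continuous_intros cont)
    moreover have "open {z. 0 < volume_density (w z)}"
      by (intro open_Collect_less continuous_intros cv)
    ultimately show ?thesis by (metis (no_types, lifting) open_Int open_UN)
  qed
  then have "{z. a < d_tau_length w z} \<in> sets borel" for a
  proof (cases "a \<ge> 0")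
    case False
    then have "{z. a < d_tau_length w z} = UNIV" using L0 by (auto intro: less_le_trans[of a 0])
    then show ?thesis by simp
  qed (auto intro: borel_open)
  then show ?thesis unfolding borel_measurable_iff_greater by simp
qed

lemma continuous_volume_density:
  fixes w :: "complex ^ 'q \<Rightarrow> 'q::finite covec"
  assumes w: "\<And>z. semipositive_form (w z)" and cont: "\<And>v. continuous_on UNIV (\<lambda>z. w z v)"
  shows "continuous_on UNIV (\<lambda>z. volume_density (w z))"
  unfolding volume_density_def wedge_power_fact_expand[OF semipositive_alternating[OF w]]
  by (intro continuous_intros cont) auto

lemma bilin_of_bounded:
  fixes w :: "complex ^ 'q \<Rightarrow> 'q::finite covec"
  assumes w: "\<And>z. semipositive_form (w z)" and cont: "\<And>v. continuous_on UNIV (\<lambda>z. w z v)"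
  obtains M where "\<And>z u v. norm z \<le> R \<Longrightarrow> norm u = 1 \<Longrightarrow> norm v = 1 \<Longrightarrow> \<bar>bilin_of (w z) u v\<bar> \<le> M"
proof -
  let ?S = "cball (0 :: complex ^ 'q) R \<times> sphere (0 :: complex ^ 'q) 1 \<times> sphere (0 :: complex ^ 'q) 1"
  have "continuous_on ?S (\<lambda>p. w (fst p) (\<lambda>j. if j = 0 then fst (snd p) else \<i> *s snd (snd p)))"
  proof (rule multilinear_continuous[where a=w and k=2 and T=UNIV])
    show "multilinear_form 2 (w z)" for z by (rule alternating_multilinear[OF semipositive_alternating[OF w]])
    have "continuous_on ?S (\<lambda>p. \<i> *s snd (snd p))"
      by (rule linear_continuous_on_compose[where f="\<lambda>p. snd (snd p)", OF _ linear_i_smult]) (intro continuous_intros)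
    then show "continuous_on ?S (\<lambda>p. if j = 0 then fst (snd p) else \<i> *s snd (snd p))" for j :: nat
      by (cases "j = 0") (auto intro!: continuous_intros)
  qed (auto intro!: continuous_intros cont)
  then have "continuous_on ?S (\<lambda>p. bilin_of (w (fst p)) (fst (snd p)) (snd (snd p)))"
    unfolding bilin_of_def by (intro continuous_intros)
  then have "compact ((\<lambda>p. bilin_of (w (fst p)) (fst (snd p)) (snd (snd p))) ` ?S)"
    by (intro compact_continuous_image compact_Times) auto
  then have "bounded ((\<lambda>p. bilin_of (w (fst p)) (fst (snd p)) (snd (snd p))) ` ?S)" by (rule compact_imp_bounded)
  then obtain M where M: "\<forall>y\<in>(\<lambda>p. bilin_of (w (fst p)) (fst (snd p)) (snd (snd p))) ` ?S. \<bar>y\<bar> \<le> M"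
    unfolding bounded_real by blast
  show thesis
  proof (rule that)
    fix z u v :: "complex ^ 'q" assume "norm z \<le> R" "norm u = 1" "norm v = 1"
    then have "(z, u, v) \<in> ?S" by simp
    then have "(\<lambda>p. bilin_of (w (fst p)) (fst (snd p)) (snd (snd p))) (z, u, v) \<in> (\<lambda>p. bilin_of (w (fst p)) (fst (snd p)) (snd (snd p))) ` ?S"
      by (rule imageI)
    then show "\<bar>bilin_of (w z) u v\<bar> \<le> M" using M by auto
  qed
qed

text \<open>Supplies integrability over spheres; the length of \<open>d\<tau>\<close> alone may be
  unbounded near degenerate points.\<close>

lemma energy_density_bounded:
  fixes w :: "complex ^ 'q \<Rightarrow> 'q::finite covec"
  assumes w: "\<And>z. semipositive_form (w z)" and cont: "\<And>v. continuous_on UNIV (\<lambda>z. w z v)"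
  obtains K where "\<And>z. norm z \<le> R \<Longrightarrow> \<bar>energy_density w z\<bar> \<le> K"
proof -
  obtain M where M: "\<And>z u v. norm z \<le> R \<Longrightarrow> norm u = 1 \<Longrightarrow> norm v = 1 \<Longrightarrow> \<bar>bilin_of (w z) u v\<bar> \<le> M"
    using bilin_of_bounded[OF assms] by metis
  define M' where "M' = max M (2 * \<bar>R\<bar>)"
  define K where "K = 2 * \<bar>R\<bar> * (fact (2 * CARD('q)) * M' ^ CARD('q))"
  have M'0: "M' \<ge> 0" by (simp add: M'_def le_max_iff_disj)
  have K0: "K \<ge> 0" using M'0 by (simp add: K_def)
  have ge: "0 \<le> energy_density w z" for z
    using volume_density_nonneg[OF w] by (simp add: energy_density_def)
  have "energy_density w z \<le> K" if z: "norm z \<le> R" for z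
  proof (cases "pos_def (bilin_of (w z)) \<and> z \<noteq> 0")
    case True
    have "energy_density w z = (colength (bilin_of (w z)) (d_tau z))\<^sup>2 * volume_density (w z)"
      using True by (simp add: energy_density_def d_tau_length_def)
    also have "\<dots> \<le> 2 * norm z * (fact (2 * CARD('q)) * M' ^ CARD('q))"
    proof (rule star_flux_le[OF w])
      show "\<bar>bilin_of (w z) u v\<bar> \<le> M'" if "norm u = 1" "norm v = 1" for u v
        using M[OF z that] by (simp add: M'_def)
      have "norm z \<le> \<bar>R\<bar>" using z by linarith
      then show "2 * norm z \<le> M'" by (simp add: M'_def le_max_iff_disj)
    qed (use True in auto)
    also have "\<dots> \<le> K" unfolding K_def using z M'0 by (intro mult_right_mono) auto
    finally show ?thesis .
  next
    case False
    have "d_tau_length w z = 0 \<or> volume_density (w z) = 0"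
    proof (cases "pos_def (bilin_of (w z))")
      case True
      then have z0: "z = 0" using False by simp
      have "(d_tau_length w z)\<^sup>2 = d_tau z (sharp (bilin_of (w z)) (d_tau z))"
        using colength_power2(1)[OF w True linear_d_tau] True by (simp add: d_tau_length_def)
      then show ?thesis by (simp add: z0 d_tau_eq)
    qed (simp add: d_tau_length_def)
    then show ?thesis using K0 by (auto simp: energy_density_def)
  qed
  then show thesis using ge that[of K] by simp
qed

section \<open>Integrals over balls and spheres, and exponential growth\<close>

lemma volume_of_ball_eq:
  assumes w: "\<And>z. semipositive_form (w z)"
  shows "volume_of_ball w r = (LINT z:ball 0 r|lborel. volume_density (w z))"
proof -
  have "ball_integral r (\<lambda>z. wedge_power_fact CARD('a) (w z)) = (LINT z|lborel. of_real (indicator (ball 0 r) z * volume_density (w z)))"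
    unfolding ball_integral_def set_lebesgue_integral_def
    by (intro Bochner_Integration.integral_cong) (simp_all add: wedge_power_eq_volume_density[OF w] scaleR_conv_of_real)
  also have "\<dots> = of_real (LINT z|lborel. indicator (ball 0 r) z * volume_density (w z))"
    by (rule integral_complex_of_real)
  finally show ?thesis by (simp add: volume_of_ball_def set_lebesgue_integral_def)
qed

lemma sphere_integral_eq:
  fixes w :: "complex ^ 'q \<Rightarrow> 'q::finite covec"
  assumes w: "\<And>z. semipositive_form (w z)" and t: "0 < t"
  shows "Re (sphere_integral t (\<lambda>z v. of_real (d_tau_length w z) * area_form w z v)) =
    sphere_mean t (energy_density w) / (2 * t)"
proof -
  \<comment> \<open>Settles \<open>x = 0\<close>, where \<open>t *\<^sub>R sgn x\<close> is the
    origin instead of a point of the sphere.\<close>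
  have e0: "energy_density w 0 = 0"
  proof (cases "pos_def (bilin_of (w 0))")
    case True
    have "(d_tau_length w 0)\<^sup>2 = d_tau 0 (sharp (bilin_of (w 0)) (d_tau 0))"
      using colength_power2(1)[OF w True linear_d_tau] True by (simp add: d_tau_length_def)
    then show ?thesis by (simp add: energy_density_def d_tau_eq)
  qed (simp add: energy_density_def d_tau_length_def)
  have n: "energy_density w (t *\<^sub>R sgn x) / (2 * norm (t *\<^sub>R sgn x)) = energy_density w (t *\<^sub>R sgn x) / (2 * t)" for x
    using t e0 by (cases "x = 0") (auto simp: norm_sgn)
  have "(LINT x:ball (0::complex ^ 'q) 1|lborel. complex_of_real (energy_density w (t *\<^sub>R sgn x) / (2 * norm (t *\<^sub>R sgn x)))) =
      (LINT x|lborel. complex_of_real (indicator (ball 0 1) x * (energy_density w (t *\<^sub>R sgn x) / (2 * t))))"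
    unfolding set_lebesgue_integral_def n by (simp add: scaleR_conv_of_real)
  also have "\<dots> = of_real (LINT x|lborel. indicator (ball 0 1) x * (energy_density w (t *\<^sub>R sgn x) / (2 * t)))"
    by (rule integral_complex_of_real)
  also have "(LINT x|lborel. indicator (ball 0 1) x * (energy_density w (t *\<^sub>R sgn x) / (2 * t))) =
      (LINT x:ball 0 1|lborel. energy_density w (t *\<^sub>R sgn x)) / (2 * t)"
    unfolding set_lebesgue_integral_def by simp
  finally have "sphere_integral t (\<lambda>z v. of_real (d_tau_length w z) * area_form w z v) =
      of_real (real DIM(complex ^ 'q) * t ^ (DIM(complex ^ 'q) - 1)) *
      of_real ((LINT x:ball 0 1|lborel. energy_density w (t *\<^sub>R sgn x)) / (2 * t))"
    unfolding sphere_integral_def sphere_surface_integral_def sphere_integrand_eq[OF w] by simp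
  then show ?thesis by (simp add: sphere_mean_def del: DIM_cart of_real_mult of_real_divide add: of_real_mult[symmetric])
qed

text \<open>Since \<open>V \<le> C * V'\<close>, the product \<open>V t * exp (- t / C)\<close> is
  nondecreasing, so \<open>V\<close> dominates \<open>c * exp (t / C)\<close>. The last unit
  interval of integration gives the same rate for the integral, and \<open>b / C - ln F\<close>
  stays bounded above.\<close>

lemma exponential_growth_Limsup:
  fixes V V' :: "real \<Rightarrow> real"
  assumes der: "\<And>t. 0 < t \<Longrightarrow> (V has_real_derivative V' t) (at t)" and mono: "mono V" and nonneg: "\<And>t. 0 \<le> V t"
    and pos: "0 < V t0" and C: "0 < C" and le: "\<And>t. r0 < t \<Longrightarrow> V t \<le> C * V' t"
  shows "Limsup at_top (\<lambda>b. ereal (b / C - ln (LINT t:{0..b}|lborel. V t))) \<noteq> \<infinity>"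
proof -
  \<comment> \<open>Beyond \<open>t0\<close> the volume is positive, beyond \<open>r0\<close> the
    inequality holds, and \<open>V\<close> is differentiable at positive radii.\<close>
  define t1 where "t1 = max t0 (max (r0 + 1) 1)"
  have t1: "t0 \<le> t1" "r0 < t1" "0 < t1" by (auto simp: t1_def)
  have "V t1 > 0" using pos monoD[OF mono t1(1)] by linarith
  define c where "c = V t1 * exp (- t1 / C)"
  have c: "c > 0" using \<open>V t1 > 0\<close> by (simp add: c_def)
  have lower: "c * exp (t / C) \<le> V t" if t: "t1 \<le> t" for t
  proof -
    have "V t1 * exp (- t1 / C) \<le> V t * exp (- t / C)"
    proof (rule DERIV_nonneg_imp_nondecreasing[OF t])
      fix x assume x: "t1 \<le> x" "x \<le> t"
      have "((\<lambda>t. V t * exp (- t / C)) has_real_derivative V' x * exp (- x / C) + exp (- x / C) * (- 1 / C) * V x) (at x)"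
        by (rule DERIV_mult[OF der]) (use x t1 C in \<open>auto intro!: derivative_eq_intros\<close>)
      moreover have "0 \<le> V' x * exp (- x / C) + exp (- x / C) * (- 1 / C) * V x"
      proof -
        have "V x / C \<le> V' x" using le[of x] x t1 C by (simp add: divide_le_eq mult.commute)
        then have "0 \<le> exp (- x / C) * (V' x - V x / C)" by simp
        then show ?thesis by (simp add: algebra_simps)
      qed
      ultimately show "\<exists>y. ((\<lambda>t. V t * exp (- t / C)) has_real_derivative y) (at x) \<and> 0 \<le> y" by blast
    qed
    then have "c * exp (t / C) \<le> V t * exp (- t / C) * exp (t / C)"
      unfolding c_def by (intro mult_right_mono) auto
    also have "\<dots> = V t" by (simp add: mult.assoc flip: exp_add)
    finally show ?thesis .
  qed
  have F: "c * exp ((b - 1) / C) \<le> (LINT t:{0..b}|lborel. V t)" if b: "t1 + 1 \<le> b" for b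
  proof -
    define k where "k = c * exp ((b - 1) / C)"
    have k: "k > 0" using c by (simp add: k_def)
    have int: "set_integrable lborel {0..b} V"
      unfolding set_integrable_def
    proof (rule integrableI_bounded_set[where A="{0..b}" and B="V b"])
      show "(\<lambda>x. indicator {0..b} x *\<^sub>R V x) \<in> borel_measurable lborel"
        using borel_measurable_mono[OF mono] by (intro borel_measurable_scaleR borel_measurable_indicator) auto
    qed (use b t1 nonneg monoD[OF mono] in auto)
    have "(LINT t|lborel. indicator {b - 1..b} t *\<^sub>R k) \<le> (LINT t|lborel. indicator {0..b} t *\<^sub>R V t)"
    proof (rule integral_mono)
      show "integrable lborel (\<lambda>t. indicator {0..b} t *\<^sub>R V t)" using int by (simp add: set_integrable_def)
      fix t :: real
      have "k \<le> V t" if t: "b - 1 \<le> t"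
      proof -
        have "k \<le> c * exp (t / C)" unfolding k_def using t C c by (simp add: divide_right_mono)
        also have "\<dots> \<le> V t" using t b by (intro lower) linarith
        finally show ?thesis .
      qed
      then show "indicator {b - 1..b} t *\<^sub>R k \<le> indicator {0..b} t *\<^sub>R V t"
        using nonneg[of t] b t1 by (auto split: split_indicator)
    qed simp
    then show ?thesis by (simp add: set_lebesgue_integral_def k_def)
  qed
  have "eventually (\<lambda>b. ereal (b / C - ln (LINT t:{0..b}|lborel. V t)) \<le> ereal (1 / C - ln c)) at_top"
    using eventually_ge_at_top[of "t1 + 1"]
  proof eventually_elim
    case (elim b)
    have "ln c + (b - 1) / C = ln (c * exp ((b - 1) / C))" using c by (simp add: ln_mult)
    also have "\<dots> \<le> ln (LINT t:{0..b}|lborel. V t)"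
      using F[OF elim] c by (intro ln_mono) (auto intro: less_le_trans[OF _ F[OF elim]])
    finally show ?case by (simp add: diff_divide_distrib)
  qed
  then have "Limsup at_top (\<lambda>b. ereal (b / C - ln (LINT t:{0..b}|lborel. V t))) \<le> ereal (1 / C - ln c)"
    by (rule Limsup_bounded)
  then show ?thesis by auto
qed

lemma integral_ball_pos:
  fixes V :: "'a::euclidean_space \<Rightarrow> real"
  assumes V: "continuous_on UNIV V" "\<And>x. 0 \<le> V x" and x0: "0 < V x0"
  shows "0 < (LINT x:ball 0 (norm x0 + 1)|lborel. V x)"
proof -
  have "open {x. V x0 / 2 < V x}" by (intro open_Collect_less continuous_intros V)
  then obtain d where d: "d > 0" "ball x0 d \<subseteq> {x. V x0 / 2 < V x}" by (rule openE[of _ x0]) (use x0 in auto)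
  define d' where "d' = min d 1"
  have d': "d' > 0" using d by (simp add: d'_def)
  have "0 < measure lborel (ball x0 d') * (V x0 / 2)" using x0 d' content_ball_pos[of d' x0] by simp
  also have "\<dots> = (LINT x|lborel. indicator (ball x0 d') x *\<^sub>R (V x0 / 2))"
    using emeasure_bounded_finite[of "ball x0 d'"] by simp
  also have "\<dots> \<le> (LINT x|lborel. indicator (ball 0 (norm x0 + 1)) x *\<^sub>R V x)"
  proof (rule integral_mono)
    show "integrable lborel (\<lambda>x. indicator (ball 0 (norm x0 + 1)) x *\<^sub>R V x)"
      using set_integrable_ball_continuous[OF V(1)] by (simp add: set_integrable_def)
    show "integrable lborel (\<lambda>x. indicator (ball x0 d') x *\<^sub>R (V x0 / 2))"
      using emeasure_bounded_finite[of "ball x0 d'"] by simp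
    fix x
    have "V x0 / 2 < V x \<and> norm x < norm x0 + 1" if "x \<in> ball x0 d'"
    proof
      show "V x0 / 2 < V x" using that d by (auto simp: d'_def)
      have "norm x \<le> norm x0 + dist x0 x" by (metis dist_norm norm_minus_commute norm_triangle_sub)
      then show "norm x < norm x0 + 1" using that by (auto simp: d'_def)
    qed
    then show "indicator (ball x0 d') x *\<^sub>R (V x0 / 2) \<le> indicator (ball 0 (norm x0 + 1)) x *\<^sub>R V x"
      using V(2)[of x] by (auto split: split_indicator)
  qed
  finally show ?thesis by (simp add: set_lebesgue_integral_def)
qed

lemma mono_integral_ball:
  fixes V :: "'a::euclidean_space \<Rightarrow> real"
  assumes V: "continuous_on UNIV V" "\<And>x. 0 \<le> V x"
  shows "mono (\<lambda>t. LINT x:ball 0 t|lborel. V x)"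
proof (rule monoI)
  fix s t :: real assume "s \<le> t"
  then show "(LINT x:ball 0 s|lborel. V x) \<le> (LINT x:ball 0 t|lborel. V x)"
    unfolding set_lebesgue_integral_def
    using set_integrable_ball_continuous[OF V(1)] V(2)
    by (intro integral_mono) (auto simp: set_integrable_def split: split_indicator)
qed

lemma has_real_derivative_along:
  fixes F :: "'a::real_normed_vector \<Rightarrow> complex"
  assumes "(F has_derivative F') (at x)"
  shows "((\<lambda>h. Re (c * F (x + h *\<^sub>R u))) has_real_derivative Re (c * F' u)) (at 0)"
proof -
  have "((\<lambda>h. x + h *\<^sub>R u) has_derivative (\<lambda>h. h *\<^sub>R u)) (at 0)"
    by (auto intro!: derivative_eq_intros)
  moreover have "(F has_derivative F') (at (x + 0 *\<^sub>R u))" using assms by simp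
  ultimately have "((\<lambda>h. F (x + h *\<^sub>R u)) has_derivative (\<lambda>h. F' (h *\<^sub>R u))) (at 0)"
    by (rule has_derivative_compose)
  then have "((\<lambda>h. Re (c * F (x + h *\<^sub>R u))) has_derivative (\<lambda>h. Re (c * F' (h *\<^sub>R u)))) (at 0)"
    by (intro has_derivative_Re has_derivative_mult_right)
  moreover have "Re (c * F' (h *\<^sub>R u)) = Re (c * F' u) * h" for h
    unfolding linear_scale[OF has_derivative_linear[OF assms]] by simp
  ultimately show ?thesis unfolding has_field_derivative_def by (simp only:)
qed

lemma sphere_mean_cmult: "sphere_mean t (\<lambda>x. k * f x) = k * sphere_mean t f"
  by (simp add: sphere_mean_def)

lemma sphere_mean_add:
  assumes "set_integrable lborel (ball 0 1) (\<lambda>x. f (t *\<^sub>R sgn x))"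
    "set_integrable lborel (ball 0 1) (\<lambda>x. g (t *\<^sub>R sgn x))"
  shows "sphere_mean t (\<lambda>x. f x + g x) = sphere_mean t f + sphere_mean t g"
  using assms by (simp add: sphere_mean_def set_integral_add(2) distrib_left)

text \<open>Stokes' theorem on the ball, followed by \<open>2 L \<le> s L\<^sup>2 + 1 / s\<close> for the length \<open>L\<close> of \<open>d\<tau>\<close>.\<close>

lemma volume_le_sphere_mean:
  fixes w b :: "complex ^ 'q \<Rightarrow> 'q::finite covec"
  assumes w: "\<And>z. semipositive_form (w z)" and cont: "\<And>v. continuous_on UNIV (\<lambda>z. w z v)"
    and b: "\<And>z. alternating_form (2 * CARD('q) - 1) (b z)"
    and db: "\<And>z v. ((\<lambda>z. b z v) has_derivative frechet_derivative (\<lambda>z. b z v) (at z)) (at z)"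
    and cdb: "\<And>v u. continuous_on UNIV (\<lambda>z. frechet_derivative (\<lambda>z. b z v) (at z) u)"
    and bound: "\<And>z v. (\<And>j. j < 2 * CARD('q) - 1 \<Longrightarrow> bilin_of (w z) (v j) (v j) \<le> 1) \<Longrightarrow> cmod (b z v) \<le> C"
    and exact: "\<And>z. volume_density (w z) \<le> K * Re (ext_deriv (2 * CARD('q) - 1) b z std_frame)"
    and K: "K \<ge> 0" and t: "0 < t" and s: "0 < s"
  shows "2 * t * (LINT x:ball 0 t|lborel. volume_density (w x)) \<le>
    K * (C / (2 * pairing_const CARD('q)) *
      (s * sphere_mean t (energy_density w) + 1 / s * sphere_mean t (\<lambda>x. volume_density (w x))))"
proof -
  let ?e = "std_frame :: nat \<Rightarrow> complex ^ 'q" and ?n = "2 * CARD('q)"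
  let ?V = "\<lambda>x. volume_density (w x)"
  define \<kappa> where "\<kappa> = pairing_const CARD('q)"
  have \<kappa>: "\<kappa> > 0" by (simp add: \<kappa>_def pairing_const_pos)
  have n: "{..?n - 1} = {..<?n}"
    using zero_less_card_finite[where 'a='q] unfolding set_eq_iff atMost_iff lessThan_iff by arith
  have "0 \<le> cmod (b 0 (\<lambda>_. 0))" by simp
  also have "\<dots> \<le> C" by (rule bound) (simp add: linear_0[OF bilin_semipositive_linear(1)[OF w]])
  finally have C: "C \<ge> 0" .
  have cV: "continuous_on UNIV ?V" by (rule continuous_volume_density[OF w cont])
  \<comment> \<open>The index of a basis vector in \<open>std_frame\<close>.\<close>
  define \<iota> where "\<iota> = the_inv_into {..<?n} ?e"
  have \<iota>: "\<iota> (?e i) = i" if "i < ?n" for i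
    unfolding \<iota>_def using std_frame_bij[where 'q='q] that by (intro the_inv_into_f_f) (auto simp: bij_betw_def)
  \<comment> \<open>The vector field that corresponds to the form \<open>b\<close>: its divergence
    is \<open>Re (d b)\<close>, and its product with \<open>2 x\<close> is
    \<open>Re (d\<tau> \<and> b)\<close> on the frame.\<close>
  define f where "f u x = Re ((-1) ^ \<iota> u * b x (skip (\<iota> u) ?e))" for u x
  define D where "D u x = Re ((-1) ^ \<iota> u * frechet_derivative (\<lambda>z. b z (skip (\<iota> u) ?e)) (at x) u)" for u x
  define T where "T x = wedge 1 (?n - 1) (covector (\<lambda>u. of_real (d_tau x u))) (b x) ?e" for x
  have sumD: "(\<Sum>u\<in>Basis. D u x) = Re (ext_deriv (?n - 1) b x ?e)" for x
    by (simp add: sum_Basis_std_frame ext_deriv_def n[simplified] D_def \<iota>)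
  have sumf: "(\<Sum>u\<in>Basis. 2 * (x \<bullet> u) * f u x) = Re (T x)" for x
    unfolding T_def wedge_covector[OF b] n
    by (simp add: sum_Basis_std_frame f_def \<iota> d_tau_eq mult_ac)
  have cb: "continuous_on UNIV (\<lambda>z. b z v)" for v
    using db by (meson continuous_at_imp_continuous_on has_derivative_continuous)
  have div: "2 * t * (LINT x:ball 0 t|lborel. \<Sum>u\<in>Basis. D u x) = sphere_mean t (\<lambda>x. \<Sum>u\<in>Basis. 2 * (x \<bullet> u) * f u x)"
  proof (rule divergence_theorem_ball[OF _ _ _ t])
    show "continuous_on UNIV (f u)" for u unfolding f_def by (intro continuous_intros cb)
    show "continuous_on UNIV (D u)" for u unfolding D_def by (intro continuous_intros cdb)
    show "((\<lambda>h. f u (x + h *\<^sub>R u)) has_real_derivative D u x) (at 0)" for u x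
      unfolding f_def D_def by (rule has_real_derivative_along[OF db])
  qed
  have cD: "continuous_on UNIV (\<lambda>x. \<Sum>u\<in>Basis. D u x)" unfolding D_def by (intro continuous_intros cdb)
  have cT: "continuous_on UNIV (\<lambda>x. Re (T x))" unfolding sumf[symmetric] f_def by (intro continuous_intros cb)
  have "(LINT x:ball 0 t|lborel. ?V x) \<le> (LINT x:ball 0 t|lborel. K * (\<Sum>u\<in>Basis. D u x))"
    by (intro set_integral_mono set_integrable_ball_continuous cV cD continuous_on_mult_left) (simp only: sumD exact)
  then have 1: "(LINT x:ball 0 t|lborel. ?V x) \<le> K * (LINT x:ball 0 t|lborel. \<Sum>u\<in>Basis. D u x)" by simp
  have T: "cmod (T x) * \<kappa> \<le> C * (d_tau_length w x * ?V x)" for x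
  proof (cases "pos_def (bilin_of (w x))")
    case True
    then show ?thesis
      using flux_le[OF w True linear_d_tau b bound, of x x] by (simp add: T_def d_tau_length_def \<kappa>_def mult_ac)
  next
    case False
    have "T x = 0" unfolding T_def by (rule flux_degenerate[OF w False linear_d_tau b bound])
    then show ?thesis using False by (simp add: d_tau_length_def)
  qed
  \<comment> \<open>The parameter \<open>s\<close> is still free; it will depend on the
    radius.\<close>
  have Tle: "Re (T x) \<le> C / (2 * \<kappa>) * (s * energy_density w x + 1 / s * ?V x)" for x
  proof -
    let ?L = "d_tau_length w x"
    have "0 \<le> (s * ?L - 1)\<^sup>2 / s * ?V x" using s volume_density_nonneg[OF w] by simp
    also have "(s * ?L - 1)\<^sup>2 / s = s * ?L\<^sup>2 - 2 * ?L + 1 / s" using s by (simp add: power2_eq_square field_simps)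
    finally have "2 * (?L * ?V x) \<le> s * energy_density w x + 1 / s * ?V x"
      by (simp add: energy_density_def algebra_simps)
    then have "C / (2 * \<kappa>) * (2 * (?L * ?V x)) \<le> C / (2 * \<kappa>) * (s * energy_density w x + 1 / s * ?V x)"
      using C \<kappa> by (intro mult_left_mono) auto
    moreover have "Re (T x) \<le> C / (2 * \<kappa>) * (2 * (?L * ?V x))"
    proof -
      have "cmod (T x) \<le> C * (?L * ?V x) / \<kappa>" using T[of x] \<kappa> by (simp add: pos_le_divide_eq)
      then show ?thesis using complex_Re_le_cmod[of "T x"] by simp
    qed
    ultimately show ?thesis by linarith
  qed
  obtain R where R: "\<And>z. norm z \<le> t \<Longrightarrow> \<bar>energy_density w z\<bar> \<le> R"
    using energy_density_bounded[OF w cont] by metis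
  have mE: "energy_density w \<in> borel_measurable borel"
    unfolding energy_density_def[abs_def]
    using borel_measurable_d_tau_length[OF w cont cV] borel_measurable_continuous_onI[OF cV]
    by (intro borel_measurable_times borel_measurable_power)
  have iE: "set_integrable lborel (ball 0 1) (\<lambda>x. energy_density w (t *\<^sub>R sgn x))"
    by (rule set_integrable_sphere_bounded[OF mE]) (use R t in auto)
  have iV: "set_integrable lborel (ball 0 1) (\<lambda>x. ?V (t *\<^sub>R sgn x))"
    using set_integrable_sphere_continuous[OF cV] t by simp
  have isE: "set_integrable lborel (ball 0 1) (\<lambda>x. s * energy_density w (t *\<^sub>R sgn x))"
    "set_integrable lborel (ball 0 1) (\<lambda>x. 1 / s * ?V (t *\<^sub>R sgn x))"
    using iE iV by simp_all
  have "sphere_mean t (\<lambda>x. Re (T x)) \<le> sphere_mean t (\<lambda>x. C / (2 * \<kappa>) * (s * energy_density w x + 1 / s * ?V x))"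
  proof (rule sphere_mean_mono[OF _ _ _ Tle])
    show "set_integrable lborel (ball 0 1) (\<lambda>x. Re (T (t *\<^sub>R sgn x)))"
      using set_integrable_sphere_continuous[OF cT] t by simp
    show "set_integrable lborel (ball 0 1) (\<lambda>x. C / (2 * \<kappa>) * (s * energy_density w (t *\<^sub>R sgn x) + 1 / s * ?V (t *\<^sub>R sgn x)))"
      by (intro set_integrable_mult_right set_integral_add(1) isE)
  qed (use t in simp)
  also have "\<dots> = C / (2 * \<kappa>) * (s * sphere_mean t (energy_density w) + 1 / s * sphere_mean t ?V)"
    unfolding sphere_mean_cmult sphere_mean_add[OF isE] ..
  finally have 2: "sphere_mean t (\<lambda>x. Re (T x)) \<le> C / (2 * \<kappa>) * (s * sphere_mean t (energy_density w) + 1 / s * sphere_mean t ?V)" .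
  have "2 * t * (LINT x:ball 0 t|lborel. ?V x) \<le> 2 * t * (K * (LINT x:ball 0 t|lborel. \<Sum>u\<in>Basis. D u x))"
    using 1 t by (intro mult_left_mono) auto
  also have "\<dots> = K * sphere_mean t (\<lambda>x. Re (T x))" using div unfolding sumf by simp
  also have "\<dots> \<le> K * (C / (2 * \<kappa>) * (s * sphere_mean t (energy_density w) + 1 / s * sphere_mean t ?V))"
    using 2 K by (intro mult_left_mono)
  finally show ?thesis by (simp add: \<kappa>_def)
qed

lemma volume_growth:
  fixes w b :: "complex ^ 'q \<Rightarrow> 'q::finite covec"
  assumes w: "\<And>z. semipositive_form (w z)" and cont: "\<And>v. continuous_on UNIV (\<lambda>z. w z v)"
    and b: "\<And>z. alternating_form (2 * CARD('q) - 1) (b z)"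
    and db: "\<And>z v. ((\<lambda>z. b z v) has_derivative frechet_derivative (\<lambda>z. b z v) (at z)) (at z)"
    and cdb: "\<And>v u. continuous_on UNIV (\<lambda>z. frechet_derivative (\<lambda>z. b z v) (at z) u)"
    and bound: "\<And>z v. (\<And>j. j < 2 * CARD('q) - 1 \<Longrightarrow> bilin_of (w z) (v j) (v j) \<le> 1) \<Longrightarrow> cmod (b z v) \<le> C"
    and exact: "\<And>z. volume_density (w z) \<le> K * Re (ext_deriv (2 * CARD('q) - 1) b z std_frame)"
    and K: "K \<ge> 0"
    and growth: "\<And>t. r0 < t \<Longrightarrow>
      Re (sphere_integral t (\<lambda>z v. of_real (d_tau_length w z) * area_form w z v)) \<le> C1 * t * volume_of_ball w t"
    and C1: "0 < C1" and nd: "pos_def (bilin_of (w x0))"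
  shows "\<exists>C>0. Limsup at_top (\<lambda>r. ereal (r / C - ln (LINT t:{0..r}|lborel. volume_of_ball w t))) \<noteq> \<infinity>"
proof -
  let ?V = "\<lambda>x. volume_density (w x)"
  have V0: "0 \<le> ?V x" for x by (rule volume_density_nonneg[OF w])
  have cV: "continuous_on UNIV ?V" by (rule continuous_volume_density[OF w cont])
  define vol where "vol t = (LINT x:ball 0 t|lborel. ?V x)" for t
  have vol: "volume_of_ball w = vol" by (simp add: fun_eq_iff vol_def volume_of_ball_eq[OF w])
  have vol0: "0 \<le> vol t" for t
    unfolding vol_def set_lebesgue_integral_def using V0 by (intro Bochner_Integration.integral_nonneg) simp
  have mono: "mono vol" unfolding vol_def[abs_def] by (rule mono_integral_ball[OF cV V0])
  have pos: "0 < vol (norm x0 + 1)"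
    unfolding vol_def by (rule integral_ball_pos[OF cV V0 volume_density_pos[OF w nd]])
  \<comment> \<open>The summand 1 makes the constant strictly positive, so that \<open>s\<close> can
    be defined by division.\<close>
  define \<alpha> where "\<alpha> = K * (C / pairing_const CARD('q)) + 1"
  have "0 \<le> cmod (b 0 (\<lambda>_. 0))" by simp
  also have "\<dots> \<le> C" by (rule bound) (simp add: linear_0[OF bilin_semipositive_linear(1)[OF w]])
  finally have C: "C \<ge> 0" .
  have \<alpha>: "\<alpha> > 0" using K C pairing_const_pos[of "CARD('q)"] by (simp add: \<alpha>_def add_nonneg_pos)
  define C2 where "C2 = \<alpha>\<^sup>2 * C1 / 2"
  have C2: "C2 > 0" using \<alpha> C1 by (simp add: C2_def)
  have le: "vol t \<le> C2 * sphere_mean t ?V" if t: "max r0 0 < t" for t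
  proof -
    have tp: "0 < t" using t by simp
    \<comment> \<open>With this \<open>s\<close> the energy term is at most
      \<open>t * vol t\<close>, half of the left side, and \<open>1 / s\<close> produces the factor
      \<open>t\<close> that cancels in the end.\<close>
    define s where "s = 1 / (\<alpha> * C1 * t)"
    have s: "s > 0" using \<alpha> C1 tp by (simp add: s_def)
    let ?E = "sphere_mean t (energy_density w)" and ?A = "sphere_mean t ?V"
    have "?E / (2 * t) \<le> C1 * t * vol t"
      using growth[of t] t unfolding sphere_integral_eq[OF w tp] vol by simp
    then have E: "?E \<le> 2 * C1 * t\<^sup>2 * vol t" using tp by (simp add: divide_le_eq power2_eq_square mult_ac)
    have A: "0 \<le> ?A"
      unfolding sphere_mean_def set_lebesgue_integral_def using tp V0 by (intro mult_nonneg_nonneg Bochner_Integration.integral_nonneg) auto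
    have "2 * t * vol t \<le> K * (C / (2 * pairing_const CARD('q)) * (s * ?E + 1 / s * ?A))"
      unfolding vol_def by (rule volume_le_sphere_mean[OF w cont b db cdb bound exact K tp s])
    also have "\<dots> = (K * (C / pairing_const CARD('q))) * ((s * ?E + 1 / s * ?A) / 2)" by (simp add: mult_ac)
    also have "\<dots> \<le> (K * (C / pairing_const CARD('q))) * ((s * (2 * C1 * t\<^sup>2 * vol t) + 1 / s * ?A) / 2)"
      using E s K C pairing_const_pos[of "CARD('q)"]
      by (intro mult_left_mono divide_right_mono add_right_mono) auto
    also have "\<dots> \<le> \<alpha> * ((s * (2 * C1 * t\<^sup>2 * vol t) + 1 / s * ?A) / 2)"
      using vol0[of t] C1 s A by (intro mult_right_mono) (auto simp: \<alpha>_def)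
    also have "\<dots> = t * vol t + t * (C2 * ?A)"
      using \<alpha> C1 tp by (simp add: s_def C2_def power2_eq_square field_simps)
    finally have "t * vol t \<le> t * (C2 * ?A)" by linarith
    then show ?thesis using tp by simp
  qed
  have der: "(vol has_real_derivative sphere_mean t ?V) (at t)" if "0 < t" for t
    unfolding vol_def[abs_def] by (rule DERIV_integral_ball[OF cV that])
  show ?thesis
    unfolding vol using exponential_growth_Limsup[OF der mono vol0 pos C2 le] C2 by blast
qed

text \<open>Functoriality of the pullback along the lift. Both sides evaluate
  \<open>\<alpha>\<close> in the chart \<open>chart_at A (f z)\<close>, so the chain rule settles
  it.\<close>

lemma pullback_composite:
  fixes A :: "('x::{t2_space, second_countable_topology}, 'n::finite) chart set"
    and B :: "('y::{t2_space, second_countable_topology}, 'n) chart set" and f :: "complex ^ 'm::finite \<Rightarrow> 'x"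
  assumes A: "complex_atlas A" and B: "complex_atlas B" and \<pi>: "holomorphic_map B A \<pi>"
    and g: "holomorphic_map {std_chart} B g" "\<And>z. \<pi> (g z) = f z" and c: "c \<in> B" "g z \<in> fst c"
  shows "pullback A \<pi> \<alpha> c (snd c (g z)) (\<lambda>j. frechet_derivative (snd c \<circ> g) (at z) (v j)) =
    pullback A f \<alpha> std_chart z v"
proof -
  let ?c = "chart_at A (f z)"
  note ch = chart_at_in[OF A, of "f z"]
  have "holomorphic_vec_on (snd ?c \<circ> \<pi> \<circ> chart_inv c) (snd c ` (fst c \<inter> \<pi> -` fst ?c))"
    using \<pi> c ch unfolding holomorphic_map_def by blast
  then have "frechet_derivative (snd ?c \<circ> (\<pi> \<circ> g)) (at z) u =
     differential c ?c \<pi> (snd c (g z)) (frechet_derivative (snd c \<circ> g) (at z) u)" for u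
    by (intro chart_chain_rule atlas_chart[OF B c(1)] holomorphic_map_continuous[OF g(1)] holomorphic_map_std[OF g(1) c(1)])
      (use c ch g in simp_all)
  moreover have "\<pi> \<circ> g = f" using g(2) by (simp add: fun_eq_iff)
  ultimately have "differential c ?c \<pi> (snd c (g z)) (frechet_derivative (snd c \<circ> g) (at z) u) =
      frechet_derivative (snd ?c \<circ> f) (at z) u" for u by simp
  then show ?thesis
    using atlas_chart(4)[OF B c(1) c(2)] g(2)[of z]
    by (simp add: pullback_def Let_def chart_inv_std differential_std)
qed

theorem theorem6p4:
  fixes A :: "('x::{t2_space, second_countable_topology}, 'n::finite) chart set"
    and \<Gamma> :: "('x, 'n) dform"
    and B :: "('y::{t2_space, second_countable_topology}, 'n) chart set"
    and \<pi> :: "'y \<Rightarrow> 'x"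
  assumes "CARD('n) = 2 * CARD('p::finite) + 1"
    and "complex_atlas A"
    and "compact (UNIV :: 'x set)"
    and "holomorphic_p_contact_structure CARD('p) A \<Gamma>"
    and "universal_covering B A \<pi>"
    and "p_contact_metrically_hyperbolic CARD('p) A \<Gamma> B \<pi>"
  shows "p_contact_hyperbolic TYPE('p) A \<Gamma>"
proof (rule ccontr)
  note A = assms(2) and X = assms(3) and cov = assms(5)
  have B: "complex_atlas B" and \<pi>: "holomorphic_map B A \<pi>" and cov\<pi>: "covering_space UNIV \<pi> UNIV"
    using cov unfolding universal_covering_def by blast+
  let ?p = "CARD('p)"
  assume "\<not> p_contact_hyperbolic TYPE('p) A \<Gamma>"
  then obtain f :: "complex ^ 'p \<Rightarrow> 'x" and x0 \<omega>' where f: "holomorphic_map {std_chart} A f"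
    and nd: "nondegenerate_at A f x0" and \<omega>': "hermitian_metric A \<omega>'" and growth: "subexponential_growth A \<omega>' f"
    and f\<Gamma>: "\<And>z v. pullback A f \<Gamma> std_chart z v = 0"
    unfolding p_contact_hyperbolic_def by blast
  obtain \<omega> \<Omega> \<beta> C where \<omega>: "hermitian_metric A \<omega>"
    and decomp: "\<And>c y v. c \<in> A \<Longrightarrow> y \<in> chart_image c \<Longrightarrow> wedge_power_fact ?p (\<omega> c y) v =
       \<i> ^ (?p\<^sup>2) * wedge ?p ?p (\<Gamma> c y) (conj_form (\<Gamma> c y)) v + \<Omega> c y v"
    and \<beta>: "smooth_form B (2 * ?p - 1) \<beta>"
    and bdd: "\<And>c y v. c \<in> B \<Longrightarrow> y \<in> chart_image c \<Longrightarrow>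
       (\<forall>j<2 * ?p - 1. bilin_of (pullback A \<pi> \<omega> c y) (v j) (v j) \<le> 1) \<Longrightarrow> cmod (\<beta> c y v) \<le> C"
    and exact: "\<And>c y v. c \<in> B \<Longrightarrow> y \<in> chart_image c \<Longrightarrow> pullback A \<pi> \<Omega> c y v = ext_deriv (2 * ?p - 1) (\<beta> c) y v"
    using assms(6) unfolding p_contact_metrically_hyperbolic_def bounded_form_def by metis
  obtain g where g: "continuous_on UNIV g" "\<And>z. \<pi> (g z) = f z"
    using covering_lift[OF cov\<pi> holomorphic_map_continuous[OF f]] by metis
  have hg: "holomorphic_map {std_chart} B g" by (rule lift_holomorphic[OF A f cov g])
  define w where "w = pullback A f \<omega> std_chart"
  define w' where "w' = pullback A f \<omega>' std_chart"
  define b where "b = pullback B g \<beta> std_chart"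
  have w: "semipositive_form (w z)" and w': "semipositive_form (w' z)" for z
    unfolding w_def w'_def by (rule pullback_metric_semipositive[OF A f \<omega>] pullback_metric_semipositive[OF A f \<omega>'])+
  \<comment> \<open>Both directions of the comparison are used: \<open>K1\<close> bounds the volume
    of \<open>w'\<close> by that of \<open>w\<close>, \<open>K2\<close> turns a bound on
    \<open>w\<close>-unit vectors into one on \<open>w'\<close>-unit vectors.\<close>
  obtain K1 where K1: "K1 > 0" "\<And>c x v. c \<in> A \<Longrightarrow> x \<in> fst c \<Longrightarrow>
      bilin_of (\<omega>' c (snd c x)) v v \<le> K1 * bilin_of (\<omega> c (snd c x)) v v"
    using hermitian_metrics_comparable[OF A X \<omega> \<omega>'] by metis
  obtain K2 where K2: "K2 > 0" "\<And>c x v. c \<in> A \<Longrightarrow> x \<in> fst c \<Longrightarrow>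
      bilin_of (\<omega> c (snd c x)) v v \<le> K2 * bilin_of (\<omega>' c (snd c x)) v v"
    using hermitian_metrics_comparable[OF A X \<omega>' \<omega>] by metis
  have ww': "bilin_of (w' z) v v \<le> K1 * bilin_of (w z) v v" "bilin_of (w z) v v \<le> K2 * bilin_of (w' z) v v" for z v
  proof -
    note ch = chart_at_in[OF A, of "f z"]
    show "bilin_of (w' z) v v \<le> K1 * bilin_of (w z) v v" "bilin_of (w z) v v \<le> K2 * bilin_of (w' z) v v"
      unfolding w_def w'_def pullback_metric_bilin[OF A f \<omega> ch] pullback_metric_bilin[OF A f \<omega>' ch]
      by (rule K1(2)[OF ch] K2(2)[OF ch])+
  qed
  have pull_b: "b z v = \<beta> c (snd c (g z)) (\<lambda>j. frechet_derivative (snd c \<circ> g) (at z) (v j))"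
    if "c \<in> B" "g z \<in> fst c" for z v c
    unfolding b_def by (rule pullback_eq_chart[OF B hg \<beta> that])
  have bound: "cmod (b z v) \<le> C * sqrt K2 ^ (2 * ?p - 1)"
    if v: "\<And>j. j < 2 * ?p - 1 \<Longrightarrow> bilin_of (w' z) (v j) (v j) \<le> 1" for z v
  proof -
    let ?c = "chart_at B (g z)"
    note ch = chart_at_in[OF B, of "g z"]
    let ?D = "frechet_derivative (snd ?c \<circ> g) (at z)"
    have "Vector_Spaces.linear (*s) (*s) ?D"
      using holomorphic_vec_has_derivative(2)[OF holomorphic_map_std[OF hg ch(1)]] ch by auto
    note L = bilin_of_compose[where L="?D", OF complex_linear_linear(2)[OF this]]
    have "w z = (\<lambda>v. pullback A \<pi> \<omega> ?c (snd ?c (g z)) (\<lambda>j. ?D (v j)))"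
      unfolding w_def by (rule ext) (rule pullback_composite[OF A B \<pi> hg g(2) ch, symmetric])
    then have eq: "bilin_of (pullback A \<pi> \<omega> ?c (snd ?c (g z))) (?D u) (?D u) = bilin_of (w z) u u" for u
      by (simp only: L)
    \<comment> \<open>Shrinks vectors of \<open>w'\<close>-length at most 1 to vectors of
      \<open>w\<close>-length at most 1; homogeneity of degree \<open>2 * ?p - 1\<close> accounts
      for the constant in the bound.\<close>
    define s where "s = 1 / sqrt K2"
    have s: "s > 0" "s * sqrt K2 = 1" "s\<^sup>2 * K2 = 1" using K2(1) by (simp_all add: s_def power_divide)
    have "cmod (b z (\<lambda>j. s *\<^sub>R v j)) \<le> C"
      unfolding pull_b[OF ch]
    proof (rule bdd[OF ch(1) atlas_chart(5)[OF B ch]], intro allI impI)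
      fix j assume j: "j < 2 * ?p - 1"
      have "bilin_of (w z) (s *\<^sub>R v j) (s *\<^sub>R v j) = s\<^sup>2 * bilin_of (w z) (v j) (v j)"
        by (simp add: bilin_scale[OF w] power2_eq_square)
      also have "\<dots> \<le> s\<^sup>2 * (K2 * bilin_of (w' z) (v j) (v j))" by (intro mult_left_mono ww') simp
      also have "\<dots> = bilin_of (w' z) (v j) (v j)" using s(3) by (simp flip: mult.assoc)
      also have "\<dots> \<le> 1" by (rule v[OF j])
      finally show "bilin_of (pullback A \<pi> \<omega> ?c (snd ?c (g z))) (?D (s *\<^sub>R v j)) (?D (s *\<^sub>R v j)) \<le> 1"
        unfolding eq .
    qed
    moreover have "b z (\<lambda>j. s *\<^sub>R v j) = (s ^ (2 * ?p - 1)) *\<^sub>R b z v"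
      using multilinear_scaleR[OF alternating_multilinear[OF pullback_multilinear[OF B hg \<beta>]], of z "\<lambda>_. s" v]
      by (simp add: b_def)
    ultimately have "s ^ (2 * ?p - 1) * cmod (b z v) \<le> C" using s by simp
    then have "(s ^ (2 * ?p - 1) * cmod (b z v)) * sqrt K2 ^ (2 * ?p - 1) \<le> C * sqrt K2 ^ (2 * ?p - 1)"
      using K2(1) by (intro mult_right_mono) auto
    moreover have "(s ^ (2 * ?p - 1) * cmod (b z v)) * sqrt K2 ^ (2 * ?p - 1) = (s * sqrt K2) ^ (2 * ?p - 1) * cmod (b z v)"
      by (simp add: power_mult_distrib)
    ultimately show ?thesis by (simp only: s(2) power_one mult_1)
  qed
  \<comment> \<open>The chain is \<open>d g^*\<beta> = g^* d\<beta> = g^* \<pi>^* \<Omega> = f^*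
    \<Omega>\<close>, and the last form is the volume form of \<open>w\<close>.\<close>
  have vol: "ext_deriv (2 * ?p - 1) b z std_frame = of_real (volume_density (w z))" for z
  proof -
    let ?c = "chart_at B (g z)"
    note ch = chart_at_in[OF B, of "g z"]
    let ?c' = "chart_at A (f z)"
    note ch' = chart_at_in[OF A, of "f z"]
    let ?D = "\<lambda>u. frechet_derivative (snd ?c' \<circ> f) (at z) u"
    have pull: "\<alpha> ?c' (snd ?c' (f z)) (\<lambda>j. ?D (v j)) = pullback A f \<alpha> std_chart z v" for \<alpha> v
      by (simp add: pullback_def Let_def chart_inv_std differential_std)
    have "ext_deriv (2 * ?p - 1) b z std_frame =
        ext_deriv (2 * ?p - 1) (\<beta> ?c) (snd ?c (g z)) (\<lambda>j. frechet_derivative (snd ?c \<circ> g) (at z) (std_frame j))"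
      unfolding b_def by (rule ext_deriv_pullback_form[OF B hg \<beta> ch])
    also have "\<dots> = pullback A \<pi> \<Omega> ?c (snd ?c (g z)) (\<lambda>j. frechet_derivative (snd ?c \<circ> g) (at z) (std_frame j))"
      by (rule exact[OF ch(1) atlas_chart(5)[OF B ch], symmetric])
    also have "\<dots> = pullback A f \<Omega> std_chart z std_frame"
      by (rule pullback_composite[OF A B \<pi> hg g(2) ch])
    also have "\<dots> = \<Omega> ?c' (snd ?c' (f z)) (\<lambda>j. ?D (std_frame j))" by (rule pull[symmetric])
    also have "\<dots> = wedge_power_fact ?p (\<omega> ?c' (snd ?c' (f z))) (\<lambda>j. ?D (std_frame j))"
    proof -
      \<comment> \<open>Here \<open>f^* \<Gamma> = 0\<close> enters and removes the contact term
        from the decomposition of the power of \<open>\<omega>\<close>.\<close>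
      have "wedge ?p ?p (\<Gamma> ?c' (snd ?c' (f z))) (conj_form (\<Gamma> ?c' (snd ?c' (f z)))) (\<lambda>j. ?D (std_frame j)) = 0"
        unfolding wedge_compose pull f\<Gamma> by (simp add: wedge_def)
      then show ?thesis using decomp[OF ch'(1) atlas_chart(5)[OF A ch'], of "\<lambda>j. ?D (std_frame j)"] by simp
    qed
    also have "\<dots> = wedge_power_fact ?p (w z) std_frame"
      unfolding wedge_power_fact_compose pull w_def ..
    also have "\<dots> = of_real (volume_density (w z))" by (rule wedge_power_eq_volume_density[OF w])
    finally show ?thesis .
  qed
  \<comment> \<open>The constant of \<open>volume_density_mono\<close>, divided by
    \<open>pairing_const\<close>.\<close>
  define K where "K = fact (2 * ?p) * K1 ^ ?p / pairing_const ?p"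
  have \<kappa>: "pairing_const ?p > 0" by (rule pairing_const_pos)
  have exact_le: "volume_density (w' z) \<le> K * Re (ext_deriv (2 * ?p - 1) b z std_frame)" for z
    unfolding vol using volume_density_mono[OF w w' _ ww'(1), of z] K1(1) \<kappa>
    by (simp add: K_def pos_le_divide_eq)
  have "(\<exists>C1>0. \<exists>r0>0. \<forall>t>r0.
        Re (sphere_integral t (\<lambda>z v. of_real (d_tau_length w' z) * area_form w' z v)) \<le> C1 * t * volume_of_ball w' t) \<and>
      (\<forall>C>0. Limsup at_top (\<lambda>r. ereal (r / C - ln (LINT t:{0..r}|lborel. volume_of_ball w' t))) = \<infinity>)"
    using growth unfolding subexponential_growth_def Let_def w'_def .
  then obtain C1 r0 where C1: "C1 > 0" and gr: "\<And>t. r0 < t \<Longrightarrow>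
      Re (sphere_integral t (\<lambda>z v. of_real (d_tau_length w' z) * area_form w' z v)) \<le> C1 * t * volume_of_ball w' t"
    and lim: "\<And>C. C > 0 \<Longrightarrow> Limsup at_top (\<lambda>r. ereal (r / C - ln (LINT t:{0..r}|lborel. volume_of_ball w' t))) = \<infinity>"
    by blast
  have "\<exists>C>0. Limsup at_top (\<lambda>r. ereal (r / C - ln (LINT t:{0..r}|lborel. volume_of_ball w' t))) \<noteq> \<infinity>"
  proof (rule volume_growth[OF w' _ _ _ _ bound exact_le _ gr C1])
    show "continuous_on UNIV (\<lambda>z. w' z v)" for v
      unfolding w'_def by (rule pullback_continuous[OF A f hermitian_metric_smooth[OF \<omega>']])
    show "alternating_form (2 * ?p - 1) (b z)" for z
      unfolding b_def by (rule pullback_multilinear[OF B hg \<beta>])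
    show "((\<lambda>z. b z v) has_derivative frechet_derivative (\<lambda>z. b z v) (at z)) (at z)" for z v
      unfolding b_def by (rule pullback_differentiable[OF B hg \<beta>])
    show "continuous_on UNIV (\<lambda>z. frechet_derivative (\<lambda>z. b z v) (at z) u)" for v u
      unfolding b_def by (rule pullback_form_derivative_continuous[OF B hg \<beta>])
    show "0 \<le> K" using K1(1) \<kappa> by (simp add: K_def)
    show "pos_def (bilin_of (w' x0))" unfolding w'_def by (rule pullback_metric_pos_def[OF A f \<omega>' nd])
  qed
  then show False using lim by blast
qed

end
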